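(* Let $N\ge 3$ and $1<p_1,p_2<N$, and let $f,g,a_1,a_2$ satisfy hypotheses $(\mathrm H_{f,g})$ and $(\mathrm H_a)$ (spelled out in the context). Then there exists a constant $R>0$ such that $$\max\{\|u\|_{L^\infty(\mathbb R^N)},\|v\|_{L^\infty(\mathbb R^N)}\}\le R$$ for every weak solution $(u,v)\in\mathcal D^{1,p_1}(\mathbb R^N)\times\mathcal D^{1,p_2}(\mathbb R^N)$ of the system $$-\Delta_{p_1}u=a_1(x)f(u,v)\ \text{ in }\mathbb R^N,\qquad -\Delta_{p_2}v=a_2(x)g(u,v)\ \text{ in }\mathbb R^N,\qquad u,v>0\ \text{ in }\mathbb R^N.$$
   Context: Notation: $\mathbb R^+=(0,+\infty)$; $\Delta_p w=\operatorname{div}(|\nabla w|^{p-2}\nabla w)$; $p_i^*=\frac{Np_i}{N-p_i}$; for $1<p<N$, $\mathcal D^{1,p}(\mathbb R^N)$ is the closure of $C_0^\infty(\mathbb R^N)$ with respect to the norm $\|\nabla w\|_{L^p(\mathbb R^N)}$; equivalently $\mathcal D^{1,p}(\mathbb R^N)=\{w\in L^{p^*}(\mathbb R^N):|\nabla w|\in L^p(\mathbb R^N)\}$ with $p^*=\frac{Np}{N-p}$. Hypothesis $(\mathrm H_{f,g})$: $f,g:\mathbb R^+\times\mathbb R^+\to\mathbb R^+$ are continuous and there exist $m_i,M_i>0$, $i=1,2$, such that for all $s,t\in\mathbb R^+$ $$m_1s^{\alpha_1}\le f(s,t)\le M_1s^{\alpha_1}(1+t^{\beta_1}),\qquad m_2t^{\beta_2}\le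 g(s,t)\le M_2(1+s^{\alpha_2})t^{\beta_2},$$ where the real exponents satisfy $-1<\alpha_1,\beta_2<0<\alpha_2,\beta_1$, $\ \alpha_1+\alpha_2<p_1-1$, $\ \beta_1+\beta_2<p_2-1$, and $$\beta_1<\frac{p_2^*}{p_1^*}\min\{p_1-1,p_1^*-p_1\},\qquad \alpha_2<\frac{p_1^*}{p_2^*}\min\{p_2-1,p_2^*-p_2\}.$$ Hypothesis $(\mathrm H_a)$: for $i=1,2$, $a_i:\mathbb R^N\to\mathbb R$, $a_i(x)>0$ a.e. in $\mathbb R^N$ and $a_i\in L^1(\mathbb R^N)\cap L^{\zeta_i}(\mathbb R^N)$, where the positive exponents $\zeta_i$ satisfy $\frac1{\zeta_1}\le 1-\frac{p_1}{p_1^*}-\frac{\beta_1}{p_2^*}$ and $\frac1{\zeta_2}\le 1-\frac{p_2}{p_2^*}-\frac{\alpha_2}{p_1^*}$. Weak solution: a pair $(u,v)\in\mathcal D^{1,p_1}(\mathbb R^N)\times\mathcal D^{1,p_2}(\mathbb R^N)$ with $u,v>0$ a.e. in $\mathbb R^N$ and $$\int_{\mathbb R^N}|\nabla u|^{p_1-2}\nabla u\cdot\nabla\varphi\,dx=\int_{\mathbb R^N}a_1f(u,v)\varphi\,dx,\qquad \int_{\mathbb R^N}|\nabla v|^{p_2-2}\nabla v\cdot\nabla\psi\,dx=\int_{\mathbb R^N}a_2g(u,v)\psi\,dx$$ for every $(\varphi,\psi)\in\mathcal D^{1,p_1}(\mathbb R^N)\times\mathcal D^{1,p_2}(\mathbb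 R^N)$. *)

theory Defs
  imports "HOL-Analysis.Analysis" "HOL-Probability.Essential_Supremum"
begin

text \<open>
  Throughout, \<open>\<real>\<^sup>N\<close> is a type \<open>'a\<close> of class \<^class>\<open>euclidean_space\<close> with \<open>N = DIM('a)\<close>. Integration is with
  respect to \<^const>\<open>lebesgue\<close>; its completeness makes measurability and integrability of compositions
  such as \<open>f (u x) (v x)\<close> independent of the values of \<open>f\<close> outside \<open>{0<..} \<times> {0<..}\<close> as soon as
  \<open>u\<close> and \<open>v\<close> are positive almost everywhere.
\<close>

definition critical_exponent :: "nat \<Rightarrow> real \<Rightarrow> real" where
  "critical_exponent n p = real n * p / (real n - p)"

text \<open>Lebesgue spaces and norms for finite exponents, on functions rather than on classes modulo
  almost everywhere equality.\<close>

definition Lp_space :: "real \<Rightarrow> ('a::euclidean_space \<Rightarrow> 'b::euclidean_space) set" where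
  "Lp_space p = {w \<in> borel_measurable lebesgue. integrable lebesgue (\<lambda>x. norm (w x) powr p)}"

definition Lp_norm :: "real \<Rightarrow> ('a::euclidean_space \<Rightarrow> 'b::euclidean_space) \<Rightarrow> real" where
  "Lp_norm p w = (\<integral>x. norm (w x) powr p \<partial>lebesgue) powr (1 / p)"

definition Linf_norm :: "('a::euclidean_space \<Rightarrow> real) \<Rightarrow> ereal" where
  "Linf_norm w = esssup lebesgue (\<lambda>x. ereal \<bar>w x\<bar>)"

primrec Ck :: "nat \<Rightarrow> ('a::euclidean_space \<Rightarrow> real) \<Rightarrow> bool" where
  "Ck 0 \<phi> \<longleftrightarrow> continuous_on UNIV \<phi>"
| "Ck (Suc k) \<phi> \<longleftrightarrow>
     (\<forall>x. \<phi> differentiable at x) \<and> (\<forall>i\<in>Basis. Ck k (\<lambda>x. frechet_derivative \<phi> (at x) i))"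

definition test_function :: "('a::euclidean_space \<Rightarrow> real) \<Rightarrow> bool" where
  "test_function \<phi> \<longleftrightarrow> (\<forall>k. Ck k \<phi>) \<and> compact (closure {x. \<phi> x \<noteq> 0})"

definition grad :: "('a::euclidean_space \<Rightarrow> real) \<Rightarrow> 'a \<Rightarrow> 'a" where
  "grad \<phi> x = (\<Sum>i\<in>Basis. frechet_derivative \<phi> (at x) i *\<^sub>R i)"

definition has_weak_gradient :: "('a::euclidean_space \<Rightarrow> real) \<Rightarrow> ('a \<Rightarrow> 'a) \<Rightarrow> bool" where
  "has_weak_gradient w G \<longleftrightarrow>
     (\<forall>K. compact K \<longrightarrow> w absolutely_integrable_on K \<and> G absolutely_integrable_on K) \<and>
     (\<forall>\<phi>. test_function \<phi> \<longrightarrow>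
        (\<integral>x. w x *\<^sub>R grad \<phi> x \<partial>lebesgue) = - (\<integral>x. \<phi> x *\<^sub>R G x \<partial>lebesgue))"

text \<open>Weak gradients are unique up to null sets, so nothing below depends on the choice.\<close>

definition weak_grad :: "('a::euclidean_space \<Rightarrow> real) \<Rightarrow> 'a \<Rightarrow> 'a" where
  "weak_grad w = (SOME G. has_weak_gradient w G)"

text \<open>
  The space \<open>\<D>\<^sup>1\<^sup>,\<^sup>p(\<real>\<^sup>N)\<close> (for \<open>1 < p < N\<close>): the closure of the test functions with respect to the norm
  \<open>\<parallel>\<nabla>w\<parallel>\<^sub>p\<close>, realised inside the functions in \<open>L\<^sup>p\<^sup>*\<close> whose weak gradient exists and lies in \<open>L\<^sup>p\<close>.
  On that ambient space \<open>\<parallel>\<nabla>w\<parallel>\<^sub>p\<close> is a norm, since \<open>L\<^sup>p\<^sup>*\<close> contains no nonzero constant.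
\<close>

definition D1p_space :: "real \<Rightarrow> ('a::euclidean_space \<Rightarrow> real) set" where
  "D1p_space p =
     {w \<in> Lp_space (critical_exponent DIM('a) p).
        (\<exists>G. has_weak_gradient w G) \<and> weak_grad w \<in> Lp_space p \<and>
        (\<forall>\<epsilon>>0. \<exists>\<phi>. test_function \<phi> \<and> Lp_norm p (\<lambda>x. grad \<phi> x - weak_grad w x) < \<epsilon>)}"

text \<open>
  \<open>- \<Delta>\<^sub>p w = h\<close> weakly, tested against all of \<open>\<D>\<^sup>1\<^sup>,\<^sup>p\<close>. The right-hand integral is required to exist,
  because the Bochner integral of a non-integrable function is \<open>0\<close>; the left-hand one exists by
  Hoelder's inequality. For \<open>p < 2\<close> the vector field is \<open>0\<close> where the gradient of \<open>w\<close> vanishes.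
\<close>

definition weak_p_Laplace_eq ::
    "real \<Rightarrow> ('a::euclidean_space \<Rightarrow> real) \<Rightarrow> ('a \<Rightarrow> real) \<Rightarrow> bool" where
  "weak_p_Laplace_eq p w h \<longleftrightarrow>
     (\<forall>\<phi>\<in>D1p_space p.
        integrable lebesgue (\<lambda>x. h x * \<phi> x) \<and>
        (\<integral>x. (norm (weak_grad w x) powr (p - 2) *\<^sub>R weak_grad w x) \<bullet> weak_grad \<phi> x \<partial>lebesgue)
          = (\<integral>x. h x * \<phi> x \<partial>lebesgue))"

definition weak_solution ::
    "real \<Rightarrow> real \<Rightarrow> ('a::euclidean_space \<Rightarrow> real) \<Rightarrow> ('a \<Rightarrow> real) \<Rightarrow>
     (real \<Rightarrow> real \<Rightarrow> real) \<Rightarrow> (real \<Rightarrow> real \<Rightarrow> real) \<Rightarrow> ('a \<Rightarrow> real) \<Rightarrow> ('a \<Rightarrow> real) \<Rightarrow> bool" where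
  "weak_solution p1 p2 a1 a2 f g u v \<longleftrightarrow>
     u \<in> D1p_space p1 \<and> v \<in> D1p_space p2 \<and>
     (AE x in lebesgue. u x > 0) \<and> (AE x in lebesgue. v x > 0) \<and>
     weak_p_Laplace_eq p1 u (\<lambda>x. a1 x * f (u x) (v x)) \<and>
     weak_p_Laplace_eq p2 v (\<lambda>x. a2 x * g (u x) (v x))"

definition hypothesis_fg ::
    "nat \<Rightarrow> real \<Rightarrow> real \<Rightarrow> real \<Rightarrow> real \<Rightarrow> real \<Rightarrow> real \<Rightarrow>
     (real \<Rightarrow> real \<Rightarrow> real) \<Rightarrow> (real \<Rightarrow> real \<Rightarrow> real) \<Rightarrow> bool" where
  "hypothesis_fg N p1 p2 \<alpha>1 \<beta>1 \<alpha>2 \<beta>2 f g \<longleftrightarrow>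
     continuous_on ({0<..} \<times> {0<..}) (\<lambda>(s, t). f s t) \<and>
     continuous_on ({0<..} \<times> {0<..}) (\<lambda>(s, t). g s t) \<and>
     (\<forall>s>0. \<forall>t>0. f s t > 0 \<and> g s t > 0) \<and>
     (\<exists>m1>0. \<exists>M1>0. \<exists>m2>0. \<exists>M2>0. \<forall>s>0. \<forall>t>0.
        m1 * s powr \<alpha>1 \<le> f s t \<and> f s t \<le> M1 * s powr \<alpha>1 * (1 + t powr \<beta>1) \<and>
        m2 * t powr \<beta>2 \<le> g s t \<and> g s t \<le> M2 * (1 + s powr \<alpha>2) * t powr \<beta>2) \<and>
     -1 < \<alpha>1 \<and> \<alpha>1 < 0 \<and> -1 < \<beta>2 \<and> \<beta>2 < 0 \<and> 0 < \<alpha>2 \<and> 0 < \<beta>1 \<and>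
     \<alpha>1 + \<alpha>2 < p1 - 1 \<and> \<beta>1 + \<beta>2 < p2 - 1 \<and>
     \<beta>1 < critical_exponent N p2 / critical_exponent N p1 *
            min (p1 - 1) (critical_exponent N p1 - p1) \<and>
     \<alpha>2 < critical_exponent N p1 / critical_exponent N p2 *
            min (p2 - 1) (critical_exponent N p2 - p2)"

definition hypothesis_a ::
    "real \<Rightarrow> real \<Rightarrow> real \<Rightarrow> real \<Rightarrow> ('a::euclidean_space \<Rightarrow> real) \<Rightarrow> ('a \<Rightarrow> real) \<Rightarrow> bool" where
  "hypothesis_a p1 p2 \<beta>1 \<alpha>2 a1 a2 \<longleftrightarrow>
     (AE x in lebesgue. a1 x > 0) \<and> (AE x in lebesgue. a2 x > 0) \<and>
     (\<exists>\<zeta>1>0. \<exists>\<zeta>2>0.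
        a1 \<in> Lp_space 1 \<inter> Lp_space \<zeta>1 \<and> a2 \<in> Lp_space 1 \<inter> Lp_space \<zeta>2 \<and>
        1 / \<zeta>1 \<le> 1 - p1 / critical_exponent DIM('a) p1 - \<beta>1 / critical_exponent DIM('a) p2 \<and>
        1 / \<zeta>2 \<le> 1 - p2 / critical_exponent DIM('a) p2 - \<alpha>2 / critical_exponent DIM('a) p1)"

end

theory Submission
  imports Defs "HOL-Real_Asymp.Real_Asymp"
begin

text \<open>
  Testing the equations with the truncations \<open>(u - k)\<^sup>+\<close> and \<open>(v - k)\<^sup>+\<close> for \<open>k \<ge> 1/2\<close> removes the
  singular factors, because negative powers are bounded on \<open>u > 1/2\<close> and \<open>v > 1/2\<close>. Combined with
  Sobolev's inequality this gives
  \<open>\<parallel>(u - k)\<^sup>+\<parallel>\<^bsub>p*\<^esub> \<le> K (\<integral> a (1 + v\<^sup>\<beta>) (u - k)\<^sup>+)\<^bsup>1/p\<^esup>\<close> and its counterpart for \<open>v\<close>; everything else is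
  drawn from these two families of inequalities. For \<open>k = 1/2\<close> they bound both norms, because the
  restrictions on \<open>\<beta>\<^sub>1\<close> and \<open>\<alpha>\<^sub>2\<close> make the coupling subcritical. The integrability of \<open>a\<close> may be
  critical, so that at first only a linear level set inequality
  \<open>|{u > h}| \<le> C (h - k)\<^bsup>-p*\<^esup> |{u > k}|\<close> results; but it makes the level sets decay faster than
  any power and yields bounds for higher moments. Feeding those into the other equation makes the
  level set inequality superlinear, and Stampacchia's lemma gives the bound in \<open>L\<^sup>\<infinity>\<close>.

  The truncations are admissible since \<open>\<D>\<^sup>1\<^sup>,\<^sup>p\<close> is closed under smooth Lipschitz maps vanishing at \<open>0\<close>,
  and \<open>(s - k)\<^sup>+\<close> is a limit of such maps whose derivatives converge boundedly. Sobolev's inequality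
  comes from the Gagliardo--Nirenberg argument: integrate \<open>\<Prod>\<^sub>i F\<^sub>i\<^bsup>1/(N-1)\<^esup>\<close>, with \<open>F\<^sub>i\<close> the line
  integral in direction \<open>i\<close>, one coordinate at a time using Hoelder's inequality.
\<close>

section \<open>Hoelder's inequality for finitely many functions\<close>

text \<open>The order of quantifiers shapes the second half: R may depend on the data but not on the
  solution, so no norm of u or v itself may enter a constant. What can be bounded uniformly are
  norms of truncations, measures of level sets above 1 and moments over the set where a component
  exceeds 1. Hence each lemma there fixes its constant before it quantifies over u and v.

  The arithmetic of the critical case: if v has a bounded moment of order r, Hoelder's inequality
  bounds |{u > h}| by a multiple of |{u > k}| to the power \<delta> = (1 - 1/\<zeta> - 1/P -
  \<beta>/r) P / (p - 1). The hypothesis on \<zeta> says exactly that \<delta> \<ge> 1 for r = Q.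
  Every r > Q gives \<delta> > 1; the proof takes r = 2 Q.

  In the first half the obstacle is that \<open>D1p_space\<close> provides approximation of
  gradients alone, while truncating a limit of test functions requires convergence of the functions
  as well. Passing between the two descriptions of the space is the purpose of
  \<open>D1p_imp_pair\<close> and \<open>D1p_pair_imp_D1p\<close>.\<close>

lemma weighted_AM_GM:
  fixes a y :: "'i \<Rightarrow> real"
  assumes "finite I" "\<And>i. i \<in> I \<Longrightarrow> a i > 0" "(\<Sum>i\<in>I. a i) = 1" "\<And>i. i \<in> I \<Longrightarrow> y i \<ge> 0"
  shows "(\<Prod>i\<in>I. y i powr a i) \<le> (\<Sum>i\<in>I. a i * y i)"
proof (cases "\<exists>i\<in>I. y i = 0")
  case True
  then obtain j where j: "j \<in> I" "y j = 0" by blast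
  then have "(\<Prod>i\<in>I. y i powr a i) = 0"
    using assms(1) by (auto intro!: prod_zero bexI[of _ j])
  moreover have "0 \<le> (\<Sum>i\<in>I. a i * y i)"
    using assms(2,4) by (intro sum_nonneg mult_nonneg_nonneg) (auto simp: less_imp_le)
  ultimately show ?thesis by linarith
next
  case False
  then have pos: "y i > 0" if "i \<in> I" for i using assms(4) that by (metis less_le)
  have ne: "I \<noteq> {}" using assms(3) by auto
  have "(\<Prod>i\<in>I. y i powr a i) = (\<Prod>i\<in>I. exp (a i * ln (y i)))"
    by (intro prod.cong refl) (use pos in \<open>force simp: powr_def\<close>)
  also have "\<dots> = exp (\<Sum>i\<in>I. a i * ln (y i))"
    using assms(1) by (simp add: exp_sum)
  also have "\<dots> \<le> (\<Sum>i\<in>I. a i * exp (ln (y i)))"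
    using convex_on_sum[OF assms(1) ne exp_convex, where a=a and y="\<lambda>i. ln (y i)"] assms(2,3)
    by (simp add: less_imp_le)
  also have "\<dots> = (\<Sum>i\<in>I. a i * y i)"
    using pos by (intro sum.cong) auto
  finally show ?thesis .
qed

text \<open>A total power on \<open>ennreal\<close>. Since \<open>0 powr a = 0\<close>, zero and
  \<open>top\<close> are fixed by every exponent, and Hoelder's inequality can be stated without
  finiteness hypotheses.\<close>

definition epow :: "ennreal \<Rightarrow> real \<Rightarrow> ennreal" where
  "epow x a = (if x = top then top else ennreal (enn2real x powr a))"

lemma epow_ennreal: "r \<ge> 0 \<Longrightarrow> epow (ennreal r) a = ennreal (r powr a)"
  by (simp add: epow_def)

lemma epow_0 [simp]: "epow 0 a = 0"
  by (simp add: epow_def)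

lemma epow_top [simp]: "epow top a = top"
  by (simp add: epow_def)

lemma epow_eq_0_iff [simp]: "epow x a = 0 \<longleftrightarrow> x = 0"
  by (cases x) (auto simp: epow_def ennreal_eq_0_iff enn2real_eq_0_iff)

lemma epow_eq_top_iff [simp]: "epow x a = top \<longleftrightarrow> x = top"
  by (cases x) (auto simp: epow_def)

lemma measurable_epow [measurable]: "(\<lambda>x. epow x a) \<in> borel_measurable borel"
  unfolding epow_def by measurable

lemma epow_mono:
  assumes "x \<le> y" "a \<ge> 0" shows "epow x a \<le> epow y a"
  using assms by (cases x; cases y) (auto simp: epow_def ennreal_le_iff top_unique intro!: ennreal_leI powr_mono2)

text \<open>Divide each factor by its integral and apply the weighted AM-GM inequality pointwise;
  the normalised right-hand side integrates to the sum of the weights, which is 1.\<close>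

theorem nn_integral_Holder:
  fixes f :: "'i \<Rightarrow> 'm \<Rightarrow> ennreal"
  assumes "finite I" "\<And>i. i \<in> I \<Longrightarrow> a i > 0" "(\<Sum>i\<in>I. a i) = 1"
    and [measurable]: "\<And>i. i \<in> I \<Longrightarrow> f i \<in> borel_measurable M"
  shows "(\<integral>\<^sup>+x. (\<Prod>i\<in>I. epow (f i x) (a i)) \<partial>M) \<le> (\<Prod>i\<in>I. epow (\<integral>\<^sup>+x. f i x \<partial>M) (a i))"
proof -
  define c where "c i = (\<integral>\<^sup>+x. f i x \<partial>M)" for i
  \<comment> \<open>Vanishing integrals come first: in \<open>ennreal\<close> the product of 0 and
    \<open>top\<close> is 0, so an infinite factor makes the right-hand side infinite only when no
    other factor vanishes.\<close>
  consider (zero) j where "j \<in> I" "c j = 0" | (top) j where "j \<in> I" "c j = top" "\<And>i. i \<in> I \<Longrightarrow> c i \<noteq> 0"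
    | (fin) "\<And>i. i \<in> I \<Longrightarrow> c i \<noteq> 0" "\<And>i. i \<in> I \<Longrightarrow> c i \<noteq> top"
    by blast
  then show ?thesis
  proof cases
    case zero
    then have "AE x in M. f j x = 0"
      using nn_integral_0_iff_AE[of "f j" M] by (simp add: c_def)
    then have "AE x in M. (\<Prod>i\<in>I. epow (f i x) (a i)) = 0"
      by (rule AE_mp) (use zero assms(1) in \<open>auto intro!: AE_I2 prod_zero bexI[of _ j]\<close>)
    then have "(\<integral>\<^sup>+x. (\<Prod>i\<in>I. epow (f i x) (a i)) \<partial>M) = (\<integral>\<^sup>+x. 0 \<partial>M)"
      by (rule nn_integral_cong_AE)
    then show ?thesis by simp
  next
    case top
    then have "(\<Prod>i\<in>I. epow (c i) (a i)) = top"
      using assms(1) by (subst ennreal_prod_eq_top) (auto simp: )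
    then show ?thesis by (simp add: c_def)
  next
    case fin
    define d where "d i = enn2real (c i)" for i
    have d: "c i = ennreal (d i)" "d i > 0" if "i \<in> I" for i
      using fin that by (auto simp: d_def enn2real_positive_iff less_top zero_less_iff_neq_zero)
    define D where "D = (\<Prod>i\<in>I. d i powr a i)"
    have D: "D \<ge> 0" by (auto simp: D_def intro!: prod_nonneg)
    have pw: "(\<Prod>i\<in>I. epow (f i x) (a i)) \<le> ennreal D * (\<Sum>i\<in>I. ennreal (a i / d i) * f i x)" for x
    proof (cases "\<exists>j\<in>I. f j x = top")
      case True
      then obtain j where j: "j \<in> I" "f j x = top" by blast
      have "ennreal (a j / d j) * f j x = top"
        using j d[of j] assms(2)[of j] by (simp add: ennreal_mult_top)
      then have "(\<Sum>i\<in>I. ennreal (a i / d i) * f i x) = top"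
        using j assms(1) by (simp add: sum.remove)
      moreover have "D > 0" unfolding D_def by (intro prod_pos) (metis d(2) powr_gt_zero less_irrefl)
      ultimately show ?thesis by (simp add: ennreal_mult_top)
    next
      case False
      define y where "y i = enn2real (f i x)" for i
      have y: "f i x = ennreal (y i)" "y i \<ge> 0" if "i \<in> I" for i
        using False that by (auto simp: y_def less_top)
      have "(\<Prod>i\<in>I. epow (f i x) (a i)) = (\<Prod>i\<in>I. ennreal (y i powr a i))"
        by (intro prod.cong) (auto simp: y epow_ennreal)
      also have "\<dots> = ennreal (\<Prod>i\<in>I. y i powr a i)"
        by (intro prod_ennreal) auto
      also have "(\<Prod>i\<in>I. y i powr a i) = D * (\<Prod>i\<in>I. (y i / d i) powr a i)"
        unfolding D_def prod.distrib[symmetric]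
      proof (intro prod.cong refl)
        fix i assume i: "i \<in> I"
        show "y i powr a i = d i powr a i * (y i / d i) powr a i"
          using y[OF i] d[OF i] by (simp add: powr_divide)
      qed
      also have "\<dots> \<le> D * (\<Sum>i\<in>I. a i * (y i / d i))"
        using weighted_AM_GM[OF assms(1-3), of "\<lambda>i. y i / d i"] y d D
        by (intro mult_left_mono) (auto simp: less_imp_le)
      also have "ennreal \<dots> = ennreal D * (\<Sum>i\<in>I. ennreal (a i / d i) * f i x)"
      proof -
        have *: "ennreal (a i / d i) * f i x = ennreal (a i * (y i / d i))" if "i \<in> I" for i
          using y[OF that] d[OF that] assms(2)[OF that] by (simp add: ennreal_mult'[symmetric] less_imp_le)
        have "a i * (y i / d i) \<ge> 0" if "i \<in> I" for i
          using y[OF that] d[OF that] assms(2)[OF that] by (simp add: less_imp_le)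
        then show ?thesis using D by (simp add: ennreal_mult' * sum_ennreal)
      qed
      finally show ?thesis by (simp add: ennreal_leI)
    qed
    have "(\<integral>\<^sup>+x. (\<Prod>i\<in>I. epow (f i x) (a i)) \<partial>M) \<le> (\<integral>\<^sup>+x. ennreal D * (\<Sum>i\<in>I. ennreal (a i / d i) * f i x) \<partial>M)"
      by (intro nn_integral_mono pw)
    also have "\<dots> = ennreal D * (\<Sum>i\<in>I. ennreal (a i / d i) * c i)"
      by (simp add: nn_integral_cmult nn_integral_sum c_def)
    also have "(\<Sum>i\<in>I. ennreal (a i / d i) * c i) = (\<Sum>i\<in>I. ennreal (a i))"
    proof (intro sum.cong refl)
      fix i assume i: "i \<in> I"
      show "ennreal (a i / d i) * c i = ennreal (a i)"
        using d[OF i] assms(2)[OF i] by (simp add: ennreal_mult'[symmetric] less_imp_le)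
    qed
    also have "\<dots> = ennreal (\<Sum>i\<in>I. a i)"
      by (intro sum_ennreal) (use assms(2) in \<open>auto simp: less_imp_le\<close>)
    also have "ennreal D * ennreal (\<Sum>i\<in>I. a i) = (\<Prod>i\<in>I. epow (c i) (a i))"
      using d by (simp add: assms(3) D_def prod_ennreal[symmetric] epow_ennreal less_imp_le)
    finally show ?thesis by (simp add: c_def)
  qed
qed

section \<open>Integration over grid lines\<close>

definition line_int :: "'a::euclidean_space \<Rightarrow> ('a \<Rightarrow> ennreal) \<Rightarrow> 'a \<Rightarrow> ennreal" where
  "line_int j f x = (\<integral>\<^sup>+t. f (x + t *\<^sub>R j) \<partial>lborel)"

text \<open>A list of directions lets Fubini's theorem proceed by recursion; the order is immaterial
  because line integrals commute.\<close>

primrec line_ints :: "'a::euclidean_space list \<Rightarrow> ('a \<Rightarrow> ennreal) \<Rightarrow> 'a \<Rightarrow> ennreal" where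
  "line_ints [] f = f"
| "line_ints (j # js) f = line_int j (line_ints js f)"

lemma measurable_line_int [measurable]:
  fixes f :: "'a::euclidean_space \<Rightarrow> ennreal"
  assumes [measurable]: "f \<in> borel_measurable borel"
  shows "line_int j f \<in> borel_measurable borel"
  unfolding line_int_def[abs_def] by measurable

lemma measurable_line_ints [measurable]:
  fixes f :: "'a::euclidean_space \<Rightarrow> ennreal"
  assumes [measurable]: "f \<in> borel_measurable borel"
  shows "line_ints js f \<in> borel_measurable borel"
  by (induction js) (simp_all add: assms measurable_line_int)

lemma line_int_mono: "(\<And>x. f x \<le> g x) \<Longrightarrow> line_int j f x \<le> line_int j g x"
  unfolding line_int_def by (intro nn_integral_mono)

lemma line_int_translate:
  assumes [measurable]: "f \<in> borel_measurable borel"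
  shows "line_int j f (x + s *\<^sub>R j) = line_int j f x"
proof -
  have "line_int j f x = (\<integral>\<^sup>+t. f (x + (s + 1 * t) *\<^sub>R j) \<partial>lborel)"
    unfolding line_int_def by (subst nn_integral_real_affine[where c=1 and t=s]) simp_all
  then show ?thesis by (simp add: line_int_def algebra_simps)
qed

lemma line_int_commute:
  assumes [measurable]: "f \<in> borel_measurable borel"
  shows "line_int i (line_int j f) = line_int j (line_int i f)"
proof
  fix x
  have "line_int i (line_int j f) x = (\<integral>\<^sup>+t. \<integral>\<^sup>+s. f (x + t *\<^sub>R i + s *\<^sub>R j) \<partial>lborel \<partial>lborel)"
    by (simp add: line_int_def)
  also have "\<dots> = (\<integral>\<^sup>+s. \<integral>\<^sup>+t. f (x + t *\<^sub>R i + s *\<^sub>R j) \<partial>lborel \<partial>lborel)"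
    by (rule lborel_pair.Fubini') measurable
  finally show "line_int i (line_int j f) x = line_int j (line_int i f) x"
    by (simp add: line_int_def algebra_simps)
qed

lemma line_int_line_ints:
  assumes [measurable]: "f \<in> borel_measurable borel"
  shows "line_int j (line_ints js f) = line_ints js (line_int j f)"
proof (induction js)
  case (Cons i js)
  have "line_int j (line_ints (i # js) f) = line_int i (line_int j (line_ints js f))"
    by (simp add: line_int_commute)
  with Cons show ?case by simp
qed simp

text \<open>Induction over the directions already integrated. Factor i starts with direction i
  integrated out, so for i in \<open>js\<close> it has seen exactly the directions
  \<open>js\<close>, and otherwise one more. When j is added, factor j is constant along j and
  leaves the integral; the other N - 1 factors carry the exponent 1/(N - 1) each, so their exponents
  sum to 1 as Hoelder's inequality requires.\<close>

lemma grid_lines: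
  fixes f :: "'a::euclidean_space \<Rightarrow> ennreal"
  assumes [measurable]: "f \<in> borel_measurable borel" and dim: "DIM('a) \<ge> 2"
    and js: "distinct js" "set js \<subseteq> Basis"
  defines "p \<equiv> 1 / (real DIM('a) - 1)"
  shows "line_ints js (\<lambda>x. \<Prod>i\<in>Basis. epow (line_int i f x) p) x
    \<le> (\<Prod>i\<in>Basis. epow (if i \<in> set js then line_ints js f x else line_ints js (line_int i f) x) p)"
  using js
proof (induction js arbitrary: x)
  case (Cons j js)
  have jB: "j \<in> Basis" and jn: "j \<notin> set js" using Cons.prems by auto
  define H where "H i = (if i \<in> set js then line_ints js f else line_ints js (line_int i f))" for i
  have [measurable]: "H i \<in> borel_measurable borel" for i by (simp add: H_def)
  have Hj: "H j (y + t *\<^sub>R j) = H j y" for y t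
    using jn line_int_line_ints[of f j js] line_int_translate[of "line_ints js f" j y t] by (simp add: H_def)
  have p: "p > 0" using dim by (simp add: p_def)
  have sum1: "(\<Sum>i\<in>Basis - {j}. p) = 1"
    using jB dim by (simp add: p_def card_Diff_singleton of_nat_diff)
  have "line_ints (j # js) (\<lambda>x. \<Prod>i\<in>Basis. epow (line_int i f x) p) x
      \<le> line_int j (\<lambda>x. \<Prod>i\<in>Basis. epow (H i x) p) x"
    unfolding line_ints.simps
  proof (intro line_int_mono)
    fix y
    have "H i y = (if i \<in> set js then line_ints js f y else line_ints js (line_int i f) y)" for i
      by (simp add: H_def)
    then show "line_ints js (\<lambda>x. \<Prod>i\<in>Basis. epow (line_int i f x) p) y \<le> (\<Prod>i\<in>Basis. epow (H i y) p)"
      using Cons by simp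
  qed
  also have "\<dots> = (\<integral>\<^sup>+t. epow (H j x) p * (\<Prod>i\<in>Basis - {j}. epow (H i (x + t *\<^sub>R j)) p) \<partial>lborel)"
    using jB by (simp add: line_int_def prod.remove[of Basis j] Hj)
  also have "\<dots> = epow (H j x) p * (\<integral>\<^sup>+t. (\<Prod>i\<in>Basis - {j}. epow (H i (x + t *\<^sub>R j)) p) \<partial>lborel)"
    by (rule nn_integral_cmult) measurable
  also have "\<dots> \<le> epow (H j x) p * (\<Prod>i\<in>Basis - {j}. epow (line_int j (H i) x) p)"
    unfolding line_int_def
    by (intro mult_left_mono nn_integral_Holder) (use p sum1 in auto)
  also have "H j x = line_ints (j # js) f x"
    using jn line_int_line_ints[of f j js] by (simp add: H_def)
  also have "epow (line_ints (j # js) f x) p * (\<Prod>i\<in>Basis - {j}. epow (line_int j (H i) x) p) =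
     (\<Prod>i\<in>Basis. epow (if i \<in> set (j # js) then line_ints (j # js) f x else line_ints (j # js) (line_int i f) x) p)"
  proof -
    have *: "line_int j (H i) x = (if i \<in> set js then line_ints (j # js) f x else line_ints (j # js) (line_int i f) x)" for i
      by (simp add: H_def)
    show ?thesis
      unfolding * prod.remove[OF finite_Basis jB] by (intro arg_cong2[of _ _ _ _ "(*)"] prod.cong) auto
  qed
  finally show ?case .
qed simp

text \<open>The base point x is kept general because peeling off the direction j moves its
  contribution into the base point.\<close>

lemma nn_integral_line_ints_aux:
  fixes f :: "'a::euclidean_space \<Rightarrow> ennreal"
  assumes [measurable]: "f \<in> borel_measurable borel" and "distinct js"
  shows "(\<integral>\<^sup>+z. f (x + (\<Sum>b\<in>set js. z b *\<^sub>R b)) \<partial>(\<Pi>\<^sub>M b\<in>set js. lborel)) = line_ints js f x"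
  using assms(2)
proof (induction js arbitrary: x)
  case Nil
  then show ?case by (simp add: PiM_empty nn_integral_count_space_finite)
next
  case (Cons j js)
  interpret product_sigma_finite "\<lambda>_::'a. lborel :: real measure" by standard
  have "(\<integral>\<^sup>+z. f (x + (\<Sum>b\<in>set (j # js). z b *\<^sub>R b)) \<partial>(\<Pi>\<^sub>M b\<in>set (j # js). lborel)) =
    (\<integral>\<^sup>+y. (\<integral>\<^sup>+z. f (x + (\<Sum>b\<in>insert j (set js). (z(j := y)) b *\<^sub>R b)) \<partial>(\<Pi>\<^sub>M b\<in>set js. lborel)) \<partial>lborel)"
    using Cons.prems by (simp, subst product_nn_integral_insert_rev) simp_all
  also have "\<dots> = (\<integral>\<^sup>+y. (\<integral>\<^sup>+z. f ((x + y *\<^sub>R j) + (\<Sum>b\<in>set js. z b *\<^sub>R b)) \<partial>(\<Pi>\<^sub>M b\<in>set js. lborel)) \<partial>lborel)"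
  proof (intro nn_integral_cong arg_cong[of _ _ f])
    fix y z
    have "(\<Sum>b\<in>set js. (z(j := y)) b *\<^sub>R b) = (\<Sum>b\<in>set js. z b *\<^sub>R b)"
      using Cons.prems by (intro sum.cong) auto
    then show "x + (\<Sum>b\<in>insert j (set js). (z(j := y)) b *\<^sub>R b) = x + y *\<^sub>R j + (\<Sum>b\<in>set js. z b *\<^sub>R b)"
      using Cons.prems by simp
  qed
  also have "\<dots> = line_ints (j # js) f x"
    using Cons by (simp add: line_int_def)
  finally show ?case .
qed

lemma nn_integral_line_ints:
  fixes f :: "'a::euclidean_space \<Rightarrow> ennreal"
  assumes [measurable]: "f \<in> borel_measurable borel" and "distinct js" "set js = Basis"
  shows "line_ints js f x = (\<integral>\<^sup>+y. f y \<partial>lborel)"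
proof -
  have "(\<integral>\<^sup>+y. f y \<partial>lborel) = (\<integral>\<^sup>+y. f (x + y) \<partial>lborel)"
    by (subst lborel_distr_plus[of x, symmetric]) (simp add: nn_integral_distr)
  also have "\<dots> = (\<integral>\<^sup>+z. f (x + (\<Sum>b\<in>Basis. z b *\<^sub>R b)) \<partial>(\<Pi>\<^sub>M b\<in>Basis. lborel))"
    by (subst lborel_eq) (simp add: nn_integral_distr)
  also have "\<dots> = line_ints js f x"
    using nn_integral_line_ints_aux[OF assms(1,2), of x] assms(3) by simp
  finally show ?thesis by simp
qed

lemma epow_power_card:
  assumes "finite B" "B \<noteq> {}"
  shows "(\<Prod>i\<in>B. epow y p) = epow y (real (card B) * p)"
proof (cases "y = top \<or> y = 0")
  case False
  then obtain r where "y = ennreal r" "r > 0"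
    by (cases y) (auto simp: ennreal_eq_0_iff not_le)
  then show ?thesis by (simp add: epow_ennreal ennreal_power powr_power mult.commute)
next
  case True
  with assms show ?thesis by (elim disjE) (simp_all add: top_power_ennreal zero_power card_gt_0_iff)
qed

text \<open>The power N/(N - 1) of g is a product of N copies of its power 1/(N - 1); each copy is
  bounded by the line integral in a different direction. After integration in all directions every
  factor of \<open>grid_lines\<close> is the full integral of f.\<close>

lemma nn_integral_le_line_ints:
  fixes f g :: "'a::euclidean_space \<Rightarrow> ennreal"
  assumes [measurable]: "f \<in> borel_measurable borel" and dim: "DIM('a) \<ge> 2"
    and g: "\<And>x i. i \<in> Basis \<Longrightarrow> g x \<le> line_int i f x"
  defines "q \<equiv> real DIM('a) / (real DIM('a) - 1)"
  shows "(\<integral>\<^sup>+x. epow (g x) q \<partial>lborel) \<le> epow (\<integral>\<^sup>+x. f x \<partial>lborel) q"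
proof -
  define p where "p = 1 / (real DIM('a) - 1)"
  have p: "p > 0" using dim by (simp add: p_def)
  have q: "q = real (card (Basis::'a set)) * p" by (simp add: q_def p_def)
  obtain js :: "'a list" where js: "distinct js" "set js = Basis"
    using finite_distinct_list[OF finite_Basis] by blast
  have "(\<integral>\<^sup>+x. epow (g x) q \<partial>lborel) = (\<integral>\<^sup>+x. (\<Prod>i\<in>(Basis::'a set). epow (g x) p) \<partial>lborel)"
    by (simp only: epow_power_card[OF finite_Basis nonempty_Basis] q)
  also have "\<dots> \<le> (\<integral>\<^sup>+x. (\<Prod>i\<in>Basis. epow (line_int i f x) p) \<partial>lborel)"
    by (intro nn_integral_mono prod_mono_ennreal) (use g p in \<open>auto intro!: epow_mono\<close>)
  also have "\<dots> = line_ints js (\<lambda>x. \<Prod>i\<in>Basis. epow (line_int i f x) p) 0"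
    by (rule nn_integral_line_ints[symmetric]) (use js in auto)
  also have "\<dots> \<le> (\<Prod>i\<in>Basis. epow (if i \<in> set js then line_ints js f 0 else line_ints js (line_int i f) 0) p)"
    unfolding p_def by (rule grid_lines) (use dim js in auto)
  also have "\<dots> = (\<Prod>i\<in>(Basis::'a set). epow (\<integral>\<^sup>+x. f x \<partial>lborel) p)"
    using js by (intro prod.cong refl) (simp add: nn_integral_line_ints)
  also have "\<dots> = epow (\<integral>\<^sup>+x. f x \<partial>lborel) q"
    by (simp only: epow_power_card[OF finite_Basis nonempty_Basis] q)
  finally show ?thesis .
qed

section \<open>Sobolev's inequality for compactly supported functions\<close>

definition C1_function :: "('a::euclidean_space \<Rightarrow> real) \<Rightarrow> bool" where
  "C1_function \<phi> \<longleftrightarrow> (\<forall>x. \<phi> differentiable at x) \<and> continuous_on UNIV (grad \<phi>)"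

lemma C1_has_derivative:
  assumes "C1_function \<phi>"
  shows "(\<phi> has_derivative (\<lambda>h. grad \<phi> x \<bullet> h)) (at x)"
proof -
  have D: "(\<phi> has_derivative frechet_derivative \<phi> (at x)) (at x)"
    using assms by (simp add: C1_function_def frechet_derivative_works)
  then have lin: "linear (frechet_derivative \<phi> (at x))" by (rule has_derivative_linear)
  have "frechet_derivative \<phi> (at x) h = grad \<phi> x \<bullet> h" for h
  proof -
    have "frechet_derivative \<phi> (at x) h = frechet_derivative \<phi> (at x) (\<Sum>i\<in>Basis. (h \<bullet> i) *\<^sub>R i)"
      by (simp add: euclidean_representation)
    also have "\<dots> = (\<Sum>i\<in>Basis. (h \<bullet> i) * frechet_derivative \<phi> (at x) i)"
      using lin by (simp add: linear_sum linear_scale)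
    also have "\<dots> = grad \<phi> x \<bullet> h"
      unfolding grad_def inner_sum_left inner_scaleR_left
      by (intro sum.cong refl) (simp only: inner_commute mult.commute)
    finally show ?thesis .
  qed
  then have "frechet_derivative \<phi> (at x) = (\<lambda>h. grad \<phi> x \<bullet> h)" by (rule ext)
  then show ?thesis using D by simp
qed

lemma C1_grad_eqI:
  assumes "(\<phi> has_derivative (\<lambda>h. G \<bullet> h)) (at x)"
  shows "grad \<phi> x = G"
proof -
  have "frechet_derivative \<phi> (at x) = (\<lambda>h. G \<bullet> h)"
    using assms frechet_derivative_at by metis
  then show ?thesis
    unfolding grad_def by (simp add: euclidean_representation)
qed

lemma C1_continuous: "C1_function \<phi> \<Longrightarrow> continuous_on UNIV \<phi>"
  by (auto simp: C1_function_def continuous_on_eq_continuous_at intro: differentiable_imp_continuous_within)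

lemma C1_line_deriv:
  assumes "C1_function \<phi>"
  shows "((\<lambda>t. \<phi> (x + t *\<^sub>R j)) has_real_derivative grad \<phi> (x + t *\<^sub>R j) \<bullet> j) (at t)"
proof -
  have "((\<lambda>t. x + t *\<^sub>R j) has_derivative (\<lambda>s. s *\<^sub>R j)) (at t)"
    by (auto intro!: derivative_eq_intros)
  from has_derivative_compose[OF this C1_has_derivative[OF assms]]
  show ?thesis by (simp add: has_field_derivative_def mult_commute_abs)
qed

lemma grad_zero_outside:
  assumes "closed K" "x \<notin> K" "\<And>y. y \<notin> K \<Longrightarrow> \<phi> y = 0"
  shows "grad \<phi> x = 0"
proof (rule C1_grad_eqI)
  have "((\<lambda>_. 0) has_derivative (\<lambda>h. 0)) (at x)" by simp
  then have "(\<phi> has_derivative (\<lambda>h. 0)) (at x)"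
    by (rule has_derivative_transform_within_open[of _ _ _ _ "- K"]) (use assms in auto)
  then show "(\<phi> has_derivative (\<lambda>h. 0 \<bullet> h)) (at x)" by simp
qed

lemma integrable_lborel_compact_support:
  fixes h :: "'a::euclidean_space \<Rightarrow> 'b::{banach, second_countable_topology}"
  assumes "continuous_on UNIV h" "compact K" "\<And>y. y \<notin> K \<Longrightarrow> h y = 0"
  shows "integrable lborel h"
proof -
  have "integrable lborel (\<lambda>x. indicator K x *\<^sub>R h x)"
    using assms by (intro borel_integrable_compact) (auto intro: continuous_on_subset)
  moreover have "(\<lambda>x. indicator K x *\<^sub>R h x) = h"
    using assms(3) by (auto simp: fun_eq_iff indicator_def)
  ultimately show ?thesis by simp
qed

text \<open>Up to the factor \<open>\<beta> + 1\<close>, the derivative of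
  \<open>\<bar>y\<bar> powr (\<beta> + 1)\<close>.\<close>

definition signed_powr :: "real \<Rightarrow> real \<Rightarrow> real" where
  "signed_powr \<beta> y = sgn y * \<bar>y\<bar> powr \<beta>"

lemma tendsto_abs_powr_0: "\<beta> > 0 \<Longrightarrow> ((\<lambda>h::real. \<bar>h\<bar> powr \<beta>) \<longlongrightarrow> 0) (at 0)"
proof -
  assume "\<beta> > 0"
  have "((\<lambda>h::real. \<bar>h\<bar>) \<longlongrightarrow> 0) (at 0)" by (rule tendsto_eq_intros | simp)+
  from tendsto_zero_powrI[OF this tendsto_const[of \<beta>]] \<open>\<beta> > 0\<close> show ?thesis by simp
qed

lemma isCont_signed_powr: "\<beta> > 0 \<Longrightarrow> isCont (signed_powr \<beta>) y"
proof (cases "y = 0")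
  case True
  assume b: "\<beta> > 0"
  have "((\<lambda>h. norm (signed_powr \<beta> h)) \<longlongrightarrow> 0) (at 0)"
    using tendsto_abs_powr_0[OF b] by (rule Lim_transform_eventually) 
      (auto simp: signed_powr_def abs_mult eventually_at_filter abs_sgn_eq)
  then have "(signed_powr \<beta> \<longlongrightarrow> 0) (at 0)" by (rule tendsto_norm_zero_cancel)
  then show ?thesis using True by (simp add: isCont_def signed_powr_def)
next
  case False
  then show "isCont (signed_powr \<beta>) y"
    unfolding signed_powr_def[abs_def] by (intro continuous_intros) auto
qed

lemma DERIV_abs_powr:
  assumes "\<gamma> > 1"
  shows "((\<lambda>y. \<bar>y\<bar> powr \<gamma>) has_real_derivative \<gamma> * signed_powr (\<gamma> - 1) y) (at y)"
proof -
  consider "y > 0" | "y < 0" | "y = 0" by linarith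
  then show ?thesis
  proof cases
    case 1
    have "((\<lambda>y. y powr \<gamma>) has_real_derivative \<gamma> * signed_powr (\<gamma> - 1) y) (at y)"
      using 1 by (auto intro!: derivative_eq_intros simp: signed_powr_def)
    then show ?thesis
      by (rule has_field_derivative_transform_within_open[of _ _ _ "{0<..}"]) (use 1 in auto)
  next
    case 2
    have "((\<lambda>y. (- y) powr \<gamma>) has_real_derivative \<gamma> * signed_powr (\<gamma> - 1) y) (at y)"
      using 2 by (auto intro!: derivative_eq_intros simp: signed_powr_def)
    then show ?thesis
      by (rule has_field_derivative_transform_within_open[of _ _ _ "{..<0}"]) (use 2 in auto)
  next
    case 3
    have "((\<lambda>h. norm (\<bar>h\<bar> powr \<gamma> / h)) \<longlongrightarrow> 0) (at (0::real))"
    proof (rule Lim_transform_eventually)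
      show "((\<lambda>h::real. \<bar>h\<bar> powr (\<gamma> - 1)) \<longlongrightarrow> 0) (at 0)"
        using assms by (intro tendsto_abs_powr_0) simp
      show "\<forall>\<^sub>F h::real in at 0. \<bar>h\<bar> powr (\<gamma> - 1) = norm (\<bar>h\<bar> powr \<gamma> / h)"
        by (auto simp: eventually_at_filter powr_diff)
    qed
    then have "((\<lambda>h. \<bar>h\<bar> powr \<gamma> / h) \<longlongrightarrow> 0) (at (0::real))"
      by (simp only: tendsto_norm_zero_iff)
    then show ?thesis using 3 by (simp add: DERIV_def signed_powr_def)
  qed
qed

text \<open>The fundamental theorem of calculus on a segment from a point outside the support to x.
  The exponent \<gamma> > 1 makes the power of the absolute value continuously differentiable across
  the zeros of \<phi>.\<close>

lemma abs_powr_le_line_int: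
  fixes \<phi> :: "'a::euclidean_space \<Rightarrow> real"
  assumes C1: "C1_function \<phi>" and K: "compact K" "\<And>y. y \<notin> K \<Longrightarrow> \<phi> y = 0"
    and \<gamma>: "\<gamma> > 1" and j: "j \<in> Basis"
  shows "ennreal (\<bar>\<phi> x\<bar> powr \<gamma>) \<le> line_int j (\<lambda>y. ennreal (\<gamma> * \<bar>\<phi> y\<bar> powr (\<gamma> - 1) * norm (grad \<phi> y))) x"
proof -
  obtain R where R: "\<And>y. y \<in> K \<Longrightarrow> norm y \<le> R" "R > 0"
    using compact_imp_bounded[OF K(1)] bounded_pos by blast
  \<comment> \<open>Large enough that the point at parameter -T leaves the ball of radius R around
    the support.\<close>
  define T where "T = norm x + R + 1"
  have T: "\<phi> (x + (- T) *\<^sub>R j) = 0" "T > 0"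
  proof -
    have "norm (x + (- T) *\<^sub>R j) \<ge> \<bar>T\<bar> - norm x"
      using norm_triangle_ineq2[of "T *\<^sub>R j" x] j by (simp add: norm_minus_commute)
    then have "norm (x + (- T) *\<^sub>R j) > R" using R(2) by (simp add: T_def)
    then show "\<phi> (x + (- T) *\<^sub>R j) = 0" using K(2) R(1) by (meson not_le)
    show "T > 0" using R(2) norm_ge_zero[of x] unfolding T_def by linarith
  qed
  define H where "H t = \<bar>\<phi> (x + t *\<^sub>R j)\<bar> powr \<gamma>" for t
  define H' where "H' t = \<gamma> * signed_powr (\<gamma> - 1) (\<phi> (x + t *\<^sub>R j)) * (grad \<phi> (x + t *\<^sub>R j) \<bullet> j)" for t
  have der: "(H has_real_derivative H' t) (at t)" for t
    unfolding H_def[abs_def] H'_def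
    by (rule DERIV_chain2[where f="\<lambda>y. \<bar>y\<bar> powr \<gamma>", OF DERIV_abs_powr[OF \<gamma>] C1_line_deriv[OF C1]])
  have cont: "isCont H' t" for t
  proof -
    have c1: "isCont \<phi> y" and c2: "isCont (grad \<phi>) y" for y
      using C1 C1_continuous[OF C1] by (auto simp: C1_function_def continuous_on_eq_continuous_at)
    have cl: "isCont (\<lambda>t. x + t *\<^sub>R j) t" by (intro continuous_intros)
    have "isCont (\<lambda>t. signed_powr (\<gamma> - 1) (\<phi> (x + t *\<^sub>R j))) t"
      by (intro isCont_o2[OF isCont_o2[OF cl c1] isCont_signed_powr]) (use \<gamma> in simp)
    moreover have "isCont (\<lambda>t. grad \<phi> (x + t *\<^sub>R j)) t" by (rule isCont_o2[OF cl c2])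
    ultimately show ?thesis unfolding H'_def[abs_def] by (intro continuous_intros)
  qed
  have FTC: "has_bochner_integral lborel (\<lambda>t. H' t * indicator {-T..0} t) (H 0 - H (-T))"
    using T by (intro has_bochner_integral_FTC_Icc_real der cont) simp
  have "ennreal (\<bar>\<phi> x\<bar> powr \<gamma>) = ennreal (norm (H 0 - H (-T)))"
    using T by (simp add: H_def)
  also have "\<dots> = ennreal (norm (\<integral>t. H' t * indicator {-T..0} t \<partial>lborel))"
    using FTC has_bochner_integral_integral_eq by metis
  also have "\<dots> \<le> (\<integral>\<^sup>+t. norm (H' t * indicator {-T..0} t) \<partial>lborel)"
    using FTC by (intro integral_norm_bound_ennreal) (auto simp: has_bochner_integral_iff)
  also have "\<dots> \<le> (\<integral>\<^sup>+t. ennreal (\<gamma> * \<bar>\<phi> (x + t *\<^sub>R j)\<bar> powr (\<gamma> - 1) * norm (grad \<phi> (x + t *\<^sub>R j))) \<partial>lborel)"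
  proof (intro nn_integral_mono ennreal_leI)
    fix t
    have 1: "\<bar>grad \<phi> (x + t *\<^sub>R j) \<bullet> j\<bar> \<le> norm (grad \<phi> (x + t *\<^sub>R j))"
      using Basis_le_norm[OF j] by blast
    have 2: "\<bar>signed_powr (\<gamma> - 1) (\<phi> (x + t *\<^sub>R j))\<bar> \<le> \<bar>\<phi> (x + t *\<^sub>R j)\<bar> powr (\<gamma> - 1)"
      by (simp add: signed_powr_def abs_mult abs_sgn_eq)
    have "norm (H' t * indicator {-T..0} t) \<le> \<bar>H' t\<bar>"
      by (simp add: indicator_def)
    also have "\<dots> \<le> \<gamma> * \<bar>\<phi> (x + t *\<^sub>R j)\<bar> powr (\<gamma> - 1) * norm (grad \<phi> (x + t *\<^sub>R j))"
      unfolding H'_def abs_mult using \<gamma> 1 2 by (intro mult_mono) auto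
    finally show "norm (H' t * indicator {-T..0} t) \<le> \<gamma> * \<bar>\<phi> (x + t *\<^sub>R j)\<bar> powr (\<gamma> - 1) * norm (grad \<phi> (x + t *\<^sub>R j))" .
  qed
  finally show ?thesis by (simp add: line_int_def)
qed

lemma nn_integral_Holder2:
  assumes "0 < a" "0 < b" "a + b = 1" 
    and [measurable]: "f \<in> borel_measurable M" "g \<in> borel_measurable M"
  shows "(\<integral>\<^sup>+x. epow (f x) a * epow (g x) b \<partial>M) \<le> epow (\<integral>\<^sup>+x. f x \<partial>M) a * epow (\<integral>\<^sup>+x. g x \<partial>M) b"
  using nn_integral_Holder[of "UNIV :: bool set" "\<lambda>i. if i then a else b" "\<lambda>i. if i then f else g" M] assms
  by (simp add: UNIV_bool ac_simps)

text \<open>The line integral bound is applied to the power \<gamma> of |\<phi>|, where \<gamma> = p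
  (N - 1)/(N - p) satisfies both \<gamma> N/(N - 1) = P and (\<gamma> - 1) p/(p - 1) = P. By the
  second identity Hoelder's inequality on the right reproduces the integral I of the left to the
  power 1 - 1/p. As I is finite it can be divided out, and the exponent (N - 1)/N - (1 - 1/p) = 1/P
  remains.\<close>

theorem Sobolev_inequality:
  fixes \<phi> :: "'a::euclidean_space \<Rightarrow> real"
  assumes C1: "C1_function \<phi>" and K: "compact K" "\<And>y. y \<notin> K \<Longrightarrow> \<phi> y = 0"
    and p: "1 < p" "p < real DIM('a)"
  defines "P \<equiv> critical_exponent DIM('a) p"
  shows "(\<integral>x. \<bar>\<phi> x\<bar> powr P \<partial>lborel) powr (1 / P)
     \<le> p * (real DIM('a) - 1) / (real DIM('a) - p) * (\<integral>x. norm (grad \<phi> x) powr p \<partial>lborel) powr (1 / p)"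
proof -
  define N where "N = real DIM('a)"
  define \<gamma> where "\<gamma> = p * (N - 1) / (N - p)"
  have N: "p < N" "N > 1" using p by (auto simp: N_def)
  have \<gamma>: "\<gamma> > 1" using N p by (simp add: \<gamma>_def field_simps)
  have P: "P = N * p / (N - p)" "P > 0" "P = \<gamma> * (N / (N - 1))" "\<gamma> - 1 = P * (1 - 1 / p)"
    using N p by (auto simp: P_def critical_exponent_def N_def[symmetric] \<gamma>_def divide_simps) (auto simp: algebra_simps)
  have cont: "continuous_on UNIV \<phi>" "continuous_on UNIV (grad \<phi>)"
    using C1 C1_continuous by (auto simp: C1_function_def)
  have [measurable]: "\<phi> \<in> borel_measurable borel" "grad \<phi> \<in> borel_measurable borel"
    using cont by (auto intro: borel_measurable_continuous_onI)
  have K0: "grad \<phi> y = 0" if "y \<notin> K" for y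
    by (rule grad_zero_outside[OF compact_imp_closed[OF K(1)] that]) (use K(2) in blast)
  have c1: "continuous_on UNIV (\<lambda>x. \<bar>\<phi> x\<bar> powr P)"
    by (rule continuous_on_powr') (use P(2) cont in \<open>auto intro: continuous_intros\<close>)
  have i1: "integrable lborel (\<lambda>x. \<bar>\<phi> x\<bar> powr P)"
    by (rule integrable_lborel_compact_support[OF c1 K(1)]) (use K in auto)
  have c2: "continuous_on UNIV (\<lambda>x. norm (grad \<phi> x) powr p)"
    by (rule continuous_on_powr') (use p cont in \<open>auto intro: continuous_intros\<close>)
  have i2: "integrable lborel (\<lambda>x. norm (grad \<phi> x) powr p)"
    by (rule integrable_lborel_compact_support[OF c2 K(1)]) (use K0 in auto)
  define I where "I = (\<integral>x. \<bar>\<phi> x\<bar> powr P \<partial>lborel)"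
  define D where "D = (\<integral>x. norm (grad \<phi> x) powr p \<partial>lborel)"
  have ID: "I \<ge> 0" "D \<ge> 0" by (auto simp: I_def D_def)
  have nI: "(\<integral>\<^sup>+x. ennreal (\<bar>\<phi> x\<bar> powr P) \<partial>lborel) = ennreal I"
    unfolding I_def by (rule nn_integral_eq_integral[OF i1]) simp
  have nD: "(\<integral>\<^sup>+x. ennreal (norm (grad \<phi> x) powr p) \<partial>lborel) = ennreal D"
    unfolding D_def by (rule nn_integral_eq_integral[OF i2]) simp
  define f where "f y = ennreal (\<gamma> * \<bar>\<phi> y\<bar> powr (\<gamma> - 1) * norm (grad \<phi> y))" for y
  have [measurable]: "f \<in> borel_measurable borel" unfolding f_def by measurable
  have "ennreal I = (\<integral>\<^sup>+x. epow (ennreal (\<bar>\<phi> x\<bar> powr \<gamma>)) (N / (N - 1)) \<partial>lborel)"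
    unfolding nI[symmetric] by (simp add: epow_ennreal powr_powr P(3))
  also have "\<dots> \<le> epow (\<integral>\<^sup>+x. f x \<partial>lborel) (N / (N - 1))"
    unfolding N_def
  proof (rule nn_integral_le_line_ints)
    show "DIM('a) \<ge> 2" using p by linarith
    show "ennreal (\<bar>\<phi> x\<bar> powr \<gamma>) \<le> line_int i f x" if "i \<in> Basis" for i x
      unfolding f_def by (rule abs_powr_le_line_int[OF C1 K \<gamma> that])
  qed simp
  also have "(\<integral>\<^sup>+x. f x \<partial>lborel) = (\<integral>\<^sup>+x. ennreal \<gamma> * (epow (ennreal (\<bar>\<phi> x\<bar> powr P)) (1 - 1 / p) *
      epow (ennreal (norm (grad \<phi> x) powr p)) (1 / p)) \<partial>lborel)"
    unfolding f_def using \<gamma> p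
    by (intro nn_integral_cong) (simp add: epow_ennreal powr_powr P(4) ennreal_mult' mult.assoc)
  also have "\<dots> = ennreal \<gamma> * (\<integral>\<^sup>+x. (epow (ennreal (\<bar>\<phi> x\<bar> powr P)) (1 - 1 / p) *
      epow (ennreal (norm (grad \<phi> x) powr p)) (1 / p)) \<partial>lborel)"
    by (rule nn_integral_cmult) measurable
  also have "\<dots> \<le> ennreal \<gamma> * (epow (ennreal I) (1 - 1 / p) * epow (ennreal D) (1 / p))"
    unfolding nI[symmetric] nD[symmetric]
    by (intro mult_left_mono nn_integral_Holder2) (use p in auto)
  also have "\<dots> = ennreal (\<gamma> * (I powr (1 - 1 / p) * D powr (1 / p)))"
    using ID \<gamma> by (simp add: epow_ennreal ennreal_mult')
  finally have "ennreal I \<le> epow (ennreal (\<gamma> * (I powr (1 - 1 / p) * D powr (1 / p)))) (N / (N - 1))"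
    using N by (simp add: epow_mono)
  also have "\<dots> = ennreal ((\<gamma> * (I powr (1 - 1 / p) * D powr (1 / p))) powr (N / (N - 1)))"
    using \<gamma> by (intro epow_ennreal) simp
  finally have main: "I \<le> (\<gamma> * (I powr (1 - 1 / p) * D powr (1 / p))) powr (N / (N - 1))"
    by (simp add: ennreal_le_iff)
  have "I powr (1 / P) \<le> \<gamma> * D powr (1 / p)"
  proof (cases "I = 0")
    case False
    then have I: "I > 0" using ID by simp
    have "I powr ((N - 1) / N) \<le> ((\<gamma> * (I powr (1 - 1 / p) * D powr (1 / p))) powr (N / (N - 1))) powr ((N - 1) / N)"
      using main N I by (intro powr_mono2) auto
    also have "\<dots> = (\<gamma> * D powr (1 / p)) * I powr (1 - 1 / p)"
      using \<gamma> N by (simp add: powr_powr)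
    finally have "I powr ((N - 1) / N) / I powr (1 - 1 / p) \<le> \<gamma> * D powr (1 / p)"
      using I by (simp add: field_simps)
    also have "I powr ((N - 1) / N) / I powr (1 - 1 / p) = I powr ((N - 1) / N - (1 - 1 / p))"
      by (simp add: powr_diff)
    also have "(N - 1) / N - (1 - 1 / p) = 1 / P"
      using N p by (simp add: P(1) field_simps)
    finally show ?thesis .
  qed (use \<gamma> in simp)
  then show ?thesis by (simp add: I_def D_def \<gamma>_def N_def)
qed

section \<open>Smooth functions\<close>

lemma Ck_SucI:
  assumes "\<And>x. (\<phi> has_derivative D x) (at x)" "\<And>i. i \<in> Basis \<Longrightarrow> Ck k (\<lambda>x. D x i)"
  shows "Ck (Suc k) \<phi>"
proof -
  have "frechet_derivative \<phi> (at x) = D x" for x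
    using frechet_derivative_at[OF assms(1)[of x]] by simp
  with assms show ?thesis by (auto simp: differentiable_def)
qed

lemma Ck_SucD:
  assumes "Ck (Suc k) \<phi>"
  shows "(\<phi> has_derivative frechet_derivative \<phi> (at x)) (at x)"
    and "i \<in> Basis \<Longrightarrow> Ck k (\<lambda>x. frechet_derivative \<phi> (at x) i)"
  using assms by (auto simp: frechet_derivative_works[symmetric])

lemma Ck_continuous: "Ck k \<phi> \<Longrightarrow> continuous_on UNIV \<phi>"
proof (cases k)
  case (Suc m)
  moreover assume "Ck k \<phi>"
  ultimately show ?thesis
    by (auto intro!: continuous_at_imp_continuous_on intro: differentiable_imp_continuous_within)
qed simp

lemma Ck_lower: "Ck (Suc k) \<phi> \<Longrightarrow> Ck k \<phi>"
proof (induction k arbitrary: \<phi>)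
  case 0
  then show ?case using Ck_continuous[of "Suc 0" \<phi>] by (simp only: Ck.simps(1))
qed auto

lemma Ck_const [simp]: "Ck k (\<lambda>_. c)"
proof (induction k arbitrary: c)
  case (Suc k)
  show ?case by (rule Ck_SucI[of _ "\<lambda>_ _. 0"]) (use Suc in auto)
qed simp

lemma Ck_add:
  assumes "Ck k \<phi>" "Ck k \<psi>" shows "Ck k (\<lambda>x. \<phi> x + \<psi> x)"
  using assms
proof (induction k arbitrary: \<phi> \<psi>)
  case (Suc k)
  show ?case
    by (rule Ck_SucI, rule has_derivative_add[OF Ck_SucD(1)[OF Suc.prems(1)] Ck_SucD(1)[OF Suc.prems(2)]])
       (use Suc in auto)
qed (auto intro: continuous_intros)

lemma Ck_mult:
  assumes "Ck k \<phi>" "Ck k \<psi>" shows "Ck k (\<lambda>x. \<phi> x * \<psi> x)"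
  using assms
proof (induction k arbitrary: \<phi> \<psi>)
  case (Suc k)
  show ?case
  proof (rule Ck_SucI)
    show "((\<lambda>x. \<phi> x * \<psi> x) has_derivative
      (\<lambda>h. \<phi> x * frechet_derivative \<psi> (at x) h + frechet_derivative \<phi> (at x) h * \<psi> x)) (at x)" for x
      by (rule has_derivative_mult[OF Ck_SucD(1)[OF Suc.prems(1)] Ck_SucD(1)[OF Suc.prems(2)]])
    show "Ck k (\<lambda>x. \<phi> x * frechet_derivative \<psi> (at x) i + frechet_derivative \<phi> (at x) i * \<psi> x)"
      if "i \<in> Basis" for i
      using Suc.IH Ck_lower[OF Suc.prems(1)] Ck_lower[OF Suc.prems(2)] Ck_SucD(2)[OF Suc.prems(1) that]
        Ck_SucD(2)[OF Suc.prems(2) that] by (intro Ck_add) auto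
  qed
qed (auto intro: continuous_intros)

lemma Ck_prod:
  assumes "finite I" "\<And>i. i \<in> I \<Longrightarrow> Ck k (f i)"
  shows "Ck k (\<lambda>x. \<Prod>i\<in>I. f i x)"
  using assms by (induction I rule: finite_induct) (auto intro: Ck_mult)

lemma Ck_inner [simp]: "Ck k (\<lambda>x. x \<bullet> b)"
proof (cases k)
  case (Suc m)
  show ?thesis unfolding Suc
    by (rule Ck_SucI[of _ "\<lambda>_ h. h \<bullet> b"]) (auto intro!: derivative_eq_intros)
qed (auto intro: continuous_intros)

section \<open>Smooth functions of a real variable and composition\<close>

lemma Ck_real_SucI:
  fixes F F' :: "real \<Rightarrow> real"
  assumes "\<And>y. (F has_real_derivative F' y) (at y)" "Ck k F'"
  shows "Ck (Suc k) F"
  by (rule Ck_SucI[of _ "\<lambda>y h. F' y * h"]) (use assms in \<open>auto simp: has_field_derivative_def\<close>)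

lemma Ck_real_SucD:
  fixes F :: "real \<Rightarrow> real"
  assumes "Ck (Suc k) F"
  shows "(F has_real_derivative frechet_derivative F (at y) 1) (at y)"
    and "Ck k (\<lambda>y. frechet_derivative F (at y) 1)"
proof -
  have D: "(F has_derivative frechet_derivative F (at y)) (at y)" by (rule Ck_SucD(1)[OF assms])
  have "frechet_derivative F (at y) h = frechet_derivative F (at y) 1 * h" for h
    using linear_scale[OF has_derivative_linear[OF D], of h 1] by (simp add: mult.commute)
  then have "frechet_derivative F (at y) = (*) (frechet_derivative F (at y) 1)" by (rule ext)
  with D show "(F has_real_derivative frechet_derivative F (at y) 1) (at y)"
    by (simp add: has_field_derivative_def)
  show "Ck k (\<lambda>y. frechet_derivative F (at y) 1)" using Ck_SucD(2)[OF assms, of 1] by simp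
qed

lemma Ck_compose:
  fixes F :: "real \<Rightarrow> real"
  assumes "Ck k F" "Ck k \<phi>" shows "Ck k (\<lambda>x. F (\<phi> x))"
  using assms
proof (induction k arbitrary: F)
  case 0
  then show ?case using continuous_on_compose2[of UNIV F UNIV \<phi>] by auto
next
  case (Suc k)
  show ?case
  proof (rule Ck_SucI)
    show "((\<lambda>x. F (\<phi> x)) has_derivative
       (\<lambda>h. frechet_derivative F (at (\<phi> x)) 1 * frechet_derivative \<phi> (at x) h)) (at x)" for x
      using has_derivative_compose[OF Ck_SucD(1)[OF Suc.prems(2)]
          Ck_real_SucD(1)[OF Suc.prems(1), unfolded has_field_derivative_def]] .
    show "Ck k (\<lambda>x. frechet_derivative F (at (\<phi> x)) 1 * frechet_derivative \<phi> (at x) i)"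
      if "i \<in> Basis" for i
      by (rule Ck_mult) (use Suc Ck_lower Ck_SucD(2)[OF Suc.prems(2) that] Ck_real_SucD(2) in blast)+
  qed
qed

lemma Ck_affine [simp]: "Ck k (\<lambda>y::real. a * y + b)"
  using Ck_add[OF Ck_mult[OF Ck_const Ck_inner[of _ "1::real"]] Ck_const] by simp

text \<open>The case m = 0 is the classical smooth function that is flat at 0. The factor
  \<open>(1 / s) ^ m\<close> makes the span of the family closed under differentiation, so
  smoothness of every order is a single induction.\<close>

definition flat_exp :: "nat \<Rightarrow> real \<Rightarrow> real" where
  "flat_exp m s = (if s \<le> 0 then 0 else (1 / s) ^ m * exp (- (1 / s)))"

lemma flat_exp_limit: "((\<lambda>h. flat_exp m h) \<longlongrightarrow> 0) (at 0)"
proof -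
  have "((\<lambda>h. (1 / h) ^ m * exp (- (1 / h))) \<longlongrightarrow> 0) (at_right (0::real))"
    by real_asymp
  then have "((\<lambda>h. flat_exp m h) \<longlongrightarrow> 0) (at_right 0)"
    by (rule Lim_transform_eventually) (auto simp: flat_exp_def eventually_at_filter)
  moreover have "((\<lambda>h. flat_exp m h) \<longlongrightarrow> 0) (at_left 0)"
    by (rule Lim_transform_eventually[OF tendsto_const]) (auto simp: flat_exp_def eventually_at_filter)
  ultimately show ?thesis by (simp add: filterlim_split_at)
qed

lemma DERIV_flat_exp:
  "(flat_exp m has_real_derivative flat_exp (m + 2) s - real m * flat_exp (m + 1) s) (at s)"
proof -
  consider "s > 0" | "s < 0" | "s = 0" by linarith
  then show ?thesis
  proof cases
    case 1
    define q where "q = 1 / s"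
    have d: "((\<lambda>s. 1 / s) has_real_derivative - (q ^ 2)) (at s)"
      using 1 by (auto intro!: derivative_eq_intros simp: q_def power2_eq_square)
    have e: "((\<lambda>s. exp (- (1 / s))) has_real_derivative exp (- q) * q ^ 2) (at s)"
      using DERIV_fun_exp[OF DERIV_minus[OF d]] by (simp add: q_def)
    have "real m * (- (q ^ 2) * q ^ (m - Suc 0)) = - real m * q ^ (m + 1)"
      by (cases m) (auto simp: power2_eq_square algebra_simps)
    then have "((\<lambda>s. (1 / s) ^ m * exp (- (1 / s))) has_real_derivative
        flat_exp (m + 2) s - real m * flat_exp (m + 1) s) (at s)"
      using DERIV_mult[OF DERIV_power[OF d, of m] e] 1
      by (cases m) (simp_all add: flat_exp_def q_def[symmetric] algebra_simps power2_eq_square)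
    then show ?thesis
      by (rule has_field_derivative_transform_within_open[of _ _ _ "{0<..}"]) (use 1 in \<open>auto simp: flat_exp_def\<close>)
  next
    case 2
    have "((\<lambda>_. 0) has_real_derivative flat_exp (m + 2) s - real m * flat_exp (m + 1) s) (at s)"
      using 2 by (simp add: flat_exp_def)
    then show ?thesis
      by (rule has_field_derivative_transform_within_open[of _ _ _ "{..<0}"]) (use 2 in \<open>auto simp: flat_exp_def\<close>)
  next
    case 3
    \<comment> \<open>The difference quotient at 0 is the next member of the family,
      \<open>flat_exp (Suc m)\<close>.\<close>
    have "((\<lambda>h. flat_exp m h / h) \<longlongrightarrow> 0) (at 0)"
      by (rule Lim_transform_eventually[OF flat_exp_limit[of "Suc m"]])
         (auto simp: flat_exp_def eventually_at_filter)
    then show ?thesis using 3 by (simp add: DERIV_def flat_exp_def)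
  qed
qed

lemma Ck_flat_exp: "Ck k (flat_exp m)"
proof (induction k arbitrary: m)
  case 0
  have "isCont (flat_exp m) s" for s using DERIV_flat_exp by (rule DERIV_isCont)
  then show ?case by (simp add: continuous_on_eq_continuous_at)
next
  case (Suc k)
  have "Ck k (\<lambda>s. flat_exp (m + 2) s + (- real m) * flat_exp (m + 1) s)"
    by (intro Ck_add Ck_mult Ck_const Suc)
  then show ?case using Ck_real_SucI[OF DERIV_flat_exp] by simp
qed

section \<open>Smooth approximation of truncations\<close>

definition sigmoid :: "real \<Rightarrow> real" where "sigmoid s = 1 / (1 + exp (- s))"

text \<open>A smooth substitute for the positive part: it differs from it by at most
  \<open>ln 2\<close>, so rescaling the argument by r reduces the error to \<open>ln 2 / r\<close>
  while the derivative stays between 0 and 1.\<close>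

definition softplus :: "real \<Rightarrow> real" where "softplus s = ln (1 + exp s)"

lemma DERIV_softplus: "(softplus has_real_derivative sigmoid s) (at s)"
proof -
  have "1 + exp s > 0" by (simp add: add_pos_pos)
  then show ?thesis
    unfolding softplus_def[abs_def] sigmoid_def
    by (auto intro!: derivative_eq_intros simp: exp_minus field_simps)
qed

text \<open>The logistic equation: the derivative is a polynomial in \<open>sigmoid\<close>, which
  turns smoothness of every order into an induction. The form \<open>1 + (- 1) * sigmoid s\<close>
  matches \<open>Ck_add\<close> and \<open>Ck_mult\<close>.\<close>

lemma DERIV_sigmoid: "(sigmoid has_real_derivative sigmoid s * (1 + (- 1) * sigmoid s)) (at s)"
proof -
  have "1 + exp (- s) \<noteq> 0" by (smt (verit) exp_gt_zero)
  then show ?thesis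
    unfolding sigmoid_def[abs_def]
    by (auto intro!: derivative_eq_intros simp: field_simps power2_eq_square)
qed

lemma Ck_sigmoid: "Ck k sigmoid"
proof (induction k)
  case 0
  have "isCont sigmoid s" for s using DERIV_sigmoid by (rule DERIV_isCont)
  then show ?case by (simp add: continuous_on_eq_continuous_at)
next
  case (Suc k)
  then show ?case by (intro Ck_real_SucI[OF DERIV_sigmoid] Ck_mult Ck_add Ck_const)
qed

lemma Ck_softplus: "Ck k softplus"
  by (rule Ck_lower) (rule Ck_real_SucI[OF DERIV_softplus Ck_sigmoid])

lemma sigmoid_bounds: "0 < sigmoid s" "sigmoid s < 1"
  by (auto simp: sigmoid_def add_pos_pos)

lemma softplus_bounds: "max 0 s \<le> softplus s" "softplus s \<le> max 0 s + ln 2"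
proof -
  have pos: "1 + exp s > 0" by (simp add: add_pos_pos)
  show "max 0 s \<le> softplus s"
    unfolding softplus_def using pos by (auto simp: max_def ln_ge_iff ln_ge_zero)
  have "1 + exp s \<le> exp (max 0 s) * 2" by (auto simp: max_def)
  then have "softplus s \<le> ln (exp (max 0 s) * 2)"
    unfolding softplus_def using pos by (subst ln_le_cancel_iff) auto
  then show "softplus s \<le> max 0 s + ln 2" by (simp add: ln_mult)
qed

text \<open>Smooth approximation of \<open>max 0 (s - k)\<close>, normalised to vanish at \<open>0\<close>.\<close>

definition soft_trunc :: "real \<Rightarrow> nat \<Rightarrow> real \<Rightarrow> real" where
  "soft_trunc k n s = (softplus (real (Suc n) * s + - (real (Suc n) * k)) - softplus (- (real (Suc n) * k))) / real (Suc n)"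

text \<open>The value at \<open>0\<close> is the limit of \<open>sigmoid (n * 0)\<close>. It may be any number in \<open>[0, 1]\<close> for the
  energy estimate, so that the gradient on the level set itself need not be known.\<close>

definition heaviside :: "real \<Rightarrow> real" where
  "heaviside s = (if s > 0 then 1 else if s = 0 then 1 / 2 else 0)"

lemma Ck_soft_trunc: "Ck j (soft_trunc k n)"
proof -
  have "Ck j (\<lambda>s. 1 / real (Suc n) * (softplus (real (Suc n) * s + - (real (Suc n) * k)) + - softplus (- (real (Suc n) * k))))"
    by (intro Ck_mult Ck_add Ck_const Ck_compose[OF Ck_softplus] Ck_affine)
  then show ?thesis by (simp add: soft_trunc_def[abs_def] diff_conv_add_uminus del: add_uminus_conv_diff)
qed

lemma soft_trunc_0 [simp]: "soft_trunc k n 0 = 0"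
  by (simp add: soft_trunc_def)

lemma DERIV_soft_trunc: "(soft_trunc k n has_real_derivative sigmoid (real (Suc n) * (s - k))) (at s)"
proof -
  define r where "r = real (Suc n)"
  have r: "r > 0" by (simp add: r_def)
  have "((\<lambda>s. softplus (r * s + - (r * k))) has_real_derivative sigmoid (r * s + - (r * k)) * r) (at s)"
    by (rule DERIV_chain2[OF DERIV_softplus]) (auto intro!: derivative_eq_intros)
  then have "((\<lambda>s. (softplus (r * s + - (r * k)) - softplus (- (r * k))) / r) has_real_derivative
      (sigmoid (r * s + - (r * k)) * r - 0) / r) (at s)"
    by (intro DERIV_cdivide DERIV_diff DERIV_const)
  then show ?thesis
    using r by (simp add: soft_trunc_def[abs_def] r_def[symmetric] right_diff_distrib del: of_nat_Suc)
qed

lemma abs_soft_trunc_le: "\<bar>soft_trunc k n s - soft_trunc k n t\<bar> \<le> \<bar>s - t\<bar>"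
proof -
  have "norm (soft_trunc k n s - soft_trunc k n t) \<le> 1 * norm (s - t)"
  proof (rule field_differentiable_bound[of UNIV])
    show "(soft_trunc k n has_field_derivative sigmoid (real (Suc n) * (z - k))) (at z within UNIV)" for z
      by (rule DERIV_soft_trunc)
    show "norm (sigmoid (real (Suc n) * (z - k))) \<le> 1" for z
      using sigmoid_bounds[of "real (Suc n) * (z - k)"] by simp
  qed auto
  then show ?thesis by simp
qed

lemma soft_trunc_tendsto:
  assumes "k \<ge> 0"
  shows "(\<lambda>n. soft_trunc k n s) \<longlonglongrightarrow> max 0 (s - k)"
proof (rule Lim_null[THEN iffD2], rule Lim_null_comparison)
  show "\<forall>\<^sub>F n in sequentially. norm (soft_trunc k n s - max 0 (s - k)) \<le> ln 2 / real (Suc n)"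
  proof (intro always_eventually allI)
    fix n
    define r where "r = real (Suc n)"
    have r: "r > 0" by (simp add: r_def)
    have m: "max 0 (r * s + - (r * k)) = r * max 0 (s - k)"
      using r by (auto simp: max_def algebra_simps mult_le_cancel_left)
    have m0: "max 0 (- (r * k)) = 0" using r assms by simp
    \<comment> \<open>Both values of \<open>softplus\<close> exceed the respective positive part by
      an amount in [0, ln 2], hence the two errors differ by at most ln 2. By k \<ge> 0 the positive
      part in the normalising term is 0.\<close>
    have "\<bar>softplus (r * s + - (r * k)) - softplus (- (r * k)) - r * max 0 (s - k)\<bar> \<le> ln 2"
      using softplus_bounds[of "r * s + - (r * k)"] softplus_bounds[of "- (r * k)"] unfolding m m0 by linarith
    then have "\<bar>softplus (r * s + - (r * k)) - softplus (- (r * k)) - r * max 0 (s - k)\<bar> / r \<le> ln 2 / r"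
      using r by (simp add: divide_right_mono)
    also have "\<bar>softplus (r * s + - (r * k)) - softplus (- (r * k)) - r * max 0 (s - k)\<bar> / r
        = \<bar>soft_trunc k n s - max 0 (s - k)\<bar>"
    proof -
      have "soft_trunc k n s - max 0 (s - k) = (softplus (r * s + - (r * k)) - softplus (- (r * k)) - r * max 0 (s - k)) / r"
        using r by (simp add: soft_trunc_def r_def[symmetric] diff_divide_distrib del: of_nat_Suc)
      then show ?thesis using r by (simp add: abs_divide)
    qed
    finally show "norm (soft_trunc k n s - max 0 (s - k)) \<le> ln 2 / real (Suc n)"
      by (simp add: r_def)
  qed
  show "(\<lambda>n. ln 2 / real (Suc n)) \<longlonglongrightarrow> 0"
    using LIMSEQ_Suc[OF lim_const_over_n[of "ln 2::real"]] by simp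
qed

lemma sigmoid_tendsto: "(\<lambda>n. sigmoid (real (Suc n) * s)) \<longlonglongrightarrow> heaviside s"
proof -
  consider "s > 0" | "s < 0" | "s = 0" by linarith
  then show ?thesis
  proof cases
    case 1
    then have "(\<lambda>n. 1 / (1 + exp (- (real (Suc n) * s)))) \<longlonglongrightarrow> 1" by real_asymp
    then show ?thesis using 1 by (simp add: sigmoid_def heaviside_def)
  next
    case 2
    then have "(\<lambda>n. 1 / (1 + exp (- (real (Suc n) * s)))) \<longlonglongrightarrow> 0" by real_asymp
    then show ?thesis using 2 by (simp add: sigmoid_def heaviside_def)
  next
    case 3
    then show ?thesis by (simp add: sigmoid_def heaviside_def)
  qed
qed

section \<open>Test functions and integration by parts\<close>

lemma test_function_C1:
  assumes "test_function \<phi>"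
  shows "C1_function \<phi>"
proof -
  have "Ck (Suc 0) \<phi>" using assms by (simp only: test_function_def)
  then show ?thesis
    unfolding C1_function_def grad_def[abs_def] by (auto intro!: continuous_intros)
qed

lemma test_function_support:
  assumes "test_function \<phi>"
  obtains K where "compact K" "\<And>y. y \<notin> K \<Longrightarrow> \<phi> y = 0"
  using assms closure_subset[of "{x. \<phi> x \<noteq> 0}"] unfolding test_function_def by blast

lemma test_functionE:
  assumes "test_function \<phi>"
  obtains K where "compact K" "\<And>y. y \<notin> K \<Longrightarrow> \<phi> y = 0" "\<And>y. y \<notin> K \<Longrightarrow> grad \<phi> y = 0"
    "continuous_on UNIV \<phi>" "continuous_on UNIV (grad \<phi>)"
proof -
  obtain K where K: "compact K" "\<And>y. y \<notin> K \<Longrightarrow> \<phi> y = 0" using test_function_support[OF assms] by blast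
  have C: "C1_function \<phi>" by (rule test_function_C1[OF assms])
  show ?thesis
  proof (rule that[OF K])
    show "grad \<phi> y = 0" if "y \<notin> K" for y
      by (rule grad_zero_outside[OF compact_imp_closed[OF K(1)] that]) (use K(2) in blast)
  qed (use C C1_continuous in \<open>auto simp: C1_function_def\<close>)
qed

lemma test_functionI:
  assumes "\<And>k. Ck k \<phi>" "compact K" "\<And>y. y \<notin> K \<Longrightarrow> \<phi> y = 0"
  shows "test_function \<phi>"
proof -
  have "closure {x. \<phi> x \<noteq> 0} \<subseteq> K"
    using assms(2,3) by (intro closure_minimal) (auto intro: compact_imp_closed)
  then show ?thesis
    using assms(1,2) by (metis test_function_def closed_closure compact_Int_closed inf.absorb_iff2)
qed

lemma test_function_diff:
  assumes "test_function \<phi>" "test_function \<psi>"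
  shows "test_function (\<lambda>x. \<phi> x - \<psi> x)"
proof -
  obtain K L where KL: "compact K" "\<And>y. y \<notin> K \<Longrightarrow> \<phi> y = 0" "compact L" "\<And>y. y \<notin> L \<Longrightarrow> \<psi> y = 0"
    using assms by (metis test_function_support)
  have "Ck k (\<lambda>x. \<phi> x + (- 1) * \<psi> x)" for k
    using assms by (intro Ck_add Ck_mult Ck_const) (auto simp: test_function_def)
  then show ?thesis
    by (intro test_functionI[of _ "K \<union> L"]) (use KL in auto)
qed

lemma test_function_compose:
  assumes "\<And>k. Ck k F" "F 0 = 0" "test_function \<phi>"
  shows "test_function (\<lambda>x. F (\<phi> x))"
  by (rule test_function_support[OF assms(3)], rule test_functionI, rule Ck_compose)
     (use assms in \<open>auto simp: test_function_def\<close>)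

lemma Ck_translate: "Ck k \<phi> \<Longrightarrow> Ck k (\<lambda>x. \<phi> (x + c))"
proof (induction k arbitrary: \<phi>)
  case 0
  then show ?case using continuous_on_compose2[of UNIV \<phi> UNIV "\<lambda>x. x + c"]
    by (auto simp: continuous_on_add continuous_on_id)
next
  case (Suc k)
  show ?case
  proof (rule Ck_SucI)
    have tr: "((\<lambda>x. x + c) has_derivative (\<lambda>h. h)) (at x)" for x
      by (auto intro!: derivative_eq_intros)
    show "((\<lambda>x. \<phi> (x + c)) has_derivative frechet_derivative \<phi> (at (x + c))) (at x)" for x
      using has_derivative_compose[OF tr Ck_SucD(1)[OF Suc.prems]] by simp
    show "Ck k (\<lambda>x. frechet_derivative \<phi> (at (x + c)) i)" if "i \<in> Basis" for i
      using Suc.IH[OF Ck_SucD(2)[OF Suc.prems that]] by simp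
  qed
qed

lemma test_function_translate:
  assumes "test_function \<phi>" shows "test_function (\<lambda>x. \<phi> (x + c))"
proof -
  obtain K where K: "compact K" "\<And>y. y \<notin> K \<Longrightarrow> \<phi> y = 0" using test_function_support[OF assms] by blast
  show ?thesis
  proof (rule test_functionI)
    show "Ck k (\<lambda>x. \<phi> (x + c))" for k using assms by (intro Ck_translate) (simp add: test_function_def)
    show "compact ((\<lambda>x. - c + x) ` K)" by (rule compact_translation[OF K(1)])
    show "\<phi> (y + c) = 0" if "y \<notin> (\<lambda>x. - c + x) ` K" for y
    proof (rule K(2))
      show "y + c \<notin> K"
      proof
        assume "y + c \<in> K"
        then have "- c + (y + c) \<in> (\<lambda>x. - c + x) ` K" by blast
        with that show False by simp
      qed
    qed
  qed
qed

lemma grad_diff: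
  assumes "C1_function \<phi>" "C1_function \<psi>"
  shows "grad (\<lambda>x. \<phi> x - \<psi> x) x = grad \<phi> x - grad \<psi> x"
  using has_derivative_diff[OF C1_has_derivative[OF assms(1)] C1_has_derivative[OF assms(2)]]
  by (intro C1_grad_eqI) (simp add: inner_diff_left)

lemma grad_mult:
  assumes "C1_function \<phi>" "C1_function \<psi>"
  shows "grad (\<lambda>x. \<phi> x * \<psi> x) x = \<phi> x *\<^sub>R grad \<psi> x + \<psi> x *\<^sub>R grad \<phi> x"
  using has_derivative_mult[OF C1_has_derivative[OF assms(1)] C1_has_derivative[OF assms(2)]]
  by (intro C1_grad_eqI) (simp add: inner_add_left mult.commute)

lemma grad_compose:
  assumes "\<And>y. (F has_real_derivative F' y) (at y)" "C1_function \<phi>"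
  shows "grad (\<lambda>x. F (\<phi> x)) x = F' (\<phi> x) *\<^sub>R grad \<phi> x"
  using has_derivative_compose[OF C1_has_derivative[OF assms(2)] assms(1)[unfolded has_field_derivative_def]]
  by (intro C1_grad_eqI) simp

lemma grad_translate:
  assumes "C1_function \<phi>"
  shows "grad (\<lambda>x. \<phi> (x + c)) x = grad \<phi> (x + c)"
proof (rule C1_grad_eqI)
  have tr: "((\<lambda>x. x + c) has_derivative (\<lambda>h. h)) (at x)"
    by (auto intro!: derivative_eq_intros)
  show "((\<lambda>x. \<phi> (x + c)) has_derivative (\<lambda>h. grad \<phi> (x + c) \<bullet> h)) (at x)"
    using has_derivative_compose[OF tr C1_has_derivative[OF assms]] by simp
qed

section \<open>Translations and integrals of gradients\<close>

lemma C1_bounded: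
  assumes "continuous_on UNIV g" "compact K" "\<And>y. y \<notin> K \<Longrightarrow> g y = (0::'b::real_normed_vector)"
  obtains B where "B \<ge> 0" "\<And>y. norm (g y) \<le> B"
proof -
  have "compact (g ` K)" using assms by (intro compact_continuous_image) (auto intro: continuous_on_subset)
  then obtain B where B: "B > 0" "\<And>y. y \<in> K \<Longrightarrow> norm (g y) \<le> B"
    using compact_imp_bounded bounded_pos by (metis imageI)
  show ?thesis
  proof (rule that[of B])
    show "norm (g y) \<le> B" for y using B assms(3)[of y] by (cases "y \<in> K") auto
  qed (use B in simp)
qed

text \<open>Integrate \<open>h x * (grad \<eta> (x + s *\<^sub>R j) \<bullet> j)\<close> over x and
  over 0 \<le> s \<le> t in both orders. Taking h = 1 yields that gradients have integral 0; for h
  with weak gradient 0 it yields that integrals against h do not change when the test function is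
  translated.\<close>

lemma integral_translation_difference:
  fixes h \<eta> :: "'a::euclidean_space \<Rightarrow> real"
  assumes [measurable]: "h \<in> borel_measurable borel"
    and h: "\<And>R. integrable lborel (\<lambda>x. indicator (cball 0 R) x * h x)"
    and C1: "C1_function \<eta>" and K: "compact K" "\<And>y. y \<notin> K \<Longrightarrow> \<eta> y = 0"
    and t: "t \<ge> 0" and j: "j \<in> Basis"
    and c: "\<And>s. 0 \<le> s \<Longrightarrow> s \<le> t \<Longrightarrow> (\<integral>x. h x * (grad \<eta> (x + s *\<^sub>R j) \<bullet> j) \<partial>lborel) = c"
  shows "(\<integral>x. h x * (\<eta> (x + t *\<^sub>R j) - \<eta> x) \<partial>lborel) = t * c"
proof -
  define g where "g y = grad \<eta> y \<bullet> j" for y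
  have cg: "continuous_on UNIV g" and cc: "continuous_on UNIV \<eta>"
    using C1 C1_continuous[OF C1] unfolding g_def C1_function_def by (auto intro: continuous_intros)
  have [measurable]: "g \<in> borel_measurable borel" "\<eta> \<in> borel_measurable borel"
    using cg cc by (auto intro: borel_measurable_continuous_onI)
  have g0: "g y = 0" if "y \<notin> K" for y
    unfolding g_def using grad_zero_outside[OF compact_imp_closed[OF K(1)] that, of \<eta>] K(2) by simp
  obtain B where B: "B \<ge> 0" "\<And>y. norm (g y) \<le> B" using C1_bounded[OF cg K(1) g0] by blast
  obtain R where R: "R > 0" "\<And>y. y \<in> K \<Longrightarrow> norm y \<le> R"
    using compact_imp_bounded[OF K(1)] bounded_pos by blast
  define f where "f x s = indicator {0..t} s * (h x * g (x + s *\<^sub>R j))" for x s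
  \<comment> \<open>If x + s j lies in the support and 0 \<le> s \<le> t, then x has norm at most R
    + t. Local integrability of h therefore suffices for a dominating function.\<close>
  define H where "H x = indicator (cball 0 (R + t)) x * h x" for x
  have [measurable]: "H \<in> borel_measurable borel"
    unfolding H_def by (intro borel_measurable_times borel_measurable_indicator assms(1)) auto
  have fH: "\<bar>f x s\<bar> \<le> indicator {0..t} s * (B * \<bar>H x\<bar>)" for x s
  proof (cases "0 \<le> s \<and> s \<le> t \<and> x + s *\<^sub>R j \<in> K")
    case True
    have "norm x \<le> norm (x + s *\<^sub>R j) + norm (s *\<^sub>R j)"
      using norm_triangle_ineq4[of "x + s *\<^sub>R j" "s *\<^sub>R j"] by simp
    then have "x \<in> cball 0 (R + t)" using True R(2)[of "x + s *\<^sub>R j"] j by simp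
    then show ?thesis
      using True mult_left_mono[OF B(2)[of "x + s *\<^sub>R j"], of "\<bar>h x\<bar>"]
      by (simp add: f_def H_def abs_mult mult.commute)
  next
    case False
    then show ?thesis using g0 B by (auto simp: f_def indicator_def)
  qed
  have iI: "integrable lborel (\<lambda>s. indicator {0..t} s * (B * \<bar>H x\<bar>))" for x
      by (intro integrable_mult_left impI integrable_real_indicator) (auto simp: emeasure_lborel_Icc_eq)
  have fx: "integrable lborel (f x)" for x
  proof (rule Bochner_Integration.integrable_bound[OF iI])
    show "f x \<in> borel_measurable lborel" unfolding f_def by measurable
    show "AE s in lborel. norm (f x s) \<le> norm (indicator {0..t} s * (B * \<bar>H x\<bar>))"
      using fH B(1) by (auto simp: abs_mult)
  qed
  have int: "integrable (lborel \<Otimes>\<^sub>M lborel) (case_prod f)"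
  proof (rule lborel_pair.Fubini_integrable)
    show meas: "case_prod f \<in> borel_measurable (lborel \<Otimes>\<^sub>M lborel)" unfolding f_def by measurable
    show "AE x in lborel. integrable lborel (\<lambda>y. case_prod f (x, y))" using fx by simp
    show "integrable lborel (\<lambda>x. \<integral>y. norm (case_prod f (x, y)) \<partial>lborel)"
    proof (rule Bochner_Integration.integrable_bound)
      show "integrable lborel (\<lambda>x. t * B * H x)"
        using h[of "R + t"] unfolding H_def by (intro integrable_mult_right) simp
      show "(\<lambda>x. \<integral>y. norm (case_prod f (x, y)) \<partial>lborel) \<in> borel_measurable lborel"
        using meas by measurable
      show "AE x in lborel. norm (\<integral>y. norm (case_prod f (x, y)) \<partial>lborel) \<le> norm (t * B * H x)"
      proof (intro AE_I2)
        fix x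
        have "(\<integral>y. norm (f x y) \<partial>lborel) \<le> (\<integral>s. indicator {0..t} s * (B * \<bar>H x\<bar>) \<partial>lborel)"
          using fH by (intro integral_mono integrable_norm fx iI) auto
        also have "\<dots> = t * (B * \<bar>H x\<bar>)" using t by simp
        finally show "norm (\<integral>y. norm (case_prod f (x, y)) \<partial>lborel) \<le> norm (t * B * H x)"
          using t B(1) by (simp add: abs_mult)
      qed
    qed
  qed
  have inner: "(\<integral>s. f x s \<partial>lborel) = h x * (\<eta> (x + t *\<^sub>R j) - \<eta> x)" for x
  proof -
    have "has_bochner_integral lborel (\<lambda>s. g (x + s *\<^sub>R j) * indicator {0..t} s)
       (\<eta> (x + t *\<^sub>R j) - \<eta> (x + 0 *\<^sub>R j))"
    proof (rule has_bochner_integral_FTC_Icc_real[OF t])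
      show "((\<lambda>s. \<eta> (x + s *\<^sub>R j)) has_real_derivative g (x + s *\<^sub>R j)) (at s)" for s
        unfolding g_def by (rule C1_line_deriv[OF C1])
      have "isCont g y" for y using cg by (simp add: continuous_on_eq_continuous_at)
      then show "isCont (\<lambda>s. g (x + s *\<^sub>R j)) s" for s
        by (intro isCont_o2[of _ "\<lambda>s. x + s *\<^sub>R j" g]) (auto intro!: continuous_intros)
    qed
    from has_bochner_integral_integral_eq[OF has_bochner_integral_mult_right[OF this, of "h x"]]
    show ?thesis by (simp add: f_def ac_simps)
  qed
  have "(\<integral>x. h x * (\<eta> (x + t *\<^sub>R j) - \<eta> x) \<partial>lborel) = (\<integral>x. \<integral>s. f x s \<partial>lborel \<partial>lborel)"
    by (simp add: inner)
  also have "\<dots> = (\<integral>s. \<integral>x. f x s \<partial>lborel \<partial>lborel)"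
    by (rule lborel_pair.Fubini_integral[OF int, symmetric])
  also have "\<dots> = (\<integral>s. indicator {0..t} s * c \<partial>lborel)"
    using c by (intro Bochner_Integration.integral_cong refl) (auto simp: f_def g_def indicator_def)
  also have "\<dots> = t * c" using t by simp
  finally show ?thesis .
qed

text \<open>A function and its translate by j have the same integral, yet by
  \<open>integral_translation_difference\<close> with h = 1 and t = 1 these differ by the integral
  of the derivative in direction j.\<close>

lemma integral_grad_eq_0:
  fixes \<eta> :: "'a::euclidean_space \<Rightarrow> real"
  assumes C1: "C1_function \<eta>" and K: "compact K" "\<And>y. y \<notin> K \<Longrightarrow> \<eta> y = 0" and j: "j \<in> Basis"
  shows "(\<integral>x. grad \<eta> x \<bullet> j \<partial>lborel) = 0"
proof -
  define c where "c = (\<integral>x. grad \<eta> x \<bullet> j \<partial>lborel)"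
  have tr: "(\<integral>x. g (x + y) \<partial>lborel) = (\<integral>x. g x \<partial>lborel)" 
    if "continuous_on UNIV g" for g :: "'a \<Rightarrow> real" and y
  proof -
    have [measurable]: "g \<in> borel_measurable borel" using that by (rule borel_measurable_continuous_onI)
    have "(\<integral>x. g x \<partial>lborel) = (\<integral>x. g x \<partial>(distr lborel borel ((+) y)))"
      by (simp add: lborel_distr_plus)
    also have "\<dots> = (\<integral>x. g (y + x) \<partial>lborel)" by (rule integral_distr) auto
    finally show ?thesis by (simp add: add.commute)
  qed
  have cc: "continuous_on UNIV \<eta>" using C1_continuous[OF C1] .
  have cg: "continuous_on UNIV (\<lambda>x. grad \<eta> x \<bullet> j)"
    using C1 by (auto simp: C1_function_def intro: continuous_intros)
  have i0: "integrable lborel \<eta>" by (rule integrable_lborel_compact_support[OF cc K])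
  have i1: "integrable lborel (\<lambda>x. \<eta> (x + j))"
    using lborel_integrable_real_affine integrable_distr_eq[of "(+) j" lborel borel \<eta>] i0 cc
    by (simp add: lborel_distr_plus borel_measurable_continuous_onI add.commute)
  have "(\<integral>x. 1 * (\<eta> (x + 1 *\<^sub>R j) - \<eta> x) \<partial>lborel) = 1 * c"
  proof (rule integral_translation_difference[OF _ _ C1 K _ j])
    show "integrable lborel (\<lambda>x::'a. indicator (cball 0 R) x * (1::real))" for R :: real
      using emeasure_lborel_cball_finite[of "0::'a" R] by (simp add: integrable_indicator_iff)
    show "(\<integral>x. 1 * (grad \<eta> (x + s *\<^sub>R j) \<bullet> j) \<partial>lborel) = c" for s
      using tr[OF cg, of "s *\<^sub>R j"] by (simp add: c_def)
  qed auto
  moreover have "(\<integral>x. 1 * (\<eta> (x + 1 *\<^sub>R j) - \<eta> x) \<partial>lborel) = 0"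
    using tr[OF cc, of j] i0 i1 by simp
  ultimately show ?thesis by (simp add: c_def)
qed

section \<open>The fundamental lemma of the calculus of variations\<close>

text \<open>This is the integrability clause of \<open>has_weak_gradient\<close>, since
  \<open>absolutely_integrable_on\<close> abbreviates
  \<open>set_integrable lebesgue\<close>.\<close>

definition loc_int :: "('a::euclidean_space \<Rightarrow> 'b::euclidean_space) \<Rightarrow> bool" where
  "loc_int w \<longleftrightarrow> (\<forall>K. compact K \<longrightarrow> set_integrable lebesgue K w)"

lemma loc_int_measurable:
  assumes "loc_int w" shows "w \<in> borel_measurable lebesgue"
proof (rule borel_measurable_LIMSEQ_metric)
  fix n :: nat
  have "set_integrable lebesgue (cball 0 (real n)) w" using assms by (simp add: loc_int_def)
  then show "(\<lambda>x. indicator (cball 0 (real n)) x *\<^sub>R w x) \<in> borel_measurable lebesgue"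
    unfolding set_integrable_def by (rule borel_measurable_integrable)
next
  fix x :: 'a
  obtain m where m: "norm x \<le> real m" using real_arch_simple by blast
  have "\<forall>\<^sub>F n in sequentially. indicator (cball 0 (real n)) x *\<^sub>R w x = w x"
    using eventually_ge_at_top[of m] by eventually_elim (use m in \<open>auto simp: indicator_def\<close>)
  then show "(\<lambda>n. indicator (cball 0 (real n)) x *\<^sub>R w x) \<longlonglongrightarrow> w x" by (rule tendsto_eventually)
qed

lemma loc_int_diff: "loc_int v \<Longrightarrow> loc_int w \<Longrightarrow> loc_int (\<lambda>x. v x - w x)"
  by (simp add: loc_int_def set_integral_diff)

lemma loc_int_inner: "loc_int w \<Longrightarrow> loc_int (\<lambda>x. w x \<bullet> b)"
  unfolding loc_int_def set_integrable_def
proof (intro allI impI)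
  fix K :: "'a set"
  assume "\<forall>K. compact K \<longrightarrow> integrable lebesgue (\<lambda>x. indicator K x *\<^sub>R w x)" "compact K"
  then have "integrable lebesgue (\<lambda>x. (indicator K x *\<^sub>R w x) \<bullet> b)"
    by (intro integrable_inner_left) auto
  then show "integrable lebesgue (\<lambda>x. indicator K x *\<^sub>R (w x \<bullet> b))" by simp
qed

lemma integrable_loc_int_mult:
  fixes w :: "'a::euclidean_space \<Rightarrow> 'b::euclidean_space"
  assumes w: "loc_int w" and c: "continuous_on UNIV \<phi>" and K: "compact K" "\<And>y. y \<notin> K \<Longrightarrow> \<phi> y = 0"
  shows "integrable lebesgue (\<lambda>x. \<phi> x *\<^sub>R w x)"
proof -
  obtain B where B: "B \<ge> 0" "\<And>y. norm (\<phi> y) \<le> (B::real)" using C1_bounded[OF c K] by blast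
  have [measurable]: "\<phi> \<in> borel_measurable lebesgue"
    using c by (intro measurable_completion) (simp add: borel_measurable_continuous_onI)
  have [measurable]: "w \<in> borel_measurable lebesgue" by (rule loc_int_measurable[OF w])
  show ?thesis
  proof (rule Bochner_Integration.integrable_bound)
    show "integrable lebesgue (\<lambda>x. B *\<^sub>R (indicator K x *\<^sub>R w x))"
      using w K(1) unfolding loc_int_def set_integrable_def by (intro integrable_scaleR_right) auto
    show "(\<lambda>x. \<phi> x *\<^sub>R w x) \<in> borel_measurable lebesgue" by measurable
    show "AE x in lebesgue. norm (\<phi> x *\<^sub>R w x) \<le> norm (B *\<^sub>R (indicator K x *\<^sub>R w x))"
      using B K(2) by (auto simp: indicator_def intro!: mult_right_mono)
  qed
qed

lemma integrable_loc_int_grad: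
  fixes w :: "'a::euclidean_space \<Rightarrow> real"
  assumes w: "loc_int w" and t: "test_function \<psi>"
  shows "integrable lebesgue (\<lambda>x. w x *\<^sub>R grad \<psi> x)"
proof -
  obtain K where K: "compact K" "\<And>y. y \<notin> K \<Longrightarrow> grad \<psi> y = 0" and c: "continuous_on UNIV (grad \<psi>)"
    using test_functionE[OF t] by metis
  show ?thesis
  proof (rule Bochner_Integration.integrable_bound)
    have cn: "continuous_on UNIV (\<lambda>x. norm (grad \<psi> x))" using c by (intro continuous_intros)
    show "integrable lebesgue (\<lambda>x. norm (grad \<psi> x) *\<^sub>R w x)"
      by (rule integrable_loc_int_mult[OF w cn K(1)]) (use K(2) in auto)
    have "grad \<psi> \<in> borel_measurable lebesgue"
      by (intro measurable_completion) (simp add: borel_measurable_continuous_onI[OF c])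
    then show "(\<lambda>x. w x *\<^sub>R grad \<psi> x) \<in> borel_measurable lebesgue"
      using loc_int_measurable[OF w] by (intro borel_measurable_scaleR)
  qed (auto simp: mult.commute)
qed

lemma integral_grad_eq_0_vec:
  fixes \<eta> :: "'a::euclidean_space \<Rightarrow> real"
  assumes C1: "C1_function \<eta>" and K: "compact K" "\<And>y. y \<notin> K \<Longrightarrow> \<eta> y = 0"
  shows "(\<integral>x. grad \<eta> x \<partial>lborel) = 0"
proof (rule euclidean_eqI)
  fix j :: 'a assume j: "j \<in> Basis"
  have i: "integrable lborel (grad \<eta>)"
    by (rule integrable_lborel_compact_support[OF _ K(1)])
       (use C1 in \<open>auto simp: C1_function_def intro: grad_zero_outside[OF compact_imp_closed[OF K(1)] _ K(2)]\<close>)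
  show "(\<integral>x. grad \<eta> x \<partial>lborel) \<bullet> j = 0 \<bullet> j"
    using integral_grad_eq_0[OF C1 K j] i by simp
qed

lemma C1_mult: "C1_function \<phi> \<Longrightarrow> C1_function \<psi> \<Longrightarrow> C1_function (\<lambda>x. \<phi> x * \<psi> x)"
proof -
  assume a: "C1_function \<phi>" "C1_function \<psi>"
  have "(\<lambda>x. \<phi> x * \<psi> x) differentiable at x" for x
    using a by (auto simp: C1_function_def)
  moreover have "continuous_on UNIV (grad (\<lambda>x. \<phi> x * \<psi> x))"
    unfolding grad_mult[OF a, abs_def]
    using a C1_continuous[OF a(1)] C1_continuous[OF a(2)] by (auto simp: C1_function_def intro!: continuous_intros)
  ultimately show ?thesis by (simp add: C1_function_def)
qed

lemma continuous_loc_int: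
  assumes "continuous_on UNIV (f :: 'a::euclidean_space \<Rightarrow> 'b::euclidean_space)"
  shows "loc_int f"
  unfolding loc_int_def set_integrable_def
proof (intro allI impI)
  fix K :: "'a set" assume K: "compact K"
  have [measurable]: "f \<in> borel_measurable borel" using assms by (rule borel_measurable_continuous_onI)
  have "integrable lborel (\<lambda>x. indicator K x *\<^sub>R f x)"
    using K assms by (intro borel_integrable_compact) (auto intro: continuous_on_subset)
  then show "integrable lebesgue (\<lambda>x. indicator K x *\<^sub>R f x)"
    using K by (subst integrable_completion) (auto simp: borel_compact)
qed

text \<open>The gradient of the product of two test functions has integral 0; the product rule
  splits it into the two sides of the identity.\<close>

lemma test_function_weak_gradient:
  fixes \<phi> :: "'a::euclidean_space \<Rightarrow> real"
  assumes "test_function \<phi>" shows "has_weak_gradient \<phi> (grad \<phi>)"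
proof -
  have C: "C1_function \<phi>" by (rule test_function_C1[OF assms])
  obtain K where K: "compact K" "\<And>y. y \<notin> K \<Longrightarrow> \<phi> y = 0" and g0: "\<And>y. y \<notin> K \<Longrightarrow> grad \<phi> y = 0"
    and c: "continuous_on UNIV \<phi>" "continuous_on UNIV (grad \<phi>)"
    by (rule test_functionE[OF assms], rule that)
  have "(\<integral>x. \<phi> x *\<^sub>R grad \<psi> x \<partial>lebesgue) = - (\<integral>x. \<psi> x *\<^sub>R grad \<phi> x \<partial>lebesgue)" if "test_function \<psi>" for \<psi>
  proof -
    have C': "C1_function \<psi>" by (rule test_function_C1[OF that])
    have c': "continuous_on UNIV \<psi>" "continuous_on UNIV (grad \<psi>)"
      using C' C1_continuous[OF C'] by (auto simp: C1_function_def)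
    have c1: "continuous_on UNIV (\<lambda>x. \<phi> x *\<^sub>R grad \<psi> x)" and c2: "continuous_on UNIV (\<lambda>x. \<psi> x *\<^sub>R grad \<phi> x)"
      using c c' by (auto intro: continuous_intros)
    have i1: "integrable lborel (\<lambda>x. \<phi> x *\<^sub>R grad \<psi> x)"
      by (rule integrable_lborel_compact_support[OF c1 K(1)]) (use K in auto)
    have i2: "integrable lborel (\<lambda>x. \<psi> x *\<^sub>R grad \<phi> x)"
      by (rule integrable_lborel_compact_support[OF c2 K(1)]) (use g0 in auto)
    have "(\<integral>x. grad (\<lambda>x. \<phi> x * \<psi> x) x \<partial>lborel) = 0"
      by (rule integral_grad_eq_0_vec[OF C1_mult[OF C C'] K(1)]) (use K in auto)
    then have "(\<integral>x. \<phi> x *\<^sub>R grad \<psi> x \<partial>lborel) = - (\<integral>x. \<psi> x *\<^sub>R grad \<phi> x \<partial>lborel)"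
      using i1 i2 by (simp add: grad_mult[OF C C'] eq_neg_iff_add_eq_0)
    then show ?thesis
      using c1 c2 by (simp add: integral_completion borel_measurable_continuous_onI)
  qed
  then show ?thesis
    using continuous_loc_int[OF c(1)] continuous_loc_int[OF c(2)]
    unfolding has_weak_gradient_def loc_int_def by blast
qed

text \<open>A product of values exp(-1/(n d)), with n standing for \<open>Suc n\<close> and d for
  the signed distances to the 2 N faces of the box. It vanishes outside the box, and inside it tends
  to 1 as n grows. The arguments are written as sums to match the closure rules of
  \<open>Ck\<close>.\<close>

definition box_bump :: "'a::euclidean_space \<Rightarrow> 'a \<Rightarrow> nat \<Rightarrow> 'a \<Rightarrow> real" where
  "box_bump a b n x =
     (\<Prod>i\<in>Basis. flat_exp 0 (real (Suc n) * (x \<bullet> i) + - (real (Suc n) * (a \<bullet> i))) *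
                flat_exp 0 (- real (Suc n) * (x \<bullet> i) + real (Suc n) * (b \<bullet> i)))"

lemma flat_exp_0_bounds: "0 \<le> flat_exp 0 s" "flat_exp 0 s \<le> 1"
  by (auto simp: flat_exp_def)

lemma box_bump_bounds: "0 \<le> box_bump a b n x" "box_bump a b n x \<le> 1"
  unfolding box_bump_def
  by (auto intro!: prod_nonneg prod_le_1 mult_le_one mult_nonneg_nonneg flat_exp_0_bounds)

lemma box_bump_outside:
  assumes "x \<notin> box a b" shows "box_bump a b n x = 0"
proof -
  obtain i where i: "i \<in> Basis" "x \<bullet> i \<le> a \<bullet> i \<or> b \<bullet> i \<le> x \<bullet> i"
    using assms by (auto simp: mem_box not_less)
  have "real (Suc n) * (x \<bullet> i) + - (real (Suc n) * (a \<bullet> i)) \<le> 0 \<or> - real (Suc n) * (x \<bullet> i) + real (Suc n) * (b \<bullet> i) \<le> 0"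
    using i(2) mult_left_mono[of "x \<bullet> i" "a \<bullet> i" "real (Suc n)"] mult_left_mono[of "b \<bullet> i" "x \<bullet> i" "real (Suc n)"] by linarith
  then show ?thesis
    unfolding box_bump_def using i(1) by (intro prod_zero) (auto simp: flat_exp_def intro!: bexI[of _ i])
qed

lemma box_bump_test: "test_function (box_bump a b n)"
proof (rule test_functionI[of _ "cbox a b"])
  show "Ck k (box_bump a b n)" for k
    unfolding box_bump_def[abs_def]
    by (intro Ck_prod Ck_mult Ck_compose[OF Ck_flat_exp] Ck_compose[OF Ck_affine] Ck_inner finite_Basis
        Ck_add Ck_const)
  show "box_bump a b n y = 0" if "y \<notin> cbox a b" for y
    using that box_subset_cbox by (intro box_bump_outside) blast
qed simp

lemma box_bump_tendsto: "(\<lambda>n. box_bump a b n x) \<longlonglongrightarrow> indicator (box a b) x"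
proof (cases "x \<in> box a b")
  case True
  have lim: "(\<lambda>n. flat_exp 0 (real (Suc n) * s)) \<longlonglongrightarrow> 1" if "s > 0" for s
  proof -
    have "(\<lambda>n. exp (- (1 / (real (Suc n) * s)))) \<longlonglongrightarrow> 1" using that by real_asymp
    then show ?thesis using that by (simp add: flat_exp_def mult_le_0_iff)
  qed
  have "(\<lambda>n. \<Prod>i\<in>Basis. flat_exp 0 (real (Suc n) * (x \<bullet> i - a \<bullet> i)) * flat_exp 0 (real (Suc n) * (b \<bullet> i - x \<bullet> i)))
    \<longlonglongrightarrow> (\<Prod>i\<in>(Basis::'a set). 1 * 1)"
    by (intro tendsto_prod tendsto_mult lim) (use True in \<open>auto simp: mem_box\<close>)
  then show ?thesis using True
    unfolding box_bump_def by (simp add: right_diff_distrib del: of_nat_Suc)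
qed (simp add: box_bump_outside)

text \<open>Bumps converge to indicators of boxes, so G has integral 0 over every box. Boxes form a
  generator of the Borel sets that is stable under intersection, and the property extends to all
  Borel sets by Dynkin's argument.\<close>

lemma borel_eq_0_if_orthogonal_to_test_functions:
  fixes G :: "'a::euclidean_space \<Rightarrow> real"
  assumes [measurable]: "G \<in> borel_measurable borel"
    and loc: "\<And>K. compact K \<Longrightarrow> integrable lborel (\<lambda>x. indicator K x * G x)"
    and orth: "\<And>\<phi>. test_function \<phi> \<Longrightarrow> (\<integral>x. \<phi> x * G x \<partial>lborel) = 0"
  shows "AE x in lborel. G x = 0"
proof -
  have ibox: "integrable lborel (\<lambda>x. indicator (box a b) x * G x)" for a b
  proof (rule Bochner_Integration.integrable_bound)
    show "integrable lborel (\<lambda>x. indicator (cbox a b) x * G x)" by (rule loc) simp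
    show "AE x in lborel. norm (indicator (box a b) x * G x) \<le> norm (indicator (cbox a b) x * G x)"
      using box_subset_cbox[of a b] by (auto simp: indicator_def)
  qed simp
  have box0: "(\<integral>x. indicator (box a b) x * G x \<partial>lborel) = 0" for a b
  proof -
    have "(\<lambda>n. \<integral>x. box_bump a b n x * G x \<partial>lborel) \<longlonglongrightarrow> (\<integral>x. indicator (box a b) x * G x \<partial>lborel)"
    proof (rule integral_dominated_convergence)
      show "integrable lborel (\<lambda>x. norm (indicator (box a b) x * G x))" using ibox by (rule integrable_norm)
      have "continuous_on UNIV (box_bump a b n)" for n
        by (intro C1_continuous test_function_C1 box_bump_test)
      then have [measurable]: "box_bump a b n \<in> borel_measurable borel" for n
        by (rule borel_measurable_continuous_onI)
      show "(\<lambda>x. box_bump a b n x * G x) \<in> borel_measurable lborel" for n by measurable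
      show "AE x in lborel. (\<lambda>n. box_bump a b n x * G x) \<longlonglongrightarrow> indicator (box a b) x * G x"
        by (intro AE_I2 tendsto_mult box_bump_tendsto tendsto_const)
      show "AE x in lborel. norm (box_bump a b n x * G x) \<le> norm (indicator (box a b) x * G x)" for n
        using box_bump_bounds[of a b n] box_bump_outside[of _ a b n]
        by (auto simp: abs_mult indicator_def intro!: mult_left_le_one_le)
    qed simp
    then have "(\<lambda>n. 0) \<longlonglongrightarrow> (\<integral>x. indicator (box a b) x * G x \<partial>lborel)"
      by (simp add: orth box_bump_test)
    then show ?thesis by (simp add: LIMSEQ_const_iff)
  qed
  have "AE x in lborel. indicator (box (- real n *\<^sub>R One) (real n *\<^sub>R One)) x * G x = 0" for n
  proof -
    \<comment> \<open>The complement step of the induction subtracts from the integral over the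
      whole space. As G is only locally integrable, it is first cut down to a large box, where the
      total integral exists and is 0.\<close>
    define B where "B = box (- real n *\<^sub>R One) (real n *\<^sub>R One :: 'a)"
    define H where "H x = indicator B x * G x" for x
    have iH: "integrable lborel H" unfolding H_def B_def by (rule ibox)
    have H0: "(\<integral>x. H x \<partial>lborel) = 0" unfolding H_def B_def by (rule box0)
    have "(\<integral>x. indicator A x * H x \<partial>lborel) = 0" if "A \<in> sets lborel" for A
    proof -
      have "Int_stable (range (\<lambda>(a, b). box a b :: 'a set))" "range (\<lambda>(a, b). box a b :: 'a set) \<subseteq> Pow UNIV"
        "A \<in> sigma_sets UNIV (range (\<lambda>(a, b). box a b))"
        using that by (auto simp: borel_eq_box Int_stable_def box_Int_box)
      then show ?thesis
      proof (induction rule: sigma_sets_induct_disjoint)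
        case (basic A)
        then obtain a b where A: "A = box a b" by auto
        obtain c d where cd: "box a b \<inter> B = box c d" by (simp add: B_def box_Int_box)
        have "indicator A x * H x = indicator (box c d) x * G x" for x
          by (simp add: H_def A cd[symmetric] indicator_inter_arith)
        then show ?case using box0[of c d] by simp
      next
        case (compl A)
        have A: "A \<in> sets lborel" using compl(1) by (simp add: borel_eq_box)
        have "indicator (UNIV - A) x * H x = H x - indicator A x * H x" for x
          by (simp add: indicator_def)
        moreover have "integrable lborel (\<lambda>x. indicator A x * H x)"
          using integrable_mult_indicator[OF A iH] by simp
        ultimately show ?case using compl iH H0 by simp
      next
        case (union A)
        have A: "A i \<in> sets lborel" for i using union(2) by (auto simp: borel_eq_box)
        have "set_lebesgue_integral lborel (\<Union>i. A i) H = (\<Sum>i. set_lebesgue_integral lborel (A i) H)"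
        proof (rule lebesgue_integral_countable_add)
          show "A i \<in> sets lborel" for i by (rule A)
          show "A i \<inter> A j = {}" if "i \<noteq> j" for i j using union(1) that by (auto simp: disjoint_family_on_def)
          show "set_integrable lborel (\<Union>i. A i) H"
            unfolding set_integrable_def by (intro integrable_mult_indicator iH sets.countable_UN) (use A in auto)
        qed
        then show ?case using union by (simp add: set_lebesgue_integral_def)
      qed auto
    qed
    then have "AE x in lborel. H x = 0"
      by (intro sigma_finite_measure.density_zero[OF sigma_finite_lborel iH]) (simp add: set_lebesgue_integral_def)
    then show ?thesis by (simp add: H_def B_def)
  qed
  then have "AE x in lborel. \<forall>n. indicator (box (- real n *\<^sub>R One) (real n *\<^sub>R One)) x * G x = 0"
    unfolding AE_all_countable by blast
  then show ?thesis
  proof (rule AE_mp, intro AE_I2 impI)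
    fix x assume *: "\<forall>n. indicator (box (- real n *\<^sub>R One) (real n *\<^sub>R One)) x * G x = 0"
    obtain n where n: "norm x < real n" using reals_Archimedean2 by blast
    have "x \<in> box (- real n *\<^sub>R One) (real n *\<^sub>R One)"
      using n Basis_le_norm[of _ x] by (force simp: mem_box abs_le_iff)
    with *[rule_format, of n] show "G x = 0" by simp
  qed
qed

text \<open>The Dynkin argument runs over Borel sets, so w is replaced by a Borel function that
  agrees with it almost everywhere.\<close>

lemma eq_0_if_orthogonal_to_test_functions:
  fixes w :: "'a::euclidean_space \<Rightarrow> real"
  assumes w: "loc_int w" and orth: "\<And>\<phi>. test_function \<phi> \<Longrightarrow> (\<integral>x. \<phi> x * w x \<partial>lebesgue) = 0"
  shows "AE x in lebesgue. w x = 0"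
proof -
  have [measurable]: "w \<in> borel_measurable lebesgue" by (rule loc_int_measurable[OF w])
  obtain G where [measurable]: "G \<in> borel_measurable borel" and wG: "AE x in lebesgue. w x = G x"
    using completion_ex_borel_measurable_real[of w lborel] by (auto dest: AE_completion)
  have "AE x in lborel. G x = 0"
  proof (rule borel_eq_0_if_orthogonal_to_test_functions)
    fix K :: "'a set" assume K: "compact K"
    have [measurable]: "K \<in> sets borel" using K by (simp add: borel_compact)
    have "integrable lebesgue (\<lambda>x. indicator K x * w x)"
      using w K by (simp add: loc_int_def set_integrable_def)
    then have "integrable lebesgue (\<lambda>x. indicator K x * G x)"
      by (rule integrable_cong_AE_imp) (use wG in \<open>auto intro: measurable_completion\<close>)
    then show "integrable lborel (\<lambda>x. indicator K x * G x)"
      by (subst (asm) integrable_completion) auto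
  next
    fix \<phi> :: "'a \<Rightarrow> real" assume t: "test_function \<phi>"
    have [measurable]: "\<phi> \<in> borel_measurable borel"
      by (intro borel_measurable_continuous_onI C1_continuous test_function_C1 t)
    have [measurable]: "\<phi> \<in> borel_measurable lebesgue" "G \<in> borel_measurable lebesgue"
      by (auto intro: measurable_completion)
    have "(\<integral>x. \<phi> x * G x \<partial>lborel) = (\<integral>x. \<phi> x * G x \<partial>lebesgue)"
      by (rule integral_completion[symmetric]) simp
    also have "\<dots> = (\<integral>x. \<phi> x * w x \<partial>lebesgue)"
      by (rule integral_cong_AE) (use wG in auto)
    also have "\<dots> = 0" by (rule orth[OF t])
    finally show "(\<integral>x. \<phi> x * G x \<partial>lborel) = 0" .
  qed simp
  then have "AE x in lebesgue. G x = 0" by (rule AE_completion)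
  with wG show ?thesis by eventually_elim simp
qed

section \<open>Lebesgue spaces and uniqueness of weak gradients\<close>

text \<open>The functions \<open>f i\<close> play the role of the p-th powers. The exponents are
  then weights with sum 1, and any number of factors can be handled without conjugate
  exponents.\<close>

lemma integral_Holder:
  fixes f :: "'i \<Rightarrow> 'm \<Rightarrow> real"
  assumes fin: "finite I" and a: "\<And>i. i \<in> I \<Longrightarrow> a i > 0" "(\<Sum>i\<in>I. a i) = 1"
    and int: "\<And>i. i \<in> I \<Longrightarrow> integrable M (f i)" and nn: "\<And>i x. i \<in> I \<Longrightarrow> f i x \<ge> 0"
  shows "integrable M (\<lambda>x. \<Prod>i\<in>I. f i x powr a i)"
    and "(\<integral>x. (\<Prod>i\<in>I. f i x powr a i) \<partial>M) \<le> (\<Prod>i\<in>I. (\<integral>x. f i x \<partial>M) powr a i)"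
proof -
  have [measurable]: "f i \<in> borel_measurable M" if "i \<in> I" for i
    using int[OF that] by (rule borel_measurable_integrable)
  have "(\<integral>\<^sup>+x. ennreal (\<Prod>i\<in>I. f i x powr a i) \<partial>M) = (\<integral>\<^sup>+x. (\<Prod>i\<in>I. epow (ennreal (f i x)) (a i)) \<partial>M)"
  proof (intro nn_integral_cong)
    fix x
    have "(\<Prod>i\<in>I. epow (ennreal (f i x)) (a i)) = (\<Prod>i\<in>I. ennreal (f i x powr a i))"
      by (intro prod.cong refl) (simp add: epow_ennreal nn)
    then show "ennreal (\<Prod>i\<in>I. f i x powr a i) = (\<Prod>i\<in>I. epow (ennreal (f i x)) (a i))"
      by (simp add: prod_ennreal)
  qed
  also have "\<dots> \<le> (\<Prod>i\<in>I. epow (\<integral>\<^sup>+x. ennreal (f i x) \<partial>M) (a i))"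
    by (intro nn_integral_Holder fin a) measurable
  also have "\<dots> = (\<Prod>i\<in>I. ennreal ((\<integral>x. f i x \<partial>M) powr a i))"
    by (intro prod.cong refl) (simp add: nn_integral_eq_integral[OF int] nn epow_ennreal)
  also have "\<dots> = ennreal (\<Prod>i\<in>I. (\<integral>x. f i x \<partial>M) powr a i)"
    by (simp add: prod_ennreal)
  finally have *: "(\<integral>\<^sup>+x. ennreal (\<Prod>i\<in>I. f i x powr a i) \<partial>M) \<le> ennreal (\<Prod>i\<in>I. (\<integral>x. f i x \<partial>M) powr a i)" .
  have pn: "0 \<le> (\<Prod>i\<in>I. f i x powr a i)" for x by (simp add: prod_nonneg)
  show i: "integrable M (\<lambda>x. \<Prod>i\<in>I. f i x powr a i)"
  proof (rule integrableI_nonneg)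
    show "(\<integral>\<^sup>+x. ennreal (\<Prod>i\<in>I. f i x powr a i) \<partial>M) < \<infinity>" using * by (simp add: le_less_trans)
  qed (use pn in \<open>auto intro!: borel_measurable_prod\<close>)
  show "(\<integral>x. (\<Prod>i\<in>I. f i x powr a i) \<partial>M) \<le> (\<Prod>i\<in>I. (\<integral>x. f i x \<partial>M) powr a i)"
    using * nn_integral_eq_integral[OF i] pn by (simp add: prod_nonneg)
qed

lemma integral_Holder2:
  fixes f g :: "'m \<Rightarrow> real"
  assumes "0 < a" "0 < b" "a + b = 1" "integrable M f" "integrable M g" "\<And>x. f x \<ge> 0" "\<And>x. g x \<ge> 0"
  shows "integrable M (\<lambda>x. f x powr a * g x powr b)"
    and "(\<integral>x. f x powr a * g x powr b \<partial>M) \<le> (\<integral>x. f x \<partial>M) powr a * (\<integral>x. g x \<partial>M) powr b"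
  using integral_Holder[of "UNIV :: bool set" "\<lambda>i. if i then a else b" M "\<lambda>i. if i then f else g"] assms
  by (simp_all add: UNIV_bool ac_simps)

text \<open>A cheap substitute for Minkowski's inequality. The loss is harmless in limits; it is
  also the source of the factor 4 in \<open>D1p_pair_Sobolev\<close>.\<close>

lemma norm_add_powr_le:
  fixes a b :: "'a::real_normed_vector"
  assumes "p \<ge> 0"
  shows "norm (a + b) powr p \<le> 2 powr p * (norm a powr p + norm b powr p)"
proof -
  have "norm (a + b) powr p \<le> (2 * max (norm a) (norm b)) powr p"
    using assms norm_triangle_ineq[of a b] by (intro powr_mono2) auto
  also have "\<dots> = 2 powr p * max (norm a) (norm b) powr p" by (simp add: powr_mult)
  also have "max (norm a) (norm b) powr p \<le> norm a powr p + norm b powr p"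
    by (auto simp: max_def)
  finally show ?thesis by simp
qed

abbreviation Lp_int :: "real \<Rightarrow> ('a::euclidean_space \<Rightarrow> 'b::euclidean_space) \<Rightarrow> real" where
  "Lp_int p w \<equiv> (\<integral>x. norm (w x) powr p \<partial>lebesgue)"

lemma Lp_spaceD:
  assumes "w \<in> Lp_space p"
  shows "w \<in> borel_measurable lebesgue" "integrable lebesgue (\<lambda>x. norm (w x) powr p)"
  using assms by (auto simp: Lp_space_def)

lemma Lp_space_add:
  assumes v: "v \<in> Lp_space p" and w: "w \<in> Lp_space p" and p: "p \<ge> 0"
  shows "(\<lambda>x. v x + w x) \<in> Lp_space p"
    and "(Lp_int p (\<lambda>x. v x + w x))
       \<le> 2 powr p * (Lp_int p v + Lp_int p w)"
proof -
  note [measurable] = Lp_spaceD(1)[OF v] Lp_spaceD(1)[OF w]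
  have i: "integrable lebesgue (\<lambda>x. 2 powr p * (norm (v x) powr p + norm (w x) powr p))"
    by (intro integrable_mult_right Bochner_Integration.integrable_add Lp_spaceD v w)
  have i': "integrable lebesgue (\<lambda>x. norm (v x + w x) powr p)"
    by (rule Bochner_Integration.integrable_bound[OF i]) (use norm_add_powr_le[OF p] in auto)
  then show "(\<lambda>x. v x + w x) \<in> Lp_space p" by (simp add: Lp_space_def)
  have "(Lp_int p (\<lambda>x. v x + w x)) \<le> (\<integral>x. 2 powr p * (norm (v x) powr p + norm (w x) powr p) \<partial>lebesgue)"
    by (rule integral_mono[OF i' i]) (rule norm_add_powr_le[OF p])
  then show "(Lp_int p (\<lambda>x. v x + w x))
       \<le> 2 powr p * (Lp_int p v + Lp_int p w)"
    using Lp_spaceD(2)[OF v] Lp_spaceD(2)[OF w] by simp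
qed

lemma Lp_space_uminus: "w \<in> Lp_space p \<Longrightarrow> (\<lambda>x. - w x) \<in> Lp_space p"
  by (auto simp: Lp_space_def)

lemma Lp_space_diff:
  assumes v: "v \<in> Lp_space p" and w: "w \<in> Lp_space p" and p: "p \<ge> 0"
  shows "(\<lambda>x. v x - w x) \<in> Lp_space p"
    and "(Lp_int p (\<lambda>x. v x - w x))
       \<le> 2 powr p * (Lp_int p v + Lp_int p w)"
  using Lp_space_add[OF v Lp_space_uminus[OF w] p] by simp_all

lemma Lp_space_bound:
  assumes "v \<in> Lp_space p" "w \<in> borel_measurable lebesgue" "\<And>x. norm (w x) \<le> c * norm (v x)" "c \<ge> 0" "p \<ge> 0"
  shows "w \<in> Lp_space p"
proof -
  note [measurable] = assms(2)
  have "integrable lebesgue (\<lambda>x. norm (w x) powr p)"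
  proof (rule Bochner_Integration.integrable_bound)
    show "integrable lebesgue (\<lambda>x. c powr p * norm (v x) powr p)"
      by (intro integrable_mult_right Lp_spaceD assms)
    show "AE x in lebesgue. norm (norm (w x) powr p) \<le> norm (c powr p * norm (v x) powr p)"
      using assms(3-5) by (auto simp: powr_mult[symmetric] intro!: powr_mono2)
  qed simp
  with assms(2) show ?thesis by (simp add: Lp_space_def)
qed

lemma Lp_space_loc_int:
  fixes w :: "'a::euclidean_space \<Rightarrow> 'b::euclidean_space"
  assumes "w \<in> Lp_space p" "p \<ge> 1" shows "loc_int w"
  unfolding loc_int_def set_integrable_def
proof (intro allI impI)
  fix K :: "'a set" assume K: "compact K"
  note [measurable] = Lp_spaceD(1)[OF assms(1)]
  have [measurable]: "K \<in> sets lebesgue" using K by (simp add: borel_compact lmeasurable_compact fmeasurableD)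
  show "integrable lebesgue (\<lambda>x. indicator K x *\<^sub>R w x)"
  proof (rule Bochner_Integration.integrable_bound)
    have "integrable lebesgue (indicator K :: 'a \<Rightarrow> real)"
      using lmeasurable_compact[OF K] by (simp add: integrable_indicator_iff fmeasurable_def)
    then show "integrable lebesgue (\<lambda>x. indicator K x + norm (w x) powr p)"
      by (intro Bochner_Integration.integrable_add Lp_spaceD assms)
    show "AE x in lebesgue. norm (indicator K x *\<^sub>R w x) \<le> norm (indicator K x + norm (w x) powr p)"
    proof (intro AE_I2)
      fix x
      have "norm (w x) \<le> 1 + norm (w x) powr p"
        using ge_one_powr_ge_zero[of "norm (w x)" "p - 1"] assms(2) powr_mono[of 1 p "norm (w x)"]
        by (cases "norm (w x) \<le> 1") (auto intro: order.trans[of _ 1])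
      then show "norm (indicator K x *\<^sub>R w x) \<le> norm (indicator K x + norm (w x) powr p)"
        by (auto simp: indicator_def)
    qed
  qed simp
qed

lemma continuous_Lp_space:
  fixes f :: "'a::euclidean_space \<Rightarrow> 'b::euclidean_space"
  assumes "continuous_on UNIV f" "compact K" "\<And>y. y \<notin> K \<Longrightarrow> f y = 0" "p > 0"
  shows "f \<in> Lp_space p"
proof -
  have c: "continuous_on UNIV (\<lambda>x. norm (f x) powr p)"
    by (rule continuous_on_powr') (use assms in \<open>auto intro: continuous_intros\<close>)
  have [measurable]: "f \<in> borel_measurable borel" using assms(1) by (rule borel_measurable_continuous_onI)
  have "integrable lborel (\<lambda>x. norm (f x) powr p)"
    by (rule integrable_lborel_compact_support[OF c assms(2)]) (use assms in auto)
  then have "integrable lebesgue (\<lambda>x. norm (f x) powr p)" by (subst integrable_completion) auto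
  then show ?thesis by (simp add: Lp_space_def measurable_completion)
qed

lemma test_function_Lp_space:
  fixes \<phi> :: "'a::euclidean_space \<Rightarrow> real"
  assumes "test_function \<phi>" "p > 0"
  shows "\<phi> \<in> Lp_space p" "grad \<phi> \<in> Lp_space p"
  by (rule test_functionE[OF assms(1)], rule continuous_Lp_space, assumption+, rule assms)+

lemma integral_mult_tendsto_Lp:
  fixes f :: "nat \<Rightarrow> 'a::euclidean_space \<Rightarrow> real"
  assumes p: "p > 1" and fn: "\<And>n. f n \<in> Lp_space p" and g: "g \<in> Lp_space p"
    and lim: "(\<lambda>n. Lp_int p (\<lambda>x. f n x - g x)) \<longlonglongrightarrow> 0"
    and \<psi>: "continuous_on UNIV \<psi>" "compact K" "\<And>y. y \<notin> K \<Longrightarrow> \<psi> y = 0"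
  shows "(\<lambda>n. \<integral>x. \<psi> x * f n x \<partial>lebesgue) \<longlonglongrightarrow> (\<integral>x. \<psi> x * g x \<partial>lebesgue)"
proof -
  define q where "q = p / (p - 1)"
  have q: "q > 0" "1 / p + 1 / q = 1" using p by (auto simp: q_def field_simps)
  have \<psi>q: "\<psi> \<in> Lp_space q" by (rule continuous_Lp_space[OF \<psi> q(1)])
  define C where "C = (Lp_int q \<psi>) powr (1 / q)"
  have if1: "integrable lebesgue (\<lambda>x. \<psi> x * f n x)" for n
    using integrable_loc_int_mult[OF Lp_space_loc_int[OF fn] \<psi>] p by simp
  have if2: "integrable lebesgue (\<lambda>x. \<psi> x * g x)"
    using integrable_loc_int_mult[OF Lp_space_loc_int[OF g] \<psi>] p by simp
  have bnd: "norm ((\<integral>x. \<psi> x * f n x \<partial>lebesgue) - (\<integral>x. \<psi> x * g x \<partial>lebesgue))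
      \<le> (Lp_int p (\<lambda>x. f n x - g x)) powr (1 / p) * C" for n
  proof -
    have d: "(\<lambda>x. f n x - g x) \<in> Lp_space p" using p by (intro Lp_space_diff fn g) simp
    have "(\<integral>x. \<psi> x * f n x \<partial>lebesgue) - (\<integral>x. \<psi> x * g x \<partial>lebesgue) = (\<integral>x. \<psi> x * f n x - \<psi> x * g x \<partial>lebesgue)"
      using if1 if2 by simp
    also have "norm \<dots> \<le> (\<integral>x. norm (\<psi> x * f n x - \<psi> x * g x) \<partial>lebesgue)" by (rule integral_norm_bound)
    also have "\<dots> = (\<integral>x. (norm (f n x - g x) powr p) powr (1 / p) * (norm (\<psi> x) powr q) powr (1 / q) \<partial>lebesgue)"
      using p q by (intro Bochner_Integration.integral_cong refl)
        (simp add: powr_powr right_diff_distrib[symmetric] abs_mult mult.commute)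
    also have "\<dots> \<le> (Lp_int p (\<lambda>x. f n x - g x)) powr (1 / p) * C"
      unfolding C_def by (rule integral_Holder2) (use p q Lp_spaceD[OF d] Lp_spaceD[OF \<psi>q] in auto)
    finally show ?thesis .
  qed
  have "(\<lambda>n. (Lp_int p (\<lambda>x. f n x - g x)) powr (1 / p)) \<longlonglongrightarrow> 0"
    by (rule tendsto_zero_powrI[OF lim tendsto_const]) (use p in auto)
  then have "(\<lambda>n. (Lp_int p (\<lambda>x. f n x - g x)) powr (1 / p) * C) \<longlonglongrightarrow> 0"
    by (rule tendsto_mult_left_zero)
  then have "(\<lambda>n. (\<integral>x. \<psi> x * f n x \<partial>lebesgue) - (\<integral>x. \<psi> x * g x \<partial>lebesgue)) \<longlonglongrightarrow> 0"
    by (rule Lim_null_comparison[rotated]) (use bnd in \<open>auto intro: always_eventually\<close>)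
  then show ?thesis by (simp only: Lim_null[symmetric])
qed

text \<open>Translating \<open>\<phi>\<close> does not change \<open>\<integral> h \<phi>\<close>, and the integral tends to \<open>0\<close> as the support of the
  translate moves to infinity.\<close>

lemma eq_0_if_weak_gradient_0:
  fixes h :: "'a::euclidean_space \<Rightarrow> real"
  assumes h: "h \<in> Lp_space P" and P: "P > 1"
    and grad0: "\<And>\<psi>. test_function \<psi> \<Longrightarrow> (\<integral>x. h x *\<^sub>R grad \<psi> x \<partial>lebesgue) = 0"
  shows "AE x in lebesgue. h x = 0"
proof (rule eq_0_if_orthogonal_to_test_functions)
  show loc: "loc_int h" using Lp_space_loc_int[OF h] P by simp
  note [measurable] = Lp_spaceD(1)[OF h]
  fix \<phi> :: "'a \<Rightarrow> real" assume t: "test_function \<phi>"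
  have C1: "C1_function \<phi>" by (rule test_function_C1[OF t])
  obtain K where K: "compact K" "\<And>y. y \<notin> K \<Longrightarrow> \<phi> y = 0" using test_function_support[OF t] by blast
  obtain j :: 'a where j: "j \<in> Basis" using nonempty_Basis by blast
  have nj: "norm j = 1" using j by simp
  \<comment> \<open>\<open>integral_translation_difference\<close> applies Fubini's theorem to
    \<open>lborel\<close>, hence a Borel representative of h.\<close>
  obtain G where G[measurable]: "G \<in> borel_measurable borel" and hG: "AE x in lebesgue. h x = G x"
    using completion_ex_borel_measurable_real[of h lborel] by (auto dest: AE_completion)
  have [measurable]: "G \<in> borel_measurable lebesgue" by (rule measurable_completion) simp
  have leb_eq: "(\<integral>x. G x * g x \<partial>lborel) = (\<integral>x. h x * g x \<partial>lebesgue)" 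
    if "g \<in> borel_measurable borel" for g :: "'a \<Rightarrow> real"
  proof -
    have [measurable]: "g \<in> borel_measurable borel" "g \<in> borel_measurable lebesgue"
      using that by (auto intro: measurable_completion)
    have "(\<integral>x. G x * g x \<partial>lborel) = (\<integral>x. G x * g x \<partial>lebesgue)"
      by (rule integral_completion[symmetric]) simp
    also have "\<dots> = (\<integral>x. h x * g x \<partial>lebesgue)" by (rule integral_cong_AE) (use hG in auto)
    finally show ?thesis .
  qed
  have cphi: "continuous_on UNIV (\<lambda>x. \<phi> (x + c))" for c
    using C1_continuous[OF test_function_C1[OF test_function_translate[OF t]]] .
  have mphi[measurable]: "(\<lambda>x. \<phi> (x + c)) \<in> borel_measurable borel" for c
    by (rule borel_measurable_continuous_onI[OF cphi])
  have int: "integrable lebesgue (\<lambda>x. h x * \<phi> (x + c))" for c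
  proof -
    obtain L where L: "compact L" "\<And>y. y \<notin> L \<Longrightarrow> \<phi> (y + c) = 0"
      using test_function_support[OF test_function_translate[OF t]] by metis
    show ?thesis using integrable_loc_int_mult[OF loc cphi L] by (simp add: mult.commute)
  qed
  have const: "(\<integral>x. h x * \<phi> x \<partial>lebesgue) = (\<integral>x. h x * \<phi> (x + real n *\<^sub>R j) \<partial>lebesgue)" for n
  proof -
    \<comment> \<open>Here c = 0: the gradients of all translates of \<phi> are orthogonal to
      h.\<close>
    have "(\<integral>x. G x * (\<phi> (x + real n *\<^sub>R j) - \<phi> x) \<partial>lborel) = real n * 0"
    proof (rule integral_translation_difference[OF G _ C1 K _ j])
      fix R
      have "integrable lebesgue (\<lambda>x. indicator (cball 0 R) x * h x)"
        using loc by (simp add: loc_int_def set_integrable_def)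
      then have "integrable lebesgue (\<lambda>x. indicator (cball 0 R) x * G x)"
        by (rule integrable_cong_AE_imp)
           (use hG in \<open>auto intro!: borel_measurable_times borel_measurable_indicator fmeasurableD\<close>)
      then show "integrable lborel (\<lambda>x. indicator (cball 0 R) x * G x)"
        by (subst (asm) integrable_completion) (auto intro!: borel_measurable_times borel_measurable_indicator)
    next
      fix s
      note t' = test_function_translate[OF t, of "s *\<^sub>R j"]
      have cg: "continuous_on UNIV (\<lambda>x. grad \<phi> (x + s *\<^sub>R j))"
        using test_function_C1[OF t'] unfolding C1_function_def grad_translate[OF C1, abs_def] by simp
      have ig: "integrable lebesgue (\<lambda>x. h x *\<^sub>R grad \<phi> (x + s *\<^sub>R j))"
        using integrable_loc_int_grad[OF loc t'] by (simp add: grad_translate[OF C1])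
      have "(\<integral>x. G x * (grad \<phi> (x + s *\<^sub>R j) \<bullet> j) \<partial>lborel) = (\<integral>x. h x * (grad \<phi> (x + s *\<^sub>R j) \<bullet> j) \<partial>lebesgue)"
        by (intro leb_eq borel_measurable_continuous_onI continuous_intros cg)
      also have "\<dots> = (\<integral>x. h x *\<^sub>R grad \<phi> (x + s *\<^sub>R j) \<partial>lebesgue) \<bullet> j"
        using integral_inner_left[of j lebesgue "\<lambda>x. h x *\<^sub>R grad \<phi> (x + s *\<^sub>R j)"] ig by simp
      also have "\<dots> = 0"
        using grad0[OF test_function_translate[OF t, of "s *\<^sub>R j"]] by (simp add: grad_translate[OF C1])
      finally show "(\<integral>x. G x * (grad \<phi> (x + s *\<^sub>R j) \<bullet> j) \<partial>lborel) = 0" .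
    qed auto
    moreover have "(\<integral>x. G x * (\<phi> (x + real n *\<^sub>R j) - \<phi> x) \<partial>lborel) = (\<integral>x. h x * (\<phi> (x + real n *\<^sub>R j) - \<phi> x) \<partial>lebesgue)"
      using mphi[of 0] by (intro leb_eq) simp
    moreover have "\<dots> = (\<integral>x. h x * \<phi> (x + real n *\<^sub>R j) \<partial>lebesgue) - (\<integral>x. h x * \<phi> x \<partial>lebesgue)"
      using int[of "real n *\<^sub>R j"] int[of 0] by (simp add: right_diff_distrib)
    ultimately show ?thesis by simp
  qed
  obtain R where R: "\<And>y. y \<in> K \<Longrightarrow> norm y \<le> R" using compact_imp_bounded[OF K(1)] bounded_iff by blast
  have "(\<lambda>n. \<integral>x. indicator K (x + real n *\<^sub>R j) * (norm (h x) powr P) \<partial>lebesgue) \<longlonglongrightarrow> (\<integral>x. 0 \<partial>(lebesgue :: 'a measure))"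
  proof (rule integral_dominated_convergence)
    show "integrable lebesgue (\<lambda>x. norm (h x) powr P)" by (rule Lp_spaceD[OF h])
    have "(\<lambda>x. indicator K (x + real n *\<^sub>R j) :: real) \<in> borel_measurable borel" for n
      by (rule measurable_compose[OF _ borel_measurable_indicator[of K borel], of "\<lambda>x. x + real n *\<^sub>R j"])
        (use K(1) in \<open>auto simp: borel_compact\<close>)
    then have [measurable]: "(\<lambda>x. indicator K (x + real n *\<^sub>R j) :: real) \<in> borel_measurable lebesgue" for n
      by (intro measurable_completion) simp
    show "(\<lambda>x. indicator K (x + real n *\<^sub>R j) * norm (h x) powr P) \<in> borel_measurable lebesgue" for n
      by measurable
    show "AE x in lebesgue. (\<lambda>n. indicator K (x + real n *\<^sub>R j) * norm (h x) powr P) \<longlonglongrightarrow> 0"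
    proof (intro AE_I2 tendsto_eventually)
      fix x :: 'a
      obtain m where m: "norm x + R < real m" using reals_Archimedean2 by blast
      show "\<forall>\<^sub>F n in sequentially. indicator K (x + real n *\<^sub>R j) * norm (h x) powr P = 0"
        using eventually_ge_at_top[of m]
      proof eventually_elim
        case (elim n)
        have "norm (x + real n *\<^sub>R j) \<ge> real n - norm x"
          using norm_triangle_ineq2[of "real n *\<^sub>R j" "- x"] nj by (simp add: add.commute)
        then have "x + real n *\<^sub>R j \<notin> K" using R[of "x + real n *\<^sub>R j"] m elim by fastforce
        then show ?case by simp
      qed
    qed
    show "AE x in lebesgue. norm (indicator K (x + real n *\<^sub>R j) * norm (h x) powr P) \<le> norm (h x) powr P" for n
      by (auto simp: indicator_def)
  qed simp
  then have lim0: "(\<lambda>n. \<integral>x. indicator K (x + real n *\<^sub>R j) * (norm (h x) powr P) \<partial>lebesgue) \<longlonglongrightarrow> 0" by simp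
  define q where "q = P / (P - 1)"
  have q: "q > 0" "1 / P + 1 / q = 1" using P by (auto simp: q_def field_simps)
  define C where "C = Lp_int q \<phi> powr (1 / q)"
  \<comment> \<open>Hoelder's inequality on the translated support. The factor C from \<phi> is
    invariant under translation, so smallness comes from the mass of h far away, which tends to 0
    because P is finite.\<close>
  have bnd: "norm (\<integral>x. h x * \<phi> x \<partial>lebesgue) \<le>
     (\<integral>x. indicator K (x + real n *\<^sub>R j) * (norm (h x) powr P) \<partial>lebesgue) powr (1 / P) * C" for n
  proof -
    have tq: "(\<lambda>x. \<phi> (x + real n *\<^sub>R j)) \<in> Lp_space q"
      by (rule test_function_Lp_space[OF test_function_translate[OF t] q(1)])
    have "(\<lambda>x. indicator K (x + real n *\<^sub>R j) :: real) \<in> borel_measurable borel"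
      by (rule measurable_compose[OF _ borel_measurable_indicator[of K borel], of "\<lambda>x. x + real n *\<^sub>R j"])
        (use K(1) in \<open>auto simp: borel_compact\<close>)
    then have [measurable]: "(\<lambda>x. indicator K (x + real n *\<^sub>R j) :: real) \<in> borel_measurable lebesgue"
      by (intro measurable_completion) simp
    have i1: "integrable lebesgue (\<lambda>x. indicator K (x + real n *\<^sub>R j) * (norm (h x) powr P))"
    proof (rule Bochner_Integration.integrable_bound[OF Lp_spaceD(2)[OF h]])
      show "(\<lambda>x. indicator K (x + real n *\<^sub>R j) * (norm (h x) powr P)) \<in> borel_measurable lebesgue"
        by measurable
    qed (auto simp: indicator_def)
    have tr: "(Lp_int q (\<lambda>x. \<phi> (x + real n *\<^sub>R j))) = Lp_int q \<phi>"
    proof -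
      have "(\<integral>x. norm (\<phi> x) powr q \<partial>lborel) = (\<integral>x. norm (\<phi> x) powr q \<partial>(distr lborel borel ((+) (real n *\<^sub>R j))))"
        by (simp add: lborel_distr_plus)
      also have "\<dots> = (\<integral>x. norm (\<phi> (real n *\<^sub>R j + x)) powr q \<partial>lborel)"
        using mphi[of 0] by (intro integral_distr) auto
      finally show ?thesis
        using mphi[of 0] by (simp add: integral_completion add.commute)
    qed
    have "norm (\<integral>x. h x * \<phi> x \<partial>lebesgue) = norm (\<integral>x. h x * \<phi> (x + real n *\<^sub>R j) \<partial>lebesgue)"
      using const[of n] by simp
    also have "\<dots> \<le> (\<integral>x. norm (h x * \<phi> (x + real n *\<^sub>R j)) \<partial>lebesgue)" by (rule integral_norm_bound)
    also have "\<dots> = (\<integral>x. (indicator K (x + real n *\<^sub>R j) * (norm (h x) powr P)) powr (1 / P) *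
       (norm (\<phi> (x + real n *\<^sub>R j)) powr q) powr (1 / q) \<partial>lebesgue)"
      using P q K(2) by (intro Bochner_Integration.integral_cong refl)
        (auto simp: powr_powr abs_mult indicator_def)
    also have "\<dots> \<le> (\<integral>x. indicator K (x + real n *\<^sub>R j) * (norm (h x) powr P) \<partial>lebesgue) powr (1 / P)
       * (Lp_int q (\<lambda>x. \<phi> (x + real n *\<^sub>R j))) powr (1 / q)"
      by (rule integral_Holder2) (use P q i1 Lp_spaceD[OF tq] in auto)
    finally show ?thesis by (simp only: tr C_def)
  qed
  have "(\<lambda>n. (\<integral>x. indicator K (x + real n *\<^sub>R j) * (norm (h x) powr P) \<partial>lebesgue) powr (1 / P)) \<longlonglongrightarrow> 0"
    by (rule tendsto_zero_powrI[OF lim0 tendsto_const]) (use P in auto)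
  then have "(\<lambda>n. (\<integral>x. indicator K (x + real n *\<^sub>R j) * (norm (h x) powr P) \<partial>lebesgue) powr (1 / P) * C) \<longlonglongrightarrow> 0"
    by (rule tendsto_mult_left_zero)
  then have "norm (\<integral>x. h x * \<phi> x \<partial>lebesgue) \<le> 0"
    by (rule LIMSEQ_le_const) (use bnd in auto)
  then show "(\<integral>x. \<phi> x * h x \<partial>lebesgue) = 0" by (simp add: mult.commute)
qed

lemma weak_gradient_unique:
  assumes "has_weak_gradient w G" "has_weak_gradient w H"
  shows "AE x in lebesgue. G x = H x"
proof -
  have l: "loc_int G" "loc_int H" using assms by (auto simp: has_weak_gradient_def loc_int_def)
  have "AE x in lebesgue. (G x - H x) \<bullet> j = 0" if "j \<in> Basis" for j
  proof (rule eq_0_if_orthogonal_to_test_functions)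
    show "loc_int (\<lambda>x. (G x - H x) \<bullet> j)" by (intro loc_int_inner loc_int_diff l)
    fix \<phi> :: "'a \<Rightarrow> real" assume t: "test_function \<phi>"
    obtain K where K: "compact K" "\<And>y. y \<notin> K \<Longrightarrow> \<phi> y = 0" using test_function_support[OF t] by blast
    note c = C1_continuous[OF test_function_C1[OF t]]
    note i = integrable_loc_int_mult[OF l(1) c K] integrable_loc_int_mult[OF l(2) c K]
    have "(\<integral>x. \<phi> x *\<^sub>R G x \<partial>lebesgue) = (\<integral>x. \<phi> x *\<^sub>R H x \<partial>lebesgue)"
      using assms t unfolding has_weak_gradient_def by (metis neg_equal_iff_equal)
    then have "(\<integral>x. \<phi> x *\<^sub>R G x - \<phi> x *\<^sub>R H x \<partial>lebesgue) \<bullet> j = 0"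
      using i by simp
    moreover have "(\<integral>x. (\<phi> x *\<^sub>R G x - \<phi> x *\<^sub>R H x) \<bullet> j \<partial>lebesgue) = (\<integral>x. \<phi> x *\<^sub>R G x - \<phi> x *\<^sub>R H x \<partial>lebesgue) \<bullet> j"
      by (rule integral_inner_left) (use i in simp)
    ultimately show "(\<integral>x. \<phi> x * ((G x - H x) \<bullet> j) \<partial>lebesgue) = 0"
      by (simp add: inner_diff_left right_diff_distrib)
  qed
  then have "AE x in lebesgue. \<forall>j\<in>Basis. (G x - H x) \<bullet> j = 0"
    by (subst AE_ball_countable) (auto intro: countable_finite)
  then show ?thesis
    by eventually_elim (metis euclidean_all_zero_iff eq_iff_diff_eq_0)
qed

section \<open>The space of functions with finite Dirichlet norm\<close>

text \<open>The closure of the graph of \<^const>\<open>grad\<close> on test functions: it describes \<open>\<D>\<^sup>1\<^sup>,\<^sup>p\<close> without the choice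
  hidden in \<^const>\<open>weak_grad\<close>.\<close>

definition D1p_pair :: "real \<Rightarrow> ('a::euclidean_space \<Rightarrow> real) \<Rightarrow> ('a \<Rightarrow> 'a) \<Rightarrow> bool" where
  "D1p_pair p w G \<longleftrightarrow> w \<in> Lp_space (critical_exponent DIM('a) p) \<and> G \<in> Lp_space p \<and>
     (\<exists>\<phi>. (\<forall>n::nat. test_function (\<phi> n)) \<and>
       (\<lambda>n. \<integral>x. norm (\<phi> n x - w x) powr critical_exponent DIM('a) p \<partial>lebesgue) \<longlonglongrightarrow> 0 \<and>
       (\<lambda>n. Lp_int p (\<lambda>x. grad (\<phi> n) x - G x)) \<longlonglongrightarrow> 0)"

lemma critical_exponent_gt:
  assumes "1 < p" "p < real n"
  shows "p < critical_exponent n p"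
  using assms by (simp add: critical_exponent_def field_simps)

context
  fixes p P Sob :: real and ty :: "'a::euclidean_space itself"
  assumes p: "1 < p" "p < real DIM('a)" and P_def: "P = critical_exponent DIM('a) p"
    and Sob_def: "Sob = p * (real DIM('a) - 1) / (real DIM('a) - p)"
begin

lemma P_gt: "p < P" "1 < P" "0 < P"
  using critical_exponent_gt[OF p] p P_def by auto

lemma D1p_pairD:
  fixes w :: "'a \<Rightarrow> real"
  assumes "D1p_pair p w G"
  obtains \<phi> where "w \<in> Lp_space P" "G \<in> Lp_space p" "\<And>n::nat. test_function (\<phi> n)"
    "(\<lambda>n. Lp_int P (\<lambda>x. \<phi> n x - w x)) \<longlonglongrightarrow> 0"
    "(\<lambda>n. Lp_int p (\<lambda>x. grad (\<phi> n) x - G x)) \<longlonglongrightarrow> 0"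
  using assms unfolding D1p_pair_def P_def by blast

text \<open>For each approximant both sides are integrals against fixed continuous functions with
  compact support, and these pass to the limit under L^P and L^p convergence. Components are taken
  because \<open>integral_mult_tendsto_Lp\<close> is scalar.\<close>

lemma D1p_pair_weak_gradient:
  fixes w :: "'a \<Rightarrow> real"
  assumes "D1p_pair p w G"
  shows "has_weak_gradient w G"
proof -
  obtain \<phi> where w: "w \<in> Lp_space P" and G: "G \<in> Lp_space p" and t: "\<And>n::nat. test_function (\<phi> n)"
    and l1: "(\<lambda>n. Lp_int P (\<lambda>x. \<phi> n x - w x)) \<longlonglongrightarrow> 0"
    and l2: "(\<lambda>n. Lp_int p (\<lambda>x. grad (\<phi> n) x - G x)) \<longlonglongrightarrow> 0"
    by (rule D1p_pairD[OF assms], rule that)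
  have lw: "loc_int w" using Lp_space_loc_int[OF w] P_gt by simp
  have lG: "loc_int G" using Lp_space_loc_int[OF G] p by simp
  have "(\<integral>x. w x *\<^sub>R grad \<psi> x \<partial>lebesgue) = - (\<integral>x. \<psi> x *\<^sub>R G x \<partial>lebesgue)" if t\<psi>: "test_function \<psi>" for \<psi>
  proof (rule euclidean_eqI)
    fix j :: 'a assume j: "j \<in> Basis"
    obtain K where K: "compact K" "\<And>y. y \<notin> K \<Longrightarrow> \<psi> y = 0" and g0: "\<And>y. y \<notin> K \<Longrightarrow> grad \<psi> y = 0"
      and c0: "continuous_on UNIV \<psi>" and c1: "continuous_on UNIV (grad \<psi>)"
      by (rule test_functionE[OF t\<psi>], rule that)
    have c: "continuous_on UNIV (\<lambda>x. grad \<psi> x \<bullet> j)" using c1 by (intro continuous_intros)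
    have inner_left: "(\<integral>x. v x *\<^sub>R grad \<psi> x \<partial>lebesgue) \<bullet> j = (\<integral>x. (grad \<psi> x \<bullet> j) * v x \<partial>lebesgue)"
      if v: "loc_int v" for v :: "'a \<Rightarrow> real"
    proof -
      have "(\<integral>x. (v x *\<^sub>R grad \<psi> x) \<bullet> j \<partial>lebesgue) = (\<integral>x. v x *\<^sub>R grad \<psi> x \<partial>lebesgue) \<bullet> j"
        by (intro integral_inner_left integrable_loc_int_grad[OF v t\<psi>])
      then show ?thesis by (simp add: mult.commute)
    qed
    have inner_right: "(\<integral>x. \<psi> x *\<^sub>R H x \<partial>lebesgue) \<bullet> j = (\<integral>x. \<psi> x * (H x \<bullet> j) \<partial>lebesgue)"
      if H: "loc_int H" for H :: "'a \<Rightarrow> 'a"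
    proof -
      have "(\<integral>x. (\<psi> x *\<^sub>R H x) \<bullet> j \<partial>lebesgue) = (\<integral>x. \<psi> x *\<^sub>R H x \<partial>lebesgue) \<bullet> j"
        by (intro integral_inner_left integrable_loc_int_mult[OF H c0 K])
      then show ?thesis by simp
    qed
    have inner_Lp: "(\<lambda>x. H x \<bullet> j) \<in> Lp_space p" if "H \<in> Lp_space p" for H :: "'a \<Rightarrow> 'a"
      by (rule Lp_space_bound[OF that, of _ 1]) (use Lp_spaceD(1)[OF that] Basis_le_norm[OF j] p in auto)
    have "(\<lambda>n. \<integral>x. (grad \<psi> x \<bullet> j) * \<phi> n x \<partial>lebesgue) \<longlonglongrightarrow> (\<integral>x. (grad \<psi> x \<bullet> j) * w x \<partial>lebesgue)"
      by (rule integral_mult_tendsto_Lp[OF P_gt(2) _ w l1 c K(1)])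
         (use t P_gt g0 in \<open>auto intro: test_function_Lp_space\<close>)
    then have lim1: "(\<lambda>n. (\<integral>x. \<phi> n x *\<^sub>R grad \<psi> x \<partial>lebesgue) \<bullet> j) \<longlonglongrightarrow> (\<integral>x. w x *\<^sub>R grad \<psi> x \<partial>lebesgue) \<bullet> j"
      using continuous_loc_int[OF C1_continuous[OF test_function_C1[OF t]]] lw by (simp add: inner_left)
    have Lpn: "grad (\<phi> n) \<in> Lp_space p" for n using t p by (intro test_function_Lp_space) auto
    have "(\<lambda>n. Lp_int p (\<lambda>x. grad (\<phi> n) x \<bullet> j - G x \<bullet> j)) \<longlonglongrightarrow> 0"
    proof (rule Lim_null_comparison[OF _ l2], intro always_eventually allI)
      fix n
      have d: "(\<lambda>x. grad (\<phi> n) x - G x) \<in> Lp_space p" using p by (intro Lp_space_diff Lpn G) simp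
      have "(Lp_int p (\<lambda>x. grad (\<phi> n) x \<bullet> j - G x \<bullet> j)) \<le> (Lp_int p (\<lambda>x. grad (\<phi> n) x - G x))"
      proof (rule integral_mono)
        show "integrable lebesgue (\<lambda>x. norm (grad (\<phi> n) x \<bullet> j - G x \<bullet> j) powr p)"
          using Lp_spaceD(2)[OF inner_Lp[OF d]] by (simp add: inner_diff_left)
        show "integrable lebesgue (\<lambda>x. norm (grad (\<phi> n) x - G x) powr p)" by (rule Lp_spaceD[OF d])
        show "norm (grad (\<phi> n) x \<bullet> j - G x \<bullet> j) powr p \<le> norm (grad (\<phi> n) x - G x) powr p" for x
          using Basis_le_norm[OF j, of "grad (\<phi> n) x - G x"] p by (intro powr_mono2) (auto simp: inner_diff_left)
      qed
      then show "norm (Lp_int p (\<lambda>x. grad (\<phi> n) x \<bullet> j - G x \<bullet> j)) \<le> (Lp_int p (\<lambda>x. grad (\<phi> n) x - G x))"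
        by simp
    qed
    then have "(\<lambda>n. \<integral>x. \<psi> x * (grad (\<phi> n) x \<bullet> j) \<partial>lebesgue) \<longlonglongrightarrow> (\<integral>x. \<psi> x * (G x \<bullet> j) \<partial>lebesgue)"
      by (intro integral_mult_tendsto_Lp[OF p(1) _ _ _ c0 K] inner_Lp Lpn G)
    then have lim2: "(\<lambda>n. (\<integral>x. \<psi> x *\<^sub>R grad (\<phi> n) x \<partial>lebesgue) \<bullet> j) \<longlonglongrightarrow> (\<integral>x. \<psi> x *\<^sub>R G x \<partial>lebesgue) \<bullet> j"
      using Lp_space_loc_int[OF Lpn] p lG by (simp add: inner_right)
    have "(\<integral>x. \<phi> n x *\<^sub>R grad \<psi> x \<partial>lebesgue) = - (\<integral>x. \<psi> x *\<^sub>R grad (\<phi> n) x \<partial>lebesgue)" for n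
      using test_function_weak_gradient[OF t[of n]] t\<psi> by (simp add: has_weak_gradient_def)
    then have "(\<lambda>n. (\<integral>x. \<phi> n x *\<^sub>R grad \<psi> x \<partial>lebesgue) \<bullet> j) \<longlonglongrightarrow> - ((\<integral>x. \<psi> x *\<^sub>R G x \<partial>lebesgue) \<bullet> j)"
      using tendsto_minus[OF lim2] by simp
    with lim1 have "(\<integral>x. w x *\<^sub>R grad \<psi> x \<partial>lebesgue) \<bullet> j = - ((\<integral>x. \<psi> x *\<^sub>R G x \<partial>lebesgue) \<bullet> j)"
      by (rule LIMSEQ_unique)
    then show "(\<integral>x. w x *\<^sub>R grad \<psi> x \<partial>lebesgue) \<bullet> j = (- (\<integral>x. \<psi> x *\<^sub>R G x \<partial>lebesgue)) \<bullet> j" by simp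
  qed
  then show ?thesis using lw lG by (simp add: has_weak_gradient_def loc_int_def)
qed

lemma D1p_pair_imp_D1p:
  fixes w :: "'a \<Rightarrow> real"
  assumes pair: "D1p_pair p w G"
  shows "w \<in> D1p_space p" "AE x in lebesgue. weak_grad w x = G x"
proof -
  obtain \<phi> where w: "w \<in> Lp_space P" and G: "G \<in> Lp_space p" and t: "\<And>n::nat. test_function (\<phi> n)"
    and l1: "(\<lambda>n. Lp_int P (\<lambda>x. \<phi> n x - w x)) \<longlonglongrightarrow> 0"
    and l2: "(\<lambda>n. Lp_int p (\<lambda>x. grad (\<phi> n) x - G x)) \<longlonglongrightarrow> 0"
    by (rule D1p_pairD[OF assms], rule that)
  have hw: "has_weak_gradient w G" by (rule D1p_pair_weak_gradient[OF pair])
  have hw': "has_weak_gradient w (weak_grad w)"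
    using someI[of "has_weak_gradient w", OF hw] by (simp add: weak_grad_def)
  show eq: "AE x in lebesgue. weak_grad w x = G x" by (rule weak_gradient_unique[OF hw' hw])
  have m: "weak_grad w \<in> borel_measurable lebesgue"
    using hw' by (intro loc_int_measurable) (simp add: has_weak_gradient_def loc_int_def)
  note [measurable] = m Lp_spaceD(1)[OF G]
  have "integrable lebesgue (\<lambda>x. norm (weak_grad w x) powr p)"
    by (rule integrable_cong_AE_imp[OF Lp_spaceD(2)[OF G]]) (use eq in auto)
  then have wL: "weak_grad w \<in> Lp_space p" using m by (simp add: Lp_space_def)
  have "\<exists>\<phi>. test_function \<phi> \<and> Lp_norm p (\<lambda>x. grad \<phi> x - weak_grad w x) < \<epsilon>" if "\<epsilon> > 0" for \<epsilon>
  proof -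
    have "(\<lambda>n. (Lp_int p (\<lambda>x. grad (\<phi> n) x - G x)) powr (1 / p)) \<longlonglongrightarrow> 0"
      by (rule tendsto_zero_powrI[OF l2 tendsto_const]) (use p in auto)
    then have "\<forall>\<^sub>F n in sequentially. (Lp_int p (\<lambda>x. grad (\<phi> n) x - G x)) powr (1 / p) < \<epsilon>"
      using that by (rule order_tendstoD)
    then obtain n where n: "(Lp_int p (\<lambda>x. grad (\<phi> n) x - G x)) powr (1 / p) < \<epsilon>"
      by (auto simp: eventually_sequentially)
    have [measurable]: "grad (\<phi> n) \<in> borel_measurable lebesgue"
      using test_function_Lp_space(2)[OF t, of p] p by (auto dest: Lp_spaceD)
    have "(Lp_int p (\<lambda>x. grad (\<phi> n) x - weak_grad w x)) = (Lp_int p (\<lambda>x. grad (\<phi> n) x - G x))"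
      by (rule integral_cong_AE) (use eq in auto)
    then show ?thesis using n t unfolding Lp_norm_def by metis
  qed
  then show "w \<in> D1p_space p" using w wL hw unfolding D1p_space_def P_def by blast
qed

lemma D1p_pair_cong_AE:
  fixes w :: "'a \<Rightarrow> real"
  assumes pair: "D1p_pair p w G" and v: "v \<in> borel_measurable lebesgue" and eq: "AE x in lebesgue. w x = v x"
  shows "D1p_pair p v G"
proof -
  obtain \<phi> where w: "w \<in> Lp_space P" and G: "G \<in> Lp_space p" and t: "\<And>n::nat. test_function (\<phi> n)"
    and l1: "(\<lambda>n. Lp_int P (\<lambda>x. \<phi> n x - w x)) \<longlonglongrightarrow> 0"
    and l2: "(\<lambda>n. Lp_int p (\<lambda>x. grad (\<phi> n) x - G x)) \<longlonglongrightarrow> 0"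
    by (rule D1p_pairD[OF assms(1)], rule that)
  note [measurable] = v Lp_spaceD(1)[OF w]
  have "integrable lebesgue (\<lambda>x. norm (v x) powr P)"
    by (rule integrable_cong_AE_imp[OF Lp_spaceD(2)[OF w]]) (use eq in auto)
  moreover have "(Lp_int P (\<lambda>x. \<phi> n x - w x)) = (Lp_int P (\<lambda>x. \<phi> n x - v x))" for n
  proof -
    have [measurable]: "\<phi> n \<in> borel_measurable lebesgue"
      using test_function_Lp_space(1)[OF t, of p] p by (auto dest: Lp_spaceD)
    show ?thesis by (rule integral_cong_AE) (use eq in auto)
  qed
  ultimately show ?thesis
    using v G t l1 l2 unfolding D1p_pair_def P_def[symmetric] by (auto simp: Lp_space_def intro!: exI[of _ \<phi>])
qed

lemma D1p_pair_closed:
  fixes w :: "'a \<Rightarrow> real"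
  assumes pair: "\<And>n::nat. D1p_pair p (w' n) (G' n)" and w: "w \<in> Lp_space P" and G: "G \<in> Lp_space p"
    and l1: "(\<lambda>n. Lp_int P (\<lambda>x. w' n x - w x)) \<longlonglongrightarrow> 0"
    and l2: "(\<lambda>n. Lp_int p (\<lambda>x. G' n x - G x)) \<longlonglongrightarrow> 0"
  shows "D1p_pair p w G"
proof -
  have Lw: "w' n \<in> Lp_space P" "G' n \<in> Lp_space p" for n using pair by (auto simp: D1p_pair_def P_def)
  have "\<exists>\<phi>. \<forall>n. test_function (\<phi> n) \<and> (Lp_int P (\<lambda>x. \<phi> n x - w' n x)) < 1 / real (Suc n) \<and>
      (Lp_int p (\<lambda>x. grad (\<phi> n) x - G' n x)) < 1 / real (Suc n)"
  proof (intro choice allI)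
    fix n
    obtain \<phi> where "w' n \<in> Lp_space P" "G' n \<in> Lp_space p" and t: "\<And>m::nat. test_function (\<phi> m)"
      and l1: "(\<lambda>m. Lp_int P (\<lambda>x. \<phi> m x - w' n x)) \<longlonglongrightarrow> 0"
      and l2: "(\<lambda>m. Lp_int p (\<lambda>x. grad (\<phi> m) x - G' n x)) \<longlonglongrightarrow> 0"
      by (rule D1p_pairD[OF pair], rule that)
    have "\<forall>\<^sub>F m in sequentially. (Lp_int P (\<lambda>x. \<phi> m x - w' n x)) < 1 / real (Suc n) \<and>
        (Lp_int p (\<lambda>x. grad (\<phi> m) x - G' n x)) < 1 / real (Suc n)"
      by (intro eventually_conj order_tendstoD(2)[OF l1] order_tendstoD(2)[OF l2]) auto
    then show "\<exists>\<phi>. test_function \<phi> \<and> (Lp_int P (\<lambda>x. \<phi> x - w' n x)) < 1 / real (Suc n) \<and>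
      (Lp_int p (\<lambda>x. grad \<phi> x - G' n x)) < 1 / real (Suc n)"
      using t by (auto simp: eventually_sequentially)
  qed
  then obtain \<phi> where t: "\<And>n. test_function (\<phi> n)"
    and b1: "\<And>n. (Lp_int P (\<lambda>x. \<phi> n x - w' n x)) < 1 / real (Suc n)"
    and b2: "\<And>n. (Lp_int p (\<lambda>x. grad (\<phi> n) x - G' n x)) < 1 / real (Suc n)"
    by blast
  have z: "(\<lambda>n. 1 / real (Suc n)) \<longlonglongrightarrow> 0" using LIMSEQ_inverse_real_of_nat by (simp add: inverse_eq_divide)
  have "(\<lambda>n. Lp_int P (\<lambda>x. \<phi> n x - w x)) \<longlonglongrightarrow> 0"
  proof (rule Lim_null_comparison, intro always_eventually allI)
    fix n
    have "(Lp_int P (\<lambda>x. (\<phi> n x - w' n x) + (w' n x - w x))) \<le>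
       2 powr P * ((Lp_int P (\<lambda>x. \<phi> n x - w' n x)) + (Lp_int P (\<lambda>x. w' n x - w x)))"
      by (intro Lp_space_add(2) Lp_space_diff test_function_Lp_space t Lw w) (use P_gt in auto)
    also have "\<dots> \<le> 2 powr P * (1 / real (Suc n) + (Lp_int P (\<lambda>x. w' n x - w x)))"
      using b1[of n] by (intro mult_left_mono add_right_mono) auto
    finally show "norm (Lp_int P (\<lambda>x. \<phi> n x - w x)) \<le> 2 powr P * (1 / real (Suc n) + (Lp_int P (\<lambda>x. w' n x - w x)))"
      by simp
  next
    show "(\<lambda>n. 2 powr P * (1 / real (Suc n) + (Lp_int P (\<lambda>x. w' n x - w x)))) \<longlonglongrightarrow> 0"
      using tendsto_mult[OF tendsto_const tendsto_add[OF z l1], of "2 powr P"] by simp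
  qed
  moreover have "(\<lambda>n. Lp_int p (\<lambda>x. grad (\<phi> n) x - G x)) \<longlonglongrightarrow> 0"
  proof (rule Lim_null_comparison, intro always_eventually allI)
    fix n
    have "(Lp_int p (\<lambda>x. (grad (\<phi> n) x - G' n x) + (G' n x - G x))) \<le>
       2 powr p * ((Lp_int p (\<lambda>x. grad (\<phi> n) x - G' n x)) + (Lp_int p (\<lambda>x. G' n x - G x)))"
      by (intro Lp_space_add(2) Lp_space_diff test_function_Lp_space t Lw G) (use p in auto)
    also have "\<dots> \<le> 2 powr p * (1 / real (Suc n) + (Lp_int p (\<lambda>x. G' n x - G x)))"
      using b2[of n] by (intro mult_left_mono add_right_mono) auto
    finally show "norm (Lp_int p (\<lambda>x. grad (\<phi> n) x - G x)) \<le> 2 powr p * (1 / real (Suc n) + (Lp_int p (\<lambda>x. G' n x - G x)))"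
      by simp
  next
    show "(\<lambda>n. 2 powr p * (1 / real (Suc n) + (Lp_int p (\<lambda>x. G' n x - G x)))) \<longlonglongrightarrow> 0"
      using tendsto_mult[OF tendsto_const tendsto_add[OF z l2], of "2 powr p"] by simp
  qed
  ultimately show ?thesis
    using w G t unfolding D1p_pair_def P_def[symmetric] by (auto intro!: exI[of _ \<phi>])
qed

section \<open>Sobolev's inequality on the closure, and the two descriptions of the space\<close>

lemma Sob_pos: "Sob > 0"
  using p by (simp add: Sob_def)

lemma Sobolev_test_function:
  fixes \<phi> :: "'a \<Rightarrow> real"
  assumes "test_function \<phi>"
  shows "Lp_int P \<phi> \<le> (Sob * (Lp_int p (grad \<phi>)) powr (1 / p)) powr P"
proof -
  have C: "C1_function \<phi>" by (rule test_function_C1[OF assms])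
  obtain K where K: "compact K" "\<And>y. y \<notin> K \<Longrightarrow> \<phi> y = 0" using test_function_support[OF assms] by blast
  have [measurable]: "\<phi> \<in> borel_measurable borel" "grad \<phi> \<in> borel_measurable borel"
    using C C1_continuous[OF C] by (auto simp: C1_function_def intro: borel_measurable_continuous_onI)
  define I where "I = Lp_int P \<phi>"
  have I: "I \<ge> 0" by (simp add: I_def)
  have "I powr (1 / P) \<le> Sob * (Lp_int p (grad \<phi>)) powr (1 / p)"
    using Sobolev_inequality[OF C K p] by (simp add: integral_completion I_def Sob_def P_def)
  then have "(I powr (1 / P)) powr P \<le> (Sob * (Lp_int p (grad \<phi>)) powr (1 / p)) powr P"
    using P_gt by (intro powr_mono2) auto
  then show ?thesis using I P_gt by (simp add: powr_powr I_def)
qed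

text \<open>The inequality passes to the limit along the approximating test functions. The factor 4
  is 2 times 2: the constants \<open>2 powr P\<close> and \<open>2 powr p\<close> of the two
  quasi-triangle inequalities, after roots are taken.\<close>

lemma D1p_pair_Sobolev:
  fixes w :: "'a \<Rightarrow> real"
  assumes "D1p_pair p w G"
  shows "Lp_int P w powr (1 / P) \<le> 4 * Sob * Lp_int p G powr (1 / p)"
proof -
  obtain \<phi> where w: "w \<in> Lp_space P" and G: "G \<in> Lp_space p" and t: "\<And>n::nat. test_function (\<phi> n)"
    and l1: "(\<lambda>n. Lp_int P (\<lambda>x. \<phi> n x - w x)) \<longlonglongrightarrow> 0"
    and l2: "(\<lambda>n. Lp_int p (\<lambda>x. grad (\<phi> n) x - G x)) \<longlonglongrightarrow> 0"
    by (rule D1p_pairD[OF assms], rule that)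
  define D where "D = Lp_int p G"
  define I where "I = Lp_int P w"
  define e where "e n = (Lp_int P (\<lambda>x. \<phi> n x - w x))" for n
  define d where "d n = (Lp_int p (\<lambda>x. grad (\<phi> n) x - G x))" for n
  have ID: "I \<ge> 0" "D \<ge> 0" by (auto simp: I_def D_def)
  have Lt: "\<phi> n \<in> Lp_space P" "grad (\<phi> n) \<in> Lp_space p" for n
    using t P_gt p by (auto intro: test_function_Lp_space)
  have bound: "I \<le> 2 powr P * ((Sob * (2 powr p * (d n + D)) powr (1 / p)) powr P + e n)" for n
  proof -
    have g: "(Lp_int p (grad (\<phi> n))) \<le> 2 powr p * (d n + D)"
      using Lp_space_add(2)[OF Lp_space_diff(1)[OF Lt(2)[of n] G] G] p by (simp add: d_def D_def)
    have "(Lp_int P (\<phi> n)) \<le> (Sob * (Lp_int p (grad (\<phi> n))) powr (1 / p)) powr P"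
      by (rule Sobolev_test_function[OF t])
    also have "\<dots> \<le> (Sob * (2 powr p * (d n + D)) powr (1 / p)) powr P"
      using g Sob_pos p P_gt by (intro powr_mono2 mult_left_mono) auto
    finally have s: "(Lp_int P (\<phi> n)) \<le> (Sob * (2 powr p * (d n + D)) powr (1 / p)) powr P" .
    have "I \<le> 2 powr P * ((Lp_int P (\<phi> n)) + e n)"
      using Lp_space_diff(2)[OF Lt(1)[of n] Lp_space_diff(1)[OF Lt(1)[of n] w]] P_gt by (simp add: I_def e_def)
    also have "\<dots> \<le> 2 powr P * ((Sob * (2 powr p * (d n + D)) powr (1 / p)) powr P + e n)"
      using s by (intro mult_left_mono add_right_mono) auto
    finally show ?thesis .
  qed
  have "(\<lambda>n. 2 powr P * ((Sob * (2 powr p * (d n + D)) powr (1 / p)) powr P + e n))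
      \<longlonglongrightarrow> 2 powr P * ((Sob * (2 powr p * (0 + D)) powr (1 / p)) powr P + 0)"
    using l1 l2 p P_gt ID unfolding e_def[symmetric] d_def[symmetric]
    by (intro tendsto_intros tendsto_powr') (auto simp: d_def Sob_pos less_imp_le intro!: always_eventually)
  then have "I \<le> 2 powr P * ((Sob * (2 powr p * (0 + D)) powr (1 / p)) powr P + 0)"
    by (rule LIMSEQ_le_const) (use bound in auto)
  also have "(2 powr p * (0 + D)) powr (1 / p) = 2 * D powr (1 / p)"
    using p by (simp add: powr_mult powr_powr)
  also have "2 powr P * ((Sob * (2 * D powr (1 / p))) powr P + 0) = (4 * Sob * D powr (1 / p)) powr P"
    unfolding add_0_right powr_mult[symmetric] by (simp add: ac_simps)
  finally have "I powr (1 / P) \<le> ((4 * Sob * D powr (1 / p)) powr P) powr (1 / P)"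
    using ID P_gt by (intro powr_mono2) auto
  then show ?thesis using P_gt Sob_pos by (simp add: powr_powr I_def D_def)
qed

lemma D1p_imp_approx:
  fixes w :: "'a \<Rightarrow> real"
  assumes w: "w \<in> D1p_space p" and \<eta>: "\<eta> > 0"
  shows "\<exists>\<phi>. test_function \<phi> \<and> (Lp_int p (\<lambda>x. grad \<phi> x - weak_grad w x)) < \<eta>"
proof -
  obtain \<phi> where t: "test_function \<phi>" and n: "Lp_norm p (\<lambda>x. grad \<phi> x - weak_grad w x) < \<eta> powr (1 / p)"
    using w \<eta> unfolding D1p_space_def by (auto dest!: spec[of _ "\<eta> powr (1 / p)"])
  define I where "I = (Lp_int p (\<lambda>x. grad \<phi> x - weak_grad w x))"
  have "I \<ge> 0" by (simp add: I_def)
  have "I powr (1 / p) < \<eta> powr (1 / p)" using n by (simp add: Lp_norm_def I_def)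
  then have "I < \<eta>"
    using \<open>I \<ge> 0\<close> \<eta> p powr_mono2[of "1 / p" \<eta> I] by (auto simp: not_le[symmetric])
  then show ?thesis using t by (auto simp: I_def)
qed

text \<open>Test functions whose gradients approach that of \<open>w\<close> fast converge in \<open>L\<^sup>P\<close> to some \<open>v\<close>, by
  Sobolev's inequality; then \<open>v - w\<close> lies in \<open>L\<^sup>P\<close> and has weak gradient \<open>0\<close>.\<close>

lemma D1p_imp_pair:
  fixes w :: "'a \<Rightarrow> real"
  assumes w: "w \<in> D1p_space p"
  shows "D1p_pair p w (weak_grad w)"
proof -
  define G where "G = weak_grad w"
  have wP: "w \<in> Lp_space P" and G: "G \<in> Lp_space p" and "\<exists>G. has_weak_gradient w G"
    using w by (auto simp: D1p_space_def P_def G_def)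
  then have hw: "has_weak_gradient w G"
    unfolding G_def weak_grad_def by (metis (mono_tags) someI)
  \<comment> \<open>The ratio 1/4 leaves room for a weight 2^n in the proof of pointwise convergence
    below.\<close>
  have "\<exists>\<phi>. \<forall>n. test_function (\<phi> n) \<and> (Lp_int p (\<lambda>x. grad (\<phi> n) x - G x)) < ((1/4) ^ n) powr p"
    unfolding G_def by (intro choice allI D1p_imp_approx w) simp
  then obtain \<phi> where t: "\<And>n::nat. test_function (\<phi> n)"
    and b: "\<And>n. (Lp_int p (\<lambda>x. grad (\<phi> n) x - G x)) < ((1/4) ^ n) powr p" by blast
  have Lt: "\<phi> n \<in> Lp_space P" "grad (\<phi> n) \<in> Lp_space p" for n
    using t P_gt p by (auto intro: test_function_Lp_space)
  note mt[measurable] = Lp_spaceD(1)[OF Lt(1)]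
  define C where "C = Sob * 4"
  have Sob: "Sob > 0" using p by (simp add: Sob_def)
  have C: "C > 0" using Sob by (simp add: C_def)
  have E: "(Lp_int P (\<lambda>x. \<phi> n x - \<phi> m x)) \<le> (C * (1/4) ^ n) powr P" if nm: "n \<le> m" for n m
  proof -
    have "(Lp_int p (\<lambda>x. (grad (\<phi> n) x - G x) - (grad (\<phi> m) x - G x)))
      \<le> 2 powr p * ((Lp_int p (\<lambda>x. grad (\<phi> n) x - G x)) + (Lp_int p (\<lambda>x. grad (\<phi> m) x - G x)))"
      by (intro Lp_space_diff Lt G) (use p in auto)
    also have "\<dots> \<le> 2 powr p * (((1/4) ^ n) powr p + ((1/4) ^ n) powr p)"
    proof (intro mult_left_mono add_mono)
      have "((1/4::real) ^ m) powr p \<le> ((1/4) ^ n) powr p"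
        using p nm by (intro powr_mono2 power_decreasing) auto
      then show "(Lp_int p (\<lambda>x. grad (\<phi> m) x - G x)) \<le> ((1/4) ^ n) powr p" using b[of m] by simp
    qed (use b[of n] in auto)
    also have "\<dots> \<le> 2 powr p * (2 powr p * ((1/4) ^ n) powr p)"
      using p powr_mono[of 1 p 2] by (intro mult_left_mono) (auto intro: mult_right_mono)
    also have "\<dots> = (4 * (1/4) ^ n) powr p" by (simp add: powr_mult[symmetric])
    finally have g: "(Lp_int p (\<lambda>x. grad (\<phi> n) x - grad (\<phi> m) x)) \<le> (4 * (1/4) ^ n) powr p" by simp
    have "(Lp_int P (\<lambda>x. \<phi> n x - \<phi> m x))
      \<le> (Sob * (Lp_int p (\<lambda>x. grad (\<phi> n) x - grad (\<phi> m) x)) powr (1 / p)) powr P"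
      using Sobolev_test_function[OF test_function_diff[OF t[of n] t[of m]]]
      by (simp add: grad_diff test_function_C1 t)
    also have "\<dots> \<le> (Sob * ((4 * (1/4) ^ n) powr p) powr (1 / p)) powr P"
      using g Sob p P_gt by (intro powr_mono2 mult_left_mono) auto
    also have "\<dots> = (C * (1/4) ^ n) powr P" using p by (simp add: powr_powr C_def mult.assoc)
    finally show ?thesis .
  qed
  have Ld: "(\<lambda>x. \<phi> n x - \<phi> m x) \<in> Lp_space P" for n m using P_gt by (intro Lp_space_diff Lt) auto
  have nnE: "(\<integral>\<^sup>+x. ennreal (norm (\<phi> n x - \<phi> m x) powr P) \<partial>lebesgue) \<le> ennreal ((C * (1/4) ^ n) powr P)" if "n \<le> m" for n m
    using E[OF that] Lp_spaceD(2)[OF Ld] by (subst nn_integral_eq_integral) (auto intro: ennreal_leI)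
  have AEc: "AE x in lebesgue. convergent (\<lambda>n. \<phi> n x)"
  proof -
    \<comment> \<open>The weighted series has a finite integral because 2^n times C/4^n is C/2^n.
      Where S is finite, consecutive differences are at most a constant times (1/2)^n, so the
      sequence converges.\<close>
    define S where "S x = (\<Sum>n. ennreal ((2 ^ n) powr P * norm (\<phi> n x - \<phi> (Suc n) x) powr P))" for x
    have "(\<integral>\<^sup>+x. S x \<partial>lebesgue) = (\<Sum>n. \<integral>\<^sup>+x. ennreal ((2 ^ n) powr P * norm (\<phi> n x - \<phi> (Suc n) x) powr P) \<partial>lebesgue)"
      unfolding S_def by (rule nn_integral_suminf) measurable
    also have "\<dots> \<le> (\<Sum>n. ennreal (C powr P * (1/2) ^ n))"
    proof (intro suminf_le summableI)
      fix n
      have "(\<integral>\<^sup>+x. ennreal ((2 ^ n) powr P * norm (\<phi> n x - \<phi> (Suc n) x) powr P) \<partial>lebesgue)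
        = ennreal ((2 ^ n) powr P) * (\<integral>\<^sup>+x. ennreal (norm (\<phi> n x - \<phi> (Suc n) x) powr P) \<partial>lebesgue)"
        by (simp add: ennreal_mult' nn_integral_cmult)
      also have "\<dots> \<le> ennreal ((2 ^ n) powr P) * ennreal ((C * (1/4) ^ n) powr P)"
        by (intro mult_left_mono nnE) auto
      also have "\<dots> = ennreal ((2 ^ n * (C * (1/4) ^ n)) powr P)"
        by (simp add: ennreal_mult' powr_mult)
      also have "(2 ^ n * (C * (1/4) ^ n)) = C * (1/2) ^ n"
        by (simp add: power_divide field_simps power_mult_distrib[symmetric])
      also have "(C * (1/2) ^ n) powr P = C powr P * ((1/2) ^ n) powr P" by (simp add: powr_mult)
      also have "((1/2::real) ^ n) powr P \<le> (1/2) ^ n"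
        using powr_mono'[of 1 P "(1/2::real) ^ n"] P_gt by (simp add: power_le_one)
      finally show "(\<integral>\<^sup>+x. ennreal ((2 ^ n) powr P * norm (\<phi> n x - \<phi> (Suc n) x) powr P) \<partial>lebesgue)
          \<le> ennreal (C powr P * (1/2) ^ n)"
        by (simp add: ennreal_leI mult_left_mono)
    qed
    also have "\<dots> = ennreal (\<Sum>n. C powr P * (1/2) ^ n)"
      by (intro suminf_ennreal2 summable_mult summable_geometric) auto
    also have "\<dots> < \<infinity>" by simp
    finally have "(\<integral>\<^sup>+x. S x \<partial>lebesgue) \<noteq> \<infinity>" by simp
    moreover have "S \<in> borel_measurable lebesgue" unfolding S_def by measurable
    ultimately have "AE x in lebesgue. S x \<noteq> \<infinity>" by (intro nn_integral_PInf_AE)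
    then show ?thesis
    proof eventually_elim
      case (elim x)
      then obtain B where B: "B \<ge> 0" "S x = ennreal B" by (cases "S x") auto
      have bd: "norm (\<phi> (Suc n) x - \<phi> n x) \<le> B powr (1 / P) * (1/2) ^ n" for n
      proof -
        have "g n \<le> suminf g" for g :: "nat \<Rightarrow> ennreal"
          using sum_le_suminf[of g "{n}"] by (simp add: summableI)
        then have "ennreal ((2 ^ n) powr P * norm (\<phi> n x - \<phi> (Suc n) x) powr P) \<le> ennreal B"
          unfolding B(2)[symmetric] S_def .
        then have "(2 ^ n * norm (\<phi> n x - \<phi> (Suc n) x)) powr P \<le> B"
          using B(1) by (simp only: ennreal_le_iff powr_mult)
        then have "((2 ^ n * norm (\<phi> n x - \<phi> (Suc n) x)) powr P) powr (1 / P) \<le> B powr (1 / P)"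
          using P_gt by (intro powr_mono2) auto
        then have "2 ^ n * norm (\<phi> n x - \<phi> (Suc n) x) \<le> B powr (1 / P)"
          using P_gt by (simp add: powr_powr)
        then show ?thesis by (simp add: abs_minus_commute[of "\<phi> n x"] power_divide field_simps)
      qed
      have "summable (\<lambda>n. \<phi> (Suc n) x - \<phi> n x)"
        by (rule summable_comparison_test'[OF _ bd]) (intro summable_mult summable_geometric, simp)
      then have "(\<lambda>n. \<Sum>i<n. \<phi> (Suc i) x - \<phi> i x) \<longlonglongrightarrow> (\<Sum>n. \<phi> (Suc n) x - \<phi> n x)"
        by (rule summable_LIMSEQ)
      then have "(\<lambda>n. \<phi> n x - \<phi> 0 x) \<longlonglongrightarrow> (\<Sum>n. \<phi> (Suc n) x - \<phi> n x)"
        by (simp only: sum_lessThan_telescope[of "\<lambda>n. \<phi> n x"])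
      from tendsto_add[OF this tendsto_const[of "\<phi> 0 x"]] show ?case
        unfolding convergent_def diff_add_cancel by blast
    qed
  qed
  define v where "v x = lim (\<lambda>n. \<phi> n x)" for x
  have mv[measurable]: "v \<in> borel_measurable lebesgue" unfolding v_def by measurable
  have AEv: "AE x in lebesgue. (\<lambda>n. \<phi> n x) \<longlonglongrightarrow> v x"
    using AEc by eventually_elim (simp add: v_def convergent_LIMSEQ_iff)
  \<comment> \<open>Fatou's lemma in m turns the Cauchy estimate for
    \<open>\<phi> n - \<phi> m\<close> into an estimate for \<open>\<phi> n - v\<close>.\<close>
  have Fat: "(\<integral>\<^sup>+x. ennreal (norm (\<phi> n x - v x) powr P) \<partial>lebesgue) \<le> ennreal ((C * (1/4) ^ n) powr P)" for n
  proof -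
    have "(\<integral>\<^sup>+x. ennreal (norm (\<phi> n x - v x) powr P) \<partial>lebesgue)
      = (\<integral>\<^sup>+x. liminf (\<lambda>m. ennreal (norm (\<phi> n x - \<phi> m x) powr P)) \<partial>lebesgue)"
    proof (rule nn_integral_cong_AE)
      show "AE x in lebesgue. ennreal (norm (\<phi> n x - v x) powr P) = liminf (\<lambda>m. ennreal (norm (\<phi> n x - \<phi> m x) powr P))"
        using AEv
      proof eventually_elim
        case (elim x)
        have "(\<lambda>m. ennreal (norm (\<phi> n x - \<phi> m x) powr P)) \<longlonglongrightarrow> ennreal (norm (\<phi> n x - v x) powr P)"
          using P_gt by (intro tendsto_ennrealI tendsto_powr' tendsto_intros elim) auto
        then show ?case by (intro lim_imp_Liminf[symmetric]) auto
      qed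
    qed
    also have "\<dots> \<le> liminf (\<lambda>m. \<integral>\<^sup>+x. ennreal (norm (\<phi> n x - \<phi> m x) powr P) \<partial>lebesgue)"
      by (rule nn_integral_liminf) measurable
    also have "\<dots> \<le> liminf (\<lambda>m. ennreal ((C * (1/4) ^ n) powr P))"
      by (intro Liminf_mono eventually_sequentiallyI[of n] nnE)
    also have "\<dots> = ennreal ((C * (1/4) ^ n) powr P)" by (simp add: Liminf_const)
    finally show ?thesis .
  qed
  have Lv': "(\<lambda>x. \<phi> n x - v x) \<in> Lp_space P" for n
  proof -
    have "integrable lebesgue (\<lambda>x. norm (\<phi> n x - v x) powr P)"
      using Fat[of n] by (intro integrableI_nonneg) (auto simp: le_less_trans)
    then show ?thesis by (simp add: Lp_space_def)
  qed
  have Lv: "v \<in> Lp_space P"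
    using Lp_space_diff(1)[OF Lt(1)[of 0] Lv'[of 0]] P_gt by simp
  have lim1: "(\<lambda>n. Lp_int P (\<lambda>x. \<phi> n x - v x)) \<longlonglongrightarrow> 0"
  proof (rule Lim_null_comparison, intro always_eventually allI)
    show "norm (Lp_int P (\<lambda>x. \<phi> n x - v x)) \<le> (C * (1/4) ^ n) powr P" for n
      using Fat[of n] Lp_spaceD(2)[OF Lv'] by (subst (asm) nn_integral_eq_integral) (auto simp: ennreal_le_iff)
    have "(\<lambda>n. C * (1/4) ^ n) \<longlonglongrightarrow> 0" by (intro tendsto_mult_right_zero LIMSEQ_power_zero) simp
    from tendsto_zero_powrI[OF this tendsto_const] show "(\<lambda>n. (C * (1/4) ^ n) powr P) \<longlonglongrightarrow> 0"
      using C P_gt by simp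
  qed
  have lim2: "(\<lambda>n. Lp_int p (\<lambda>x. grad (\<phi> n) x - G x)) \<longlonglongrightarrow> 0"
  proof (rule Lim_null_comparison, intro always_eventually allI)
    show "norm (Lp_int p (\<lambda>x. grad (\<phi> n) x - G x)) \<le> ((1/4) ^ n) powr p" for n
      using b[of n] by simp
    have "(\<lambda>n. (1/4::real) ^ n) \<longlonglongrightarrow> 0" by (intro LIMSEQ_power_zero) simp
    from tendsto_zero_powrI[OF this tendsto_const] show "(\<lambda>n. ((1/4::real) ^ n) powr p) \<longlonglongrightarrow> 0"
      using p by simp
  qed
  have pair: "D1p_pair p v G"
    unfolding D1p_pair_def P_def[symmetric] using Lv G t lim1 lim2 by blast
  have hv: "has_weak_gradient v G" by (rule D1p_pair_weak_gradient[OF pair])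
  have "AE x in lebesgue. v x - w x = 0"
  proof (rule eq_0_if_weak_gradient_0[OF _ P_gt(2)])
    show Lvw: "(\<lambda>x. v x - w x) \<in> Lp_space P" using P_gt by (intro Lp_space_diff Lv wP) simp
    fix \<psi> :: "'a \<Rightarrow> real" assume t\<psi>: "test_function \<psi>"
    have i: "integrable lebesgue (\<lambda>x. h x *\<^sub>R grad \<psi> x)" if "h \<in> Lp_space P" for h :: "'a \<Rightarrow> real"
      using Lp_space_loc_int[OF that] P_gt by (intro integrable_loc_int_grad t\<psi>) simp
    have "(\<integral>x. v x *\<^sub>R grad \<psi> x \<partial>lebesgue) = (\<integral>x. w x *\<^sub>R grad \<psi> x \<partial>lebesgue)"
      using hv hw t\<psi> by (simp add: has_weak_gradient_def)
    then show "(\<integral>x. (v x - w x) *\<^sub>R grad \<psi> x \<partial>lebesgue) = 0"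
      using i[OF Lv] i[OF wP] by (simp add: scaleR_diff_left)
  qed
  then have "AE x in lebesgue. v x = w x" by simp
  from D1p_pair_cong_AE[OF pair Lp_spaceD(1)[OF wP] this] show ?thesis by (simp add: G_def)
qed

text \<open>The gradient error splits as F'(\<phi>) (grad \<phi> - G) + (F'(\<phi>) - F'(w)) G. The
  first term is controlled by |F'| \<le> 1; the second tends to 0 by dominated convergence. That
  needs convergence almost everywhere, hence the subsequence r.\<close>

lemma D1p_pair_compose:
  fixes w :: "'a \<Rightarrow> real"
  assumes pair: "D1p_pair p w G"
    and F: "\<And>k. Ck k F" "F 0 = 0" "\<And>y. (F has_real_derivative F' y) (at y)" "\<And>s t. \<bar>F s - F t\<bar> \<le> \<bar>s - t\<bar>"
    and F': "\<And>y. \<bar>F' y\<bar> \<le> 1" "\<And>y. isCont F' y"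
  shows "D1p_pair p (\<lambda>x. F (w x)) (\<lambda>x. F' (w x) *\<^sub>R G x)"
proof -
  obtain \<phi> where w: "w \<in> Lp_space P" and G: "G \<in> Lp_space p" and t: "\<And>n::nat. test_function (\<phi> n)"
    and l1: "(\<lambda>n. Lp_int P (\<lambda>x. \<phi> n x - w x)) \<longlonglongrightarrow> 0"
    and l2: "(\<lambda>n. Lp_int p (\<lambda>x. grad (\<phi> n) x - G x)) \<longlonglongrightarrow> 0"
    by (rule D1p_pairD[OF pair], rule that)
  have Lt: "\<phi> n \<in> Lp_space P" "grad (\<phi> n) \<in> Lp_space p" for n
    using t P_gt p by (auto intro: test_function_Lp_space)
  have Ld: "(\<lambda>x. \<phi> n x - w x) \<in> Lp_space P" for n using P_gt by (intro Lp_space_diff Lt w) auto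
  have "\<exists>r. strict_mono r \<and> (AE x in lebesgue. (\<lambda>n. norm (\<phi> (r n) x - w x) powr P) \<longlonglongrightarrow> 0)"
    by (rule tendsto_L1_AE_subseq[OF Lp_spaceD(2)[OF Ld]]) (use l1 in simp)
  then obtain r :: "nat \<Rightarrow> nat" where r: "strict_mono r"
    and AEr: "AE x in lebesgue. (\<lambda>n. norm (\<phi> (r n) x - w x) powr P) \<longlonglongrightarrow> 0" by blast
  have AEw: "AE x in lebesgue. (\<lambda>n. \<phi> (r n) x) \<longlonglongrightarrow> w x"
    using AEr
  proof eventually_elim
    case (elim x)
    have "(\<lambda>n. (norm (\<phi> (r n) x - w x) powr P) powr (1 / P)) \<longlonglongrightarrow> 0"
      by (rule tendsto_zero_powrI[OF elim tendsto_const]) (use P_gt in auto)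
    then have "(\<lambda>n. norm (\<phi> (r n) x - w x)) \<longlonglongrightarrow> 0" using P_gt by (simp add: powr_powr)
    then show ?case using Lim_null tendsto_norm_zero_cancel by blast
  qed
  have mF: "F \<in> borel_measurable borel" "F' \<in> borel_measurable borel"
    using F(3)[THEN DERIV_isCont] F'(2) by (auto intro!: borel_measurable_continuous_onI simp: continuous_on_eq_continuous_at)
  note m0 = Lp_spaceD(1)[OF w] Lp_spaceD(1)[OF G] Lp_spaceD(1)[OF Lt(1)] Lp_spaceD(1)[OF Lt(2)]
  have m1: "(\<lambda>x. F (w x)) \<in> borel_measurable lebesgue" "(\<lambda>x. F' (w x)) \<in> borel_measurable lebesgue"
     "(\<lambda>x. F (\<phi> n x)) \<in> borel_measurable lebesgue" "(\<lambda>x. F' (\<phi> n x)) \<in> borel_measurable lebesgue" for n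
    using measurable_compose[OF m0(1) mF(1)] measurable_compose[OF m0(1) mF(2)]
      measurable_compose[OF m0(3) mF(1)] measurable_compose[OF m0(3) mF(2)] by auto
  note [measurable] = m0 m1
  have LF: "(\<lambda>x. F (w x)) \<in> Lp_space P"
    by (rule Lp_space_bound[OF w m1(1), of 1]) (use F(4)[of _ 0] F(2) P_gt in auto)
  have b1: "norm (F' y *\<^sub>R g) \<le> 1 * norm g" for y and g :: 'a using F'(1)[of y] by (simp add: mult_left_le_one_le)
  have LG: "(\<lambda>x. F' (w x) *\<^sub>R G x) \<in> Lp_space p"
    by (rule Lp_space_bound[OF G, of _ 1]) (use b1 p in \<open>auto simp del: norm_scaleR\<close>)
  have tF: "test_function (\<lambda>x. F (\<phi> n x))" for n by (rule test_function_compose[OF F(1,2) t])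
  have gF: "grad (\<lambda>x. F (\<phi> n x)) x = F' (\<phi> n x) *\<^sub>R grad (\<phi> n) x" for n x
    by (rule grad_compose[OF F(3) test_function_C1[OF t]])
  have L1: "(\<lambda>n. Lp_int P (\<lambda>x. F (\<phi> (r n) x) - F (w x))) \<longlonglongrightarrow> 0"
  proof (rule Lim_null_comparison[OF _ LIMSEQ_subseq_LIMSEQ[OF l1 r, unfolded comp_def]], intro always_eventually allI)
    fix n
    have "(Lp_int P (\<lambda>x. F (\<phi> (r n) x) - F (w x))) \<le> (Lp_int P (\<lambda>x. \<phi> (r n) x - w x))"
    proof (rule integral_mono)
      have "(\<lambda>x. F (\<phi> (r n) x) - F (w x)) \<in> Lp_space P"
        by (rule Lp_space_bound[OF Ld[of "r n"], of _ 1]) (use F(4) P_gt in auto)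
      then show "integrable lebesgue (\<lambda>x. norm (F (\<phi> (r n) x) - F (w x)) powr P)" by (rule Lp_spaceD)
      show "norm (F (\<phi> (r n) x) - F (w x)) powr P \<le> norm (\<phi> (r n) x - w x) powr P" for x
        using F(4) P_gt by (intro powr_mono2) auto
    qed (rule Lp_spaceD[OF Ld])
    then show "norm (Lp_int P (\<lambda>x. F (\<phi> (r n) x) - F (w x))) \<le> (Lp_int P (\<lambda>x. \<phi> (r n) x - w x))"
      by simp
  qed
  have dom: "(\<lambda>n. Lp_int p (\<lambda>x. (F' (\<phi> (r n) x) - F' (w x)) *\<^sub>R G x)) \<longlonglongrightarrow> (\<integral>x. 0 \<partial>(lebesgue :: 'a measure))"
  proof (rule integral_dominated_convergence)
    show "integrable lebesgue (\<lambda>x. 2 powr p * norm (G x) powr p)"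
      by (intro integrable_mult_right Lp_spaceD G)
    show "AE x in lebesgue. (\<lambda>n. norm ((F' (\<phi> (r n) x) - F' (w x)) *\<^sub>R G x) powr p) \<longlonglongrightarrow> 0"
      using AEw
    proof eventually_elim
      case (elim x)
      have "(\<lambda>n. F' (\<phi> (r n) x)) \<longlonglongrightarrow> F' (w x)" by (rule isCont_tendsto_compose[OF F'(2) elim])
      then have "(\<lambda>n. norm ((F' (\<phi> (r n) x) - F' (w x)) *\<^sub>R G x)) \<longlonglongrightarrow> norm ((F' (w x) - F' (w x)) *\<^sub>R G x)"
        by (intro tendsto_intros)
      then have "(\<lambda>n. norm ((F' (\<phi> (r n) x) - F' (w x)) *\<^sub>R G x)) \<longlonglongrightarrow> 0" by simp
      then show ?case by (rule tendsto_zero_powrI[OF _ tendsto_const]) (use p in auto)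
    qed
    show "AE x in lebesgue. norm (norm ((F' (\<phi> (r n) x) - F' (w x)) *\<^sub>R G x) powr p) \<le> 2 powr p * norm (G x) powr p" for n
    proof (intro AE_I2)
      fix x
      have "\<bar>F' (\<phi> (r n) x) - F' (w x)\<bar> \<le> 2" using F'(1)[of "\<phi> (r n) x"] F'(1)[of "w x"] by linarith
      then have "norm ((F' (\<phi> (r n) x) - F' (w x)) *\<^sub>R G x) powr p \<le> (2 * norm (G x)) powr p"
        using p by (intro powr_mono2) (auto intro: mult_right_mono)
      then show "norm (norm ((F' (\<phi> (r n) x) - F' (w x)) *\<^sub>R G x) powr p) \<le> 2 powr p * norm (G x) powr p"
        by (simp add: powr_mult)
    qed
  qed measurable
  have L2: "(\<lambda>n. Lp_int p (\<lambda>x. grad (\<lambda>x. F (\<phi> (r n) x)) x - F' (w x) *\<^sub>R G x)) \<longlonglongrightarrow> 0"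
  proof (rule Lim_null_comparison, intro always_eventually allI)
    fix n
    have d: "(\<lambda>x. grad (\<phi> (r n)) x - G x) \<in> Lp_space p" using p by (intro Lp_space_diff Lt G) auto
    have A: "(\<lambda>x. F' (\<phi> (r n) x) *\<^sub>R (grad (\<phi> (r n)) x - G x)) \<in> Lp_space p"
      by (rule Lp_space_bound[OF d, of _ 1]) (use b1 p in \<open>auto simp del: norm_scaleR\<close>)
    have b2: "norm ((F' (\<phi> (r n) x) - F' (w x)) *\<^sub>R G x) \<le> 2 * norm (G x)" for x
    proof -
      have "\<bar>F' (\<phi> (r n) x) - F' (w x)\<bar> \<le> 2" using F'(1)[of "\<phi> (r n) x"] F'(1)[of "w x"] by linarith
      then show ?thesis by (auto intro: mult_right_mono)
    qed
    have B: "(\<lambda>x. (F' (\<phi> (r n) x) - F' (w x)) *\<^sub>R G x) \<in> Lp_space p"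
      by (rule Lp_space_bound[OF G, of _ 2]) (use b2 p in \<open>auto simp del: norm_scaleR\<close>)
    have "(Lp_int p (\<lambda>x. grad (\<lambda>x. F (\<phi> (r n) x)) x - F' (w x) *\<^sub>R G x)) =
      (Lp_int p (\<lambda>x. F' (\<phi> (r n) x) *\<^sub>R (grad (\<phi> (r n)) x - G x) + (F' (\<phi> (r n) x) - F' (w x)) *\<^sub>R G x))"
      by (simp add: gF algebra_simps)
    also have "\<dots> \<le> 2 powr p * ((Lp_int p (\<lambda>x. F' (\<phi> (r n) x) *\<^sub>R (grad (\<phi> (r n)) x - G x)))
       + (Lp_int p (\<lambda>x. (F' (\<phi> (r n) x) - F' (w x)) *\<^sub>R G x)))"
      using p by (intro Lp_space_add(2) A B) auto
    also have "\<dots> \<le> 2 powr p * ((Lp_int p (\<lambda>x. grad (\<phi> (r n)) x - G x))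
       + (Lp_int p (\<lambda>x. (F' (\<phi> (r n) x) - F' (w x)) *\<^sub>R G x)))"
      using b1 p by (intro mult_left_mono add_right_mono integral_mono Lp_spaceD A d powr_mono2) (auto simp del: norm_scaleR)
    finally show "norm (Lp_int p (\<lambda>x. grad (\<lambda>x. F (\<phi> (r n) x)) x - F' (w x) *\<^sub>R G x))
      \<le> 2 powr p * ((Lp_int p (\<lambda>x. grad (\<phi> (r n)) x - G x))
       + (Lp_int p (\<lambda>x. (F' (\<phi> (r n) x) - F' (w x)) *\<^sub>R G x)))" by simp
  next
    show "(\<lambda>n. 2 powr p * ((Lp_int p (\<lambda>x. grad (\<phi> (r n)) x - G x))
       + (Lp_int p (\<lambda>x. (F' (\<phi> (r n) x) - F' (w x)) *\<^sub>R G x)))) \<longlonglongrightarrow> 0"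
      using tendsto_mult[OF tendsto_const tendsto_add[OF LIMSEQ_subseq_LIMSEQ[OF l2 r, unfolded comp_def] dom], of "2 powr p"]
      by simp
  qed
  show ?thesis
    unfolding D1p_pair_def P_def[symmetric]
    by (intro conjI LF LG exI[of _ "\<lambda>n x. F (\<phi> (r n) x)"] allI tF L1 L2)
qed

text \<open>Closedness applied to the soft truncations. By k \<ge> 0 the truncation of w is at most
  |w|, which provides both membership in L^P and a dominating function.\<close>

lemma D1p_pair_truncation:
  fixes w :: "'a \<Rightarrow> real"
  assumes pair: "D1p_pair p w G" and k: "k \<ge> 0"
  shows "D1p_pair p (\<lambda>x. max 0 (w x - k)) (\<lambda>x. heaviside (w x - k) *\<^sub>R G x)"
proof (rule D1p_pair_closed)
  have w: "w \<in> Lp_space P" and G: "G \<in> Lp_space p" using pair by (auto simp: D1p_pair_def P_def)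
  note [measurable] = Lp_spaceD(1)[OF w] Lp_spaceD(1)[OF G]
  define F' where "F' n y = sigmoid (real (Suc n) * (y - k))" for n y
  have cF': "isCont (F' n) y" for n y
    unfolding F'_def[abs_def] using isCont_o2[OF _ DERIV_isCont[OF DERIV_sigmoid], of y "\<lambda>y. real (Suc n) * (y - k)"]
    by (auto intro!: continuous_intros)
  have F'b: "0 < F' n y" "F' n y < 1" for n y unfolding F'_def by (rule sigmoid_bounds)+
  show "D1p_pair p (\<lambda>x. soft_trunc k n (w x)) (\<lambda>x. F' n (w x) *\<^sub>R G x)" for n
  proof -
    have D: "(soft_trunc k n has_real_derivative F' n s) (at s)" for s
      unfolding F'_def by (rule DERIV_soft_trunc)
    show ?thesis
      by (rule D1p_pair_compose[OF pair Ck_soft_trunc soft_trunc_0 D abs_soft_trunc_le _ cF'])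
         (use F'b[of n] in \<open>simp add: abs_of_pos less_imp_le\<close>)
  qed
  have [measurable]: "soft_trunc k n \<in> borel_measurable borel" "F' n \<in> borel_measurable borel" for n
    using DERIV_soft_trunc[of k n, THEN DERIV_isCont] cF'
    by (auto intro!: borel_measurable_continuous_onI simp: continuous_on_eq_continuous_at)
  have [measurable]: "heaviside \<in> borel_measurable borel" unfolding heaviside_def[abs_def] by measurable
  have mT: "(\<lambda>x. max 0 (w x - k)) \<in> borel_measurable lebesgue" by measurable
  show wT: "(\<lambda>x. max 0 (w x - k)) \<in> Lp_space P"
    by (rule Lp_space_bound[OF w mT, of 1]) (use k P_gt in auto)
  have mG: "(\<lambda>x. heaviside (w x - k) *\<^sub>R G x) \<in> borel_measurable lebesgue" by measurable
  show "(\<lambda>x. heaviside (w x - k) *\<^sub>R G x) \<in> Lp_space p"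
    by (rule Lp_space_bound[OF G mG, of 1]) (use p in \<open>auto simp: heaviside_def\<close>)
  have "(\<lambda>n. Lp_int P (\<lambda>x. soft_trunc k n (w x) - max 0 (w x - k))) \<longlonglongrightarrow> (\<integral>x. 0 \<partial>(lebesgue :: 'a measure))"
  proof (rule integral_dominated_convergence)
    show "integrable lebesgue (\<lambda>x. 2 powr P * norm (w x) powr P)"
      by (intro integrable_mult_right Lp_spaceD w)
    show "AE x in lebesgue. (\<lambda>n. norm (soft_trunc k n (w x) - max 0 (w x - k)) powr P) \<longlonglongrightarrow> 0"
    proof (intro AE_I2)
      fix x
      have "(\<lambda>n. norm (soft_trunc k n (w x) - max 0 (w x - k))) \<longlonglongrightarrow> 0"
        using soft_trunc_tendsto[OF k] Lim_null tendsto_norm_zero by blast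
      then show "(\<lambda>n. norm (soft_trunc k n (w x) - max 0 (w x - k)) powr P) \<longlonglongrightarrow> 0"
        by (rule tendsto_zero_powrI[OF _ tendsto_const]) (use P_gt in auto)
    qed
    show "AE x in lebesgue. norm (norm (soft_trunc k n (w x) - max 0 (w x - k)) powr P) \<le> 2 powr P * norm (w x) powr P" for n
    proof (intro AE_I2)
      fix x
      have "\<bar>soft_trunc k n (w x)\<bar> \<le> \<bar>w x\<bar>" using abs_soft_trunc_le[of k n "w x" 0] by simp
      then have "norm (soft_trunc k n (w x) - max 0 (w x - k)) powr P \<le> (2 * norm (w x)) powr P"
        using k P_gt by (intro powr_mono2) auto
      then show "norm (norm (soft_trunc k n (w x) - max 0 (w x - k)) powr P) \<le> 2 powr P * norm (w x) powr P"
        by (simp add: powr_mult)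
    qed
  qed measurable
  then show "(\<lambda>n. Lp_int P (\<lambda>x. soft_trunc k n (w x) - max 0 (w x - k))) \<longlonglongrightarrow> 0" by simp
  have "(\<lambda>n. Lp_int p (\<lambda>x. F' n (w x) *\<^sub>R G x - heaviside (w x - k) *\<^sub>R G x)) \<longlonglongrightarrow> (\<integral>x. 0 \<partial>(lebesgue :: 'a measure))"
  proof (rule integral_dominated_convergence)
    show "integrable lebesgue (\<lambda>x. norm (G x) powr p)" by (intro Lp_spaceD G)
    show "AE x in lebesgue. (\<lambda>n. norm (F' n (w x) *\<^sub>R G x - heaviside (w x - k) *\<^sub>R G x) powr p) \<longlonglongrightarrow> 0"
    proof (intro AE_I2)
      fix x
      have "(\<lambda>n. norm (F' n (w x) *\<^sub>R G x - heaviside (w x - k) *\<^sub>R G x)) \<longlonglongrightarrow> norm (heaviside (w x - k) *\<^sub>R G x - heaviside (w x - k) *\<^sub>R G x)"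
        unfolding F'_def by (intro tendsto_intros sigmoid_tendsto)
      then have "(\<lambda>n. norm (F' n (w x) *\<^sub>R G x - heaviside (w x - k) *\<^sub>R G x)) \<longlonglongrightarrow> 0" by simp
      then show "(\<lambda>n. norm (F' n (w x) *\<^sub>R G x - heaviside (w x - k) *\<^sub>R G x) powr p) \<longlonglongrightarrow> 0"
        by (rule tendsto_zero_powrI[OF _ tendsto_const]) (use p in auto)
    qed
    show "AE x in lebesgue. norm (norm (F' n (w x) *\<^sub>R G x - heaviside (w x - k) *\<^sub>R G x) powr p) \<le> norm (G x) powr p" for n
    proof (intro AE_I2)
      fix x
      have "\<bar>F' n (w x) - heaviside (w x - k)\<bar> \<le> 1" using F'b[of n "w x"] by (auto simp: heaviside_def)
      then have "norm ((F' n (w x) - heaviside (w x - k)) *\<^sub>R G x) \<le> norm (G x)" by (simp add: mult_left_le_one_le)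
      then show "norm (norm (F' n (w x) *\<^sub>R G x - heaviside (w x - k) *\<^sub>R G x) powr p) \<le> norm (G x) powr p"
        using p by (auto simp: scaleR_diff_left[symmetric] simp del: norm_scaleR intro!: powr_mono2)
    qed
  qed measurable
  then show "(\<lambda>n. Lp_int p (\<lambda>x. F' n (w x) *\<^sub>R G x - heaviside (w x - k) *\<^sub>R G x)) \<longlonglongrightarrow> 0" by simp
qed

end

section \<open>Level sets\<close>

lemma integral_Holder4:
  fixes f1 f2 f3 f4 :: "'m \<Rightarrow> real"
  assumes "0 < c1" "0 < c2" "0 < c3" "0 < c4" "c1 + c2 + c3 + c4 = 1"
    and "integrable M f1" "integrable M f2" "integrable M f3" "integrable M f4"
    and "\<And>x. f1 x \<ge> 0" "\<And>x. f2 x \<ge> 0" "\<And>x. f3 x \<ge> 0" "\<And>x. f4 x \<ge> 0"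
  shows "integrable M (\<lambda>x. f1 x powr c1 * f2 x powr c2 * f3 x powr c3 * f4 x powr c4)"
    and "(\<integral>x. f1 x powr c1 * f2 x powr c2 * f3 x powr c3 * f4 x powr c4 \<partial>M)
      \<le> (\<integral>x. f1 x \<partial>M) powr c1 * (\<integral>x. f2 x \<partial>M) powr c2 * (\<integral>x. f3 x \<partial>M) powr c3 * (\<integral>x. f4 x \<partial>M) powr c4"
proof -
  let ?f = "\<lambda>i::nat. if i = 0 then f1 else if i = 1 then f2 else if i = 2 then f3 else f4"
  let ?c = "\<lambda>i::nat. if i = 0 then c1 else if i = 1 then c2 else if i = 2 then c3 else c4"
  have c: "\<And>i. i \<in> {0,1,2,3} \<Longrightarrow> ?c i > 0" "(\<Sum>i\<in>{0,1,2,3}. ?c i) = 1"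
    "\<And>i. i \<in> {0,1,2,3} \<Longrightarrow> integrable M (?f i)" "\<And>i x. i \<in> {0,1,2,3} \<Longrightarrow> ?f i x \<ge> 0"
    using assms by auto
  show "integrable M (\<lambda>x. f1 x powr c1 * f2 x powr c2 * f3 x powr c3 * f4 x powr c4)"
    using integral_Holder(1)[where I="{0,1,2,3}" and f="?f" and a="?c", OF _ c] by (simp add: mult.assoc)
  show "(\<integral>x. f1 x powr c1 * f2 x powr c2 * f3 x powr c3 * f4 x powr c4 \<partial>M)
      \<le> (\<integral>x. f1 x \<partial>M) powr c1 * (\<integral>x. f2 x \<partial>M) powr c2 * (\<integral>x. f3 x \<partial>M) powr c3 * (\<integral>x. f4 x \<partial>M) powr c4"
    using integral_Holder(2)[where I="{0,1,2,3}" and f="?f" and a="?c", OF _ c] by (simp add: mult.assoc)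
qed

text \<open>After Hoelder's inequality the truncation inequality bounds a norm X by a root of
  something linear in X. Dividing by X leaves a bound with exponent p - 1.\<close>

lemma absorb_root:
  fixes X c K p :: real
  assumes "p > 1" "X \<ge> 0" "c \<ge> 0" "K \<ge> 0" "X \<le> K * (c * X) powr (1 / p)"
  shows "X powr (p - 1) \<le> K powr p * c"
proof (cases "X = 0")
  case False
  then have X: "X > 0" using assms by simp
  have "X powr p \<le> (K * (c * X) powr (1 / p)) powr p" using assms by (intro powr_mono2) auto
  also have "\<dots> = K powr p * (c * X)" using assms by (simp add: powr_mult powr_powr)
  finally have "X powr p / X \<le> K powr p * c" using X by (simp add: field_simps)
  then show ?thesis using X by (simp add: powr_diff)
qed (use assms in simp)

text \<open>Substituting the second inequality into the first gives M \<le> c M^\<theta> for M = max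
  1 X and \<theta> = \<alpha> \<beta> / (s t). As \<theta> < 1, this bounds M.\<close>

lemma crossed_powers_bounded:
  fixes C D s t \<alpha> \<beta> :: real
  assumes "C \<ge> 0" "D \<ge> 0" "s > 0" "t > 0" "\<alpha> > 0" "\<beta> > 0" "\<alpha> * \<beta> < s * t"
  obtains R where "R > 0" "\<And>X Y. X \<ge> 0 \<Longrightarrow> Y \<ge> 0 \<Longrightarrow> X powr s \<le> C * (1 + Y powr \<beta>) \<Longrightarrow>
     Y powr t \<le> D * (1 + X powr \<alpha>) \<Longrightarrow> X \<le> R \<and> Y \<le> R"
proof -
  \<comment> \<open>The factor 2 absorbs the summand 1 in \<open>1 + Y powr \<beta>\<close>, and E
    \<ge> 1 keeps all bases at least 1.\<close>
  define E where "E = 2 * max C D + 1"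
  have E: "E \<ge> 1" "2 * C \<le> E" "2 * D \<le> E" using assms by (auto simp: E_def)
  define c where "c = E powr (1 / s) * E powr (\<beta> / (s * t))"
  define \<theta> where "\<theta> = \<alpha> * \<beta> / (s * t)"
  have \<theta>: "0 < \<theta>" "\<theta> < 1" using assms by (auto simp: \<theta>_def field_simps)
  have c: "c \<ge> 1" unfolding c_def using E assms by (intro mult_ge1_I ge_one_powr_ge_zero) auto
  \<comment> \<open>The positive solution of M = c M^\<theta>.\<close>
  define R1 where "R1 = c powr (1 / (1 - \<theta>))"
  have R1: "R1 \<ge> 1" unfolding R1_def using c \<theta> by (intro ge_one_powr_ge_zero) auto
  define R where "R = R1 + (E * R1 powr \<alpha>) powr (1 / t)"
  have step: "Z \<le> (E * M powr \<gamma>) powr (1 / e)"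
    if "Z \<ge> 0" "M \<ge> 1" "0 < e" "0 < \<gamma>" "W \<ge> 0" "W \<le> M" "Z powr e \<le> G * (1 + W powr \<gamma>)" "2 * G \<le> E" "G \<ge> 0"
    for Z M e \<gamma> W G :: real
  proof -
    have "W powr \<gamma> \<le> M powr \<gamma>" "1 \<le> M powr \<gamma>"
      using that by (auto intro: powr_mono2 ge_one_powr_ge_zero)
    then have "G * (1 + W powr \<gamma>) \<le> G * (2 * M powr \<gamma>)" using that by (intro mult_left_mono) auto
    also have "\<dots> \<le> E * M powr \<gamma>" using that by (simp add: mult_right_mono)
    finally have "Z powr e \<le> E * M powr \<gamma>" using that by simp
    then have "(Z powr e) powr (1 / e) \<le> (E * M powr \<gamma>) powr (1 / e)" using that by (intro powr_mono2) auto
    then show ?thesis using that by (simp add: powr_powr)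
  qed
  show ?thesis
  proof (rule that[of R])
    show "R > 0" using R1 by (simp add: R_def add_pos_nonneg)
    fix X Y :: real
    assume XY: "X \<ge> 0" "Y \<ge> 0" "X powr s \<le> C * (1 + Y powr \<beta>)" "Y powr t \<le> D * (1 + X powr \<alpha>)"
    define M where "M = max 1 X"
    define M' where "M' = (E * M powr \<alpha>) powr (1 / t)"
    have M: "M \<ge> 1" "X \<le> M" by (auto simp: M_def)
    have M'1: "M' \<ge> 1" unfolding M'_def using E M assms
      by (intro ge_one_powr_ge_zero mult_ge1_I) auto
    have Y: "Y \<le> M'" unfolding M'_def by (rule step[OF XY(2) M(1) _ _ XY(1) M(2) XY(4)]) (use assms E in auto)
    have "X \<le> (E * M' powr \<beta>) powr (1 / s)"
      by (rule step[OF XY(1) M'1 _ _ XY(2) Y XY(3)]) (use assms E in auto)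
    also have "\<dots> = c * M powr \<theta>"
      using E M by (simp add: M'_def c_def \<theta>_def powr_mult powr_powr mult.assoc) (simp add: field_simps)
    finally have "M \<le> c * M powr \<theta>"
      unfolding M_def using c R1 \<theta> mult_ge1_I[OF c ge_one_powr_ge_zero[of M \<theta>]] M by (auto simp: M_def max_def)
    then have "M powr 1 / M powr \<theta> \<le> c" using M by (simp add: field_simps)
    then have "M powr (1 - \<theta>) \<le> c" by (simp only: powr_diff)
    then have "(M powr (1 - \<theta>)) powr (1 / (1 - \<theta>)) \<le> R1"
      unfolding R1_def using \<theta> by (intro powr_mono2) auto
    then have MR: "M \<le> R1" using M \<theta> by (simp add: powr_powr)
    have "M powr \<alpha> \<le> R1 powr \<alpha>" using MR M assms by (intro powr_mono2) auto
    then have "E * M powr \<alpha> \<le> E * R1 powr \<alpha>" using E by (intro mult_left_mono) auto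
    then have "M' \<le> (E * R1 powr \<alpha>) powr (1 / t)"
      unfolding M'_def using E assms by (intro powr_mono2) auto
    with Y have "Y \<le> (E * R1 powr \<alpha>) powr (1 / t)" by simp
    moreover have "0 \<le> (E * R1 powr \<alpha>) powr (1 / t)" by simp
    ultimately show "X \<le> R \<and> Y \<le> R" using M MR R1 unfolding R_def by linarith
  qed
qed

text \<open>Levels approach 1 + d with gaps that halve, so each step loses a factor
  \<open>2 powr P\<close> more than the one before. Since \<delta> > 1, geometric decay of A along
  the levels compensates this loss. R depends on \<Lambda>, \<delta>, P and C but not on A.\<close>

lemma Stampacchia_levels:
  fixes \<delta> P C \<Lambda> :: real
  assumes "\<delta> > 1" "P > 0" "C \<ge> 0" "\<Lambda> > 0"
  obtains R where "R \<ge> 1" "\<And>A :: real \<Rightarrow> real. (\<And>k. A k \<ge> 0) \<Longrightarrow> (\<And>k h. 1 \<le> k \<Longrightarrow> k \<le> h \<Longrightarrow> A h \<le> A k) \<Longrightarrow> A 1 \<le> \<Lambda> \<Longrightarrow>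
     (\<And>k h. 1 \<le> k \<Longrightarrow> k < h \<Longrightarrow> A h \<le> C * (h - k) powr (- P) * A k powr \<delta>) \<Longrightarrow> A R = 0"
proof -
  \<comment> \<open>Chosen with \<rho>^(\<delta> - 1) = 2^(-P), which cancels the growth caused by
    the shrinking gaps.\<close>
  define \<rho> where "\<rho> = (1/2::real) powr (P / (\<delta> - 1))"
  have \<rho>: "0 < \<rho>" "\<rho> < 1" using assms powr_less_mono'[of "1/2::real" 0 "P / (\<delta> - 1)"] by (auto simp: \<rho>_def)
  \<comment> \<open>Chosen so that one step contributes the factor C/(C + 1) times \<rho>, which is
    at most \<rho>; C + 1 keeps d positive when C = 0.\<close>
  define d where "d = ((C + 1) * 2 powr P * \<Lambda> powr (\<delta> - 1) / \<rho>) powr (1 / P)"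
  have base: "(C + 1) * 2 powr P * \<Lambda> powr (\<delta> - 1) / \<rho> > 0" using assms \<rho> by simp
  have d: "d > 0"
    unfolding d_def powr_gt_zero using base by (rule less_imp_neq[THEN not_sym])
  have "(y powr (1 / P)) powr P = y" if "y > 0" for y :: real
    using that assms by (simp add: powr_powr)
  from this[OF base] have dP: "d powr P = (C + 1) * 2 powr P * \<Lambda> powr (\<delta> - 1) / \<rho>"
    by (simp only: d_def)
  show ?thesis
  proof (rule that[of "1 + d"])
    show "1 + d \<ge> 1" using d by simp
    fix A :: "real \<Rightarrow> real"
    assume A: "\<And>k. A k \<ge> 0" "\<And>k h. 1 \<le> k \<Longrightarrow> k \<le> h \<Longrightarrow> A h \<le> A k" "A 1 \<le> \<Lambda>"
      and lev: "\<And>k h. 1 \<le> k \<Longrightarrow> k < h \<Longrightarrow> A h \<le> C * (h - k) powr (- P) * A k powr \<delta>"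
    define k where "k j = 1 + d * (1 - (1/2) ^ j)" for j :: nat
    have kk: "1 \<le> k j" "k j < k (Suc j)" "k (Suc j) - k j = d * (1/2) ^ Suc j" "k j \<le> 1 + d" for j
      using d by (auto simp: k_def field_simps power_le_one)
    have bound: "A (k j) \<le> \<Lambda> * \<rho> ^ j" for j
    proof (induction j)
      case 0 then show ?case using A(3) by (simp add: k_def)
    next
      case (Suc j)
      have "A (k (Suc j)) \<le> C * (d * (1/2) ^ Suc j) powr (- P) * A (k j) powr \<delta>"
        using lev[OF kk(1,2)[of j]] by (simp only: kk(3))
      also have "\<dots> \<le> C * (d * (1/2) ^ Suc j) powr (- P) * (\<Lambda> * \<rho> ^ j) powr \<delta>"
        using Suc A(1) assms by (intro mult_left_mono powr_mono2) auto
      also have "(d * (1/2) ^ Suc j) powr (- P) = (1 / d powr P) * 2 powr P * ((1/2) ^ j) powr (- P)"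
        using d by (simp add: powr_mult powr_minus_divide powr_divide)
      also have "((1/2::real) ^ j) powr (- P) = (1 / (\<rho> ^ j) powr (\<delta> - 1))"
      proof -
        have "(\<rho> ^ j) powr (\<delta> - 1) = \<rho> powr (real j * (\<delta> - 1))"
          using \<rho> by (simp add: powr_realpow[symmetric] powr_powr)
        also have "\<dots> = (1/2) powr (P / (\<delta> - 1) * (real j * (\<delta> - 1)))"
          by (simp only: \<rho>_def powr_powr)
        also have "P / (\<delta> - 1) * (real j * (\<delta> - 1)) = P * real j" using assms by simp
        also have "(1/2) powr (P * real j) = ((1/2::real) ^ j) powr P"
          by (simp add: powr_realpow[symmetric] powr_powr mult.commute)
        finally show ?thesis by (simp add: powr_minus_divide)
      qed
      also have "(\<Lambda> * \<rho> ^ j) powr \<delta> = \<Lambda> * \<rho> ^ j * (\<Lambda> powr (\<delta> - 1) * (\<rho> ^ j) powr (\<delta> - 1))"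
        using assms \<rho> powr_add[of "\<Lambda> * \<rho> ^ j" 1 "\<delta> - 1"] by (simp add: powr_mult)
      also have "C * (1 / d powr P * 2 powr P * (1 / (\<rho> ^ j) powr (\<delta> - 1))) * (\<Lambda> * \<rho> ^ j * (\<Lambda> powr (\<delta> - 1) * (\<rho> ^ j) powr (\<delta> - 1)))
         = (C * 2 powr P * \<Lambda> powr (\<delta> - 1) / d powr P) * (\<Lambda> * \<rho> ^ j)"
        using \<rho> by simp
      also have "C * 2 powr P * \<Lambda> powr (\<delta> - 1) / d powr P = C / (C + 1) * \<rho>"
        using assms by (simp add: dP)
      also have "C / (C + 1) * \<rho> \<le> 1 * \<rho>" using assms \<rho> by (intro mult_right_mono) auto
      then have "(C / (C + 1) * \<rho>) * (\<Lambda> * \<rho> ^ j) \<le> (1 * \<rho>) * (\<Lambda> * \<rho> ^ j)"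
        using assms \<rho> by (intro mult_right_mono) auto
      finally show ?case by (simp add: ac_simps)
    qed
    have "A (1 + d) \<le> 0"
    proof (rule LIMSEQ_le_const)
      have "(\<lambda>j. \<Lambda> * \<rho> ^ j) \<longlonglongrightarrow> \<Lambda> * 0" using \<rho> by (intro tendsto_mult tendsto_const LIMSEQ_power_zero) simp
      then show "(\<lambda>j. \<Lambda> * \<rho> ^ j) \<longlonglongrightarrow> 0" by simp
      show "\<exists>N. \<forall>j\<ge>N. A (1 + d) \<le> \<Lambda> * \<rho> ^ j" using bound A(2)[OF kk(1) kk(4)] order.trans by blast
    qed
    then show "A (1 + d) = 0" using A(1)[of "1 + d"] by simp
  qed
qed

text \<open>\<open>measure\<close> is 0 on sets of infinite measure, so finiteness of the level sets
  is shown separately wherever levels are compared.\<close>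

definition level :: "'m measure \<Rightarrow> ('m \<Rightarrow> real) \<Rightarrow> real \<Rightarrow> real" where
  "level M u k = measure M {x \<in> space M. u x > k}"

text \<open>Restricted to u > 1 because uniform control is available only for the truncated
  function; the integral over small values of u is finite for each solution but has no common
  bound.\<close>

definition moment_le :: "'m measure \<Rightarrow> real \<Rightarrow> real \<Rightarrow> ('m \<Rightarrow> real) \<Rightarrow> bool" where
  "moment_le M r B u \<longleftrightarrow> integrable M (\<lambda>x. indicator {x. u x > 1} x * \<bar>u x\<bar> powr r) \<and>
     (\<integral>x. indicator {x. u x > 1} x * \<bar>u x\<bar> powr r \<partial>M) \<le> B"

lemma measurable_moment:
  fixes u :: "'m \<Rightarrow> real"
  assumes [measurable]: "u \<in> borel_measurable M"
  shows "(\<lambda>x. indicator {x. u x > 1} x * \<bar>u x\<bar> powr r) \<in> borel_measurable M"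
proof -
  have "(\<lambda>x. if u x > 1 then \<bar>u x\<bar> powr r else 0) \<in> borel_measurable M" by measurable
  moreover have "(\<lambda>x. if u x > 1 then \<bar>u x\<bar> powr r else 0) = (\<lambda>x. indicator {x. u x > 1} x * \<bar>u x\<bar> powr r)"
    by (auto simp: indicator_def)
  ultimately show ?thesis by simp
qed

text \<open>On dyadic levels the linear inequality reads |{u > 2^(j+1)}| \<le> C 2^(-jP) |{u >
  2^j}|. The ratio tends to 0, so the decay beats the weight 2^(jr) for every r, and the ratio test
  applies.\<close>

lemma dyadic_levels_moment:
  fixes P C \<Lambda> r :: real
  assumes "P > 0" "C > 0" "\<Lambda> > 0" "r > 0"
  obtains B where "B \<ge> 0"
    "\<And>(M :: 'm measure) u. u \<in> borel_measurable M \<Longrightarrow> (\<And>k. k \<ge> 1 \<Longrightarrow> emeasure M {x \<in> space M. u x > k} < \<infinity>) \<Longrightarrow>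
       level M u 1 \<le> \<Lambda> \<Longrightarrow> (\<And>k h. 1 \<le> k \<Longrightarrow> k < h \<Longrightarrow> level M u h \<le> C * (h - k) powr (- P) * level M u k) \<Longrightarrow>
       moment_le M r B u"
proof -
  \<comment> \<open>Bounds the levels at 2^j by a sequence that knows neither the measure nor u, so
    that B is uniform.\<close>
  define s where "s = rec_nat \<Lambda> (\<lambda>j y. C * (2 ^ j) powr (- P) * y)"
  have s0: "s 0 = \<Lambda>" and sS: "s (Suc j) = C * (2 ^ j) powr (- P) * s j" for j by (auto simp: s_def)
  have spos: "s j > 0" for j by (induction j) (use assms in \<open>auto simp: s0 sS\<close>)
  \<comment> \<open>Bounds the contribution of the shell where u lies between 2^j and
    2^(j+1).\<close>
  define b where "b j = (2 ^ Suc j) powr r * s j" for j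
  have bpos: "b j > 0" for j using spos by (simp add: b_def)
  have bS: "b (Suc j) = (2 powr r * C * (2 ^ j) powr (- P)) * b j" for j
  proof -
    have "(2 * 2 ^ Suc j :: real) powr r = 2 powr r * (2 ^ Suc j) powr r" by (rule powr_mult)
    then show ?thesis by (simp add: b_def sS)
  qed
  have "summable b"
  proof -
    have "(\<lambda>j. 2 powr r * C * (2 ^ j) powr (- P)) \<longlonglongrightarrow> 2 powr r * C * 0"
    proof (intro tendsto_mult tendsto_const)
      have "(\<lambda>j. ((2::real) powr (- P)) ^ j) \<longlonglongrightarrow> 0"
        using assms powr_less_mono[of "- P" 0 2] by (intro LIMSEQ_power_zero) simp
      moreover have "((2::real) powr (- P)) ^ j = (2 ^ j) powr (- P)" for j
        by (simp add: powr_realpow[symmetric] powr_powr mult.commute)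
      ultimately show "(\<lambda>j. (2 ^ j) powr (- P)) \<longlonglongrightarrow> (0::real)" by simp
    qed
    then have "\<forall>\<^sub>F j in sequentially. 2 powr r * C * (2 ^ j) powr (- P) < 1/2"
      by (intro order_tendstoD(2)) auto
    then obtain N where N: "\<And>j. j \<ge> N \<Longrightarrow> 2 powr r * C * (2 ^ j) powr (- P) < 1/2"
      by (auto simp: eventually_sequentially)
    show ?thesis
    proof (rule summable_ratio_test[of "1/2" N])
      show "norm (b (Suc j)) \<le> 1/2 * norm (b j)" if "j \<ge> N" for j
        using N[OF that] bpos[of j] bpos[of "Suc j"] unfolding bS[of j] by simp
    qed simp
  qed
  define B where "B = (\<Sum>j. b j)"
  have B: "B \<ge> 0" unfolding B_def using \<open>summable b\<close> bpos by (intro suminf_nonneg) (auto simp: less_imp_le)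
  show ?thesis
  proof (rule that[of B])
    fix M :: "'m measure" and u :: "'m \<Rightarrow> real"
    assume u[measurable]: "u \<in> borel_measurable M" and fin: "\<And>k. k \<ge> 1 \<Longrightarrow> emeasure M {x \<in> space M. u x > k} < \<infinity>"
      and \<Lambda>: "level M u 1 \<le> \<Lambda>"
      and lev: "\<And>k h. 1 \<le> k \<Longrightarrow> k < h \<Longrightarrow> level M u h \<le> C * (h - k) powr (- P) * level M u k"
    define A where "A k = {x \<in> space M. u x > k}" for k
    have [measurable]: "A k \<in> sets M" for k unfolding A_def by measurable
    have As: "measure M (A (2 ^ j)) \<le> s j" for j
    proof (induction j)
      case 0 then show ?case using \<Lambda> by (simp add: s0 A_def level_def)
    next
      case (Suc j)
      have "measure M (A (2 ^ Suc j)) \<le> C * (2 ^ Suc j - 2 ^ j) powr (- P) * measure M (A (2 ^ j))"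
        unfolding A_def level_def[symmetric] by (rule lev) auto
      also have "\<dots> \<le> C * (2 ^ j) powr (- P) * s j"
        using Suc assms by (auto intro!: mult_left_mono)
      finally show ?case by (simp add: sS)
    qed
    have "(\<integral>\<^sup>+x. ennreal (indicator {x. u x > 1} x * \<bar>u x\<bar> powr r) \<partial>M)
      \<le> (\<integral>\<^sup>+x. (\<Sum>j. ennreal ((2 ^ Suc j) powr r) * indicator (A (2 ^ j)) x) \<partial>M)"
    proof (rule nn_integral_mono)
      fix x assume x: "x \<in> space M"
      show "ennreal (indicator {x. u x > 1} x * \<bar>u x\<bar> powr r) \<le> (\<Sum>j. ennreal ((2 ^ Suc j) powr r) * indicator (A (2 ^ j)) x)"
      proof (cases "u x > 1")
        case True
        obtain n where "u x < 2 ^ n" using real_arch_pow[of 2 "u x"] by auto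
        \<comment> \<open>The index of the dyadic shell that contains \<open>u x\<close>.\<close>
        define j where "j = (LEAST j. u x \<le> 2 ^ Suc j)"
        have "(2::real) ^ n \<le> 2 ^ Suc n" by simp
        then have ex: "u x \<le> 2 ^ Suc n" using \<open>u x < 2 ^ n\<close> by linarith
        have j: "u x \<le> 2 ^ Suc j" unfolding j_def by (rule LeastI[of "\<lambda>j. u x \<le> 2 ^ Suc j", OF ex])
        have j': "2 ^ j < u x"
        proof (cases j)
          case (Suc i)
          then have "\<not> u x \<le> 2 ^ Suc i" using not_less_Least[of i "\<lambda>j. u x \<le> 2 ^ Suc j"] unfolding j_def by simp
          then show ?thesis using Suc by simp
        qed (use True in simp)
        define g where "g = (\<lambda>j. ennreal ((2 ^ Suc j) powr r) * indicator (A (2 ^ j)) x)"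
        have "ennreal (indicator {x. u x > 1} x * \<bar>u x\<bar> powr r) \<le> g j"
          using True j j' x assms by (auto simp: g_def A_def intro!: ennreal_leI powr_mono2)
        also have "g j \<le> suminf g" using sum_le_suminf[of g "{j}"] by (simp add: summableI)
        finally show ?thesis by (simp only: g_def)
      qed simp
    qed
    also have "\<dots> = (\<Sum>j. \<integral>\<^sup>+x. ennreal ((2 ^ Suc j) powr r) * indicator (A (2 ^ j)) x \<partial>M)"
      by (rule nn_integral_suminf) measurable
    also have "\<dots> \<le> (\<Sum>j. ennreal (b j))"
    proof (intro suminf_le summableI)
      fix j
      have e: "emeasure M (A (2 ^ j)) = ennreal (measure M (A (2 ^ j)))"
        using fin[of "2 ^ j"] by (intro emeasure_eq_ennreal_measure) (auto simp: A_def)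
      have "(\<integral>\<^sup>+x. ennreal ((2 ^ Suc j) powr r) * indicator (A (2 ^ j)) x \<partial>M) = ennreal ((2 ^ Suc j) powr r * measure M (A (2 ^ j)))"
        by (simp add: nn_integral_cmult_indicator e ennreal_mult' del: power_Suc)
      also have "\<dots> \<le> ennreal (b j)"
        unfolding b_def using As[of j] by (intro ennreal_leI mult_left_mono) auto
      finally show "(\<integral>\<^sup>+x. ennreal ((2 ^ Suc j) powr r) * indicator (A (2 ^ j)) x \<partial>M) \<le> ennreal (b j)" .
    qed
    also have "\<dots> = ennreal B"
      unfolding B_def using \<open>summable b\<close> bpos by (intro suminf_ennreal2) (auto simp: less_imp_le)
    finally have le: "(\<integral>\<^sup>+x. ennreal (indicator {x. u x > 1} x * \<bar>u x\<bar> powr r) \<partial>M) \<le> ennreal B" .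
    have i: "integrable M (\<lambda>x. indicator {x. u x > 1} x * \<bar>u x\<bar> powr r)"
      using le by (intro integrableI_nonneg measurable_moment u) (auto simp: le_less_trans)
    have "(\<integral>x. indicator {x. u x > 1} x * \<bar>u x\<bar> powr r \<partial>M) \<le> B"
      using le B by (subst (asm) nn_integral_eq_integral[OF i]) (auto simp: ennreal_le_iff)
    with i show "moment_le M r B u" by (simp add: moment_le_def)
  qed (rule B)
qed

section \<open>Consequences of the truncation inequality\<close>

text \<open>All that is retained of one equation. Integrability stands as a premise because a
  Bochner integral that does not exist is 0, which would falsify the inequality; it is verified by
  Hoelder's inequality at each use.\<close>

definition truncation_energy ::
  "'m measure \<Rightarrow> real \<Rightarrow> real \<Rightarrow> real \<Rightarrow> ('m \<Rightarrow> real) \<Rightarrow> real \<Rightarrow> ('m \<Rightarrow> real) \<Rightarrow> ('m \<Rightarrow> real) \<Rightarrow> bool" where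
  "truncation_energy M p P K a \<beta> u v \<longleftrightarrow>
     u \<in> borel_measurable M \<and> v \<in> borel_measurable M \<and> integrable M (\<lambda>x. \<bar>u x\<bar> powr P) \<and> (AE x in M. v x > 0) \<and>
     (\<forall>k\<ge>1/2. integrable M (\<lambda>x. a x * (1 + v x powr \<beta>) * max 0 (u x - k)) \<longrightarrow>
       (\<integral>x. max 0 (u x - k) powr P \<partial>M) powr (1 / P)
         \<le> K * (\<integral>x. a x * (1 + v x powr \<beta>) * max 0 (u x - k) \<partial>M) powr (1 / p))"

lemma truncation_energyD:
  assumes "truncation_energy M p P K a \<beta> u v"
  shows "u \<in> borel_measurable M" "v \<in> borel_measurable M" "integrable M (\<lambda>x. \<bar>u x\<bar> powr P)" "AE x in M. v x > 0"
    and "k \<ge> 1/2 \<Longrightarrow> integrable M (\<lambda>x. a x * (1 + v x powr \<beta>) * max 0 (u x - k)) \<Longrightarrow>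
      (\<integral>x. max 0 (u x - k) powr P \<partial>M) powr (1 / P)
        \<le> K * (\<integral>x. a x * (1 + v x powr \<beta>) * max 0 (u x - k) \<partial>M) powr (1 / p)"
  using assms by (simp_all add: truncation_energy_def)

text \<open>Hoelder's inequality with four factors: the weight enters through its \<open>L\<^sup>1\<close> norm and its
  \<open>L\<^sup>\<zeta>\<close> norm, which interpolates between the two spaces.\<close>

lemma weighted_Holder_bound:
  fixes a U V :: "'m \<Rightarrow> real"
  assumes a: "integrable M a" "integrable M (\<lambda>x. a x powr \<zeta>)" "\<And>x. a x \<ge> 0"
    and exps: "\<zeta> > 1" "P > 0" "Q > 0" "\<beta> > 0" "1 / \<zeta> < 1 - 1 / P - \<beta> / Q"
    and U: "integrable M (\<lambda>x. U x powr P)" "\<And>x. U x \<ge> 0"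
    and V: "integrable M (\<lambda>x. V x powr Q)" "\<And>x. V x \<ge> 0"
  defines "s \<equiv> 1 - 1 / P - \<beta> / Q"
  shows "integrable M (\<lambda>x. a x * V x powr \<beta> * U x)"
    and "(\<integral>x. a x * V x powr \<beta> * U x \<partial>M) \<le> (\<integral>x. a x \<partial>M) powr ((s * \<zeta> - 1) / (\<zeta> - 1)) *
      (\<integral>x. a x powr \<zeta> \<partial>M) powr ((1 - s) / (\<zeta> - 1)) * (\<integral>x. V x powr Q \<partial>M) powr (\<beta> / Q) * (\<integral>x. U x powr P \<partial>M) powr (1 / P)"
proof -
  \<comment> \<open>The solution of c1 + c2 = s and c1 + \<zeta> c2 = 1: the weights must sum to 1
    together with those of U and V, and the two powers of a must multiply to a itself.\<close>
  define c1 c2 where "c1 = (s * \<zeta> - 1) / (\<zeta> - 1)" and "c2 = (1 - s) / (\<zeta> - 1)"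
  have "1 / P + \<beta> / Q > 0" using exps by (simp add: add_pos_pos)
  then have s: "1 / \<zeta> < s" "s < 1" using exps(5) by (auto simp: s_def)
  have c: "c1 > 0" "c2 > 0" using s exps(1) by (auto simp: c1_def c2_def field_simps)
  have c12: "c1 + c2 = s" "c1 + \<zeta> * c2 = 1"
    using exps(1) unfolding c1_def c2_def by (simp_all add: add_divide_distrib[symmetric] diff_divide_distrib[symmetric] algebra_simps divide_eq_eq)
  have sum1: "c1 + c2 + \<beta> / Q + 1 / P = 1" using c12 by (simp add: s_def)
  have eq: "a x powr c1 * (a x powr \<zeta>) powr c2 * (V x powr Q) powr (\<beta> / Q) * (U x powr P) powr (1 / P) = a x * V x powr \<beta> * U x" for x
    using exps a(3)[of x] U(2)[of x] c12(2) by (simp add: powr_powr powr_add[symmetric])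
  note H = integral_Holder4[OF c(1,2) _ _ sum1 a(1,2) V(1) U(1)]
  show "integrable M (\<lambda>x. a x * V x powr \<beta> * U x)"
    using H(1) exps a(3) by (simp add: eq)
  show "(\<integral>x. a x * V x powr \<beta> * U x \<partial>M) \<le> (\<integral>x. a x \<partial>M) powr ((s * \<zeta> - 1) / (\<zeta> - 1)) *
      (\<integral>x. a x powr \<zeta> \<partial>M) powr ((1 - s) / (\<zeta> - 1)) * (\<integral>x. V x powr Q \<partial>M) powr (\<beta> / Q) * (\<integral>x. U x powr P \<partial>M) powr (1 / P)"
    using H(2)[unfolded eq, unfolded c1_def c2_def] exps a(3) by simp
qed

text \<open>Write U as a product of two square roots. One is V to the power \<beta> for V = U,
  \<beta> = 1/2 and Q = P; the other takes the place of U with exponent 2 P. The value of s is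
  unchanged.\<close>

lemma weighted_Holder_bound_1:
  fixes a U :: "'m \<Rightarrow> real"
  assumes a: "integrable M a" "integrable M (\<lambda>x. a x powr \<zeta>)" "\<And>x. a x \<ge> 0"
    and exps: "\<zeta> > 1" "P > 0" "1 / \<zeta> < 1 - 1 / P"
    and U: "integrable M (\<lambda>x. U x powr P)" "\<And>x. U x \<ge> 0"
  defines "s \<equiv> 1 - 1 / P"
  shows "integrable M (\<lambda>x. a x * U x)"
    and "(\<integral>x. a x * U x \<partial>M) \<le> (\<integral>x. a x \<partial>M) powr ((s * \<zeta> - 1) / (\<zeta> - 1)) *
      (\<integral>x. a x powr \<zeta> \<partial>M) powr ((1 - s) / (\<zeta> - 1)) * (\<integral>x. U x powr P \<partial>M) powr (1 / P)"
proof -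
  have U': "integrable M (\<lambda>x. (U x powr (1/2)) powr (2 * P))" using U by (simp add: powr_powr)
  have s': "1 - 1 / (2 * P) - (1/2) / P = s" using exps(2) by (simp add: s_def field_simps)
  have eq: "a x * U x powr (1/2) * U x powr (1/2) = a x * U x" for x
    using U(2)[of x] powr_add[of "U x" "1/2" "1/2"] by (simp add: mult.assoc)
  have eq': "(\<integral>x. U x powr P \<partial>M) powr ((1/2) / P) * (\<integral>x. (U x powr (1/2)) powr (2 * P) \<partial>M) powr (1 / (2 * P))
      = (\<integral>x. U x powr P \<partial>M) powr (1 / P)"
    using exps(2) by (simp add: powr_powr powr_add[symmetric])
  note W = weighted_Holder_bound[OF a exps(1) _ exps(2) _ _ U' powr_ge_zero U, of "1/2", unfolded s' eq]
  show "integrable M (\<lambda>x. a x * U x)" using W(1) exps by (simp add: s_def)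
  show "(\<integral>x. a x * U x \<partial>M) \<le> (\<integral>x. a x \<partial>M) powr ((s * \<zeta> - 1) / (\<zeta> - 1)) *
      (\<integral>x. a x powr \<zeta> \<partial>M) powr ((1 - s) / (\<zeta> - 1)) * (\<integral>x. U x powr P \<partial>M) powr (1 / P)"
    using W(2) exps unfolding mult.assoc eq' by (simp add: s_def mult.assoc)
qed

lemma integrable_truncation:
  fixes u :: "'m \<Rightarrow> real"
  assumes [measurable]: "u \<in> borel_measurable M" and "integrable M (\<lambda>x. \<bar>u x\<bar> powr P)" "k \<ge> 0" "P > 0"
  shows "integrable M (\<lambda>x. max 0 (u x - k) powr P)"
proof (rule Bochner_Integration.integrable_bound[OF assms(2)])
  show "AE x in M. norm (max 0 (u x - k) powr P) \<le> norm (\<bar>u x\<bar> powr P)"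
    using assms(3,4) by (auto intro!: powr_mono2)
qed measurable

text \<open>Markov's inequality for the truncation at k, which is at least h - k where u > h. The
  first part, used with k = 0, supplies the finiteness that \<open>level\<close> cannot
  express.\<close>

lemma level_set_Markov:
  fixes u :: "'m \<Rightarrow> real"
  assumes [measurable]: "u \<in> borel_measurable M" and int: "integrable M (\<lambda>x. \<bar>u x\<bar> powr P)"
    and kh: "0 \<le> k" "k < h" "P > 0"
  shows "emeasure M {x \<in> space M. u x > h} < \<infinity>"
    and "(h - k) powr P * level M u h \<le> (\<integral>x. max 0 (u x - k) powr P \<partial>M)"
proof -
  note i = integrable_truncation[OF assms(1) int kh(1,3)]
  define A where "A = {x \<in> space M. u x > h}"
  have [measurable]: "A \<in> sets M" unfolding A_def by measurable
  have pt: "(h - k) powr P * indicator A x \<le> max 0 (u x - k) powr P" for x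
    using kh by (auto simp: A_def indicator_def intro!: powr_mono2)
  have "ennreal ((h - k) powr P) * emeasure M A = (\<integral>\<^sup>+x. ennreal ((h - k) powr P) * indicator A x \<partial>M)"
    by (simp add: nn_integral_cmult_indicator)
  also have "\<dots> \<le> (\<integral>\<^sup>+x. ennreal (max 0 (u x - k) powr P) \<partial>M)"
  proof (intro nn_integral_mono)
    fix x show "ennreal ((h - k) powr P) * indicator A x \<le> ennreal (max 0 (u x - k) powr P)"
      using pt[of x] by (auto simp: indicator_def ennreal_leI split: if_splits)
  qed
  also have "\<dots> = ennreal (\<integral>x. max 0 (u x - k) powr P \<partial>M)"
    by (rule nn_integral_eq_integral[OF i]) simp
  finally have le: "ennreal ((h - k) powr P) * emeasure M A \<le> ennreal (\<integral>x. max 0 (u x - k) powr P \<partial>M)" .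
  have "emeasure M A \<noteq> top"
  proof
    assume "emeasure M A = top"
    with le kh show False by (simp add: ennreal_mult_top top_unique)
  qed
  then show fin: "emeasure M {x \<in> space M. u x > h} < \<infinity>" by (simp add: A_def less_top)
  have "emeasure M A = ennreal (measure M A)"
    using fin by (intro emeasure_eq_ennreal_measure) (auto simp: A_def)
  with le have "ennreal ((h - k) powr P * measure M A) \<le> ennreal (\<integral>x. max 0 (u x - k) powr P \<partial>M)"
    by (simp add: ennreal_mult')
  then show "(h - k) powr P * level M u h \<le> (\<integral>x. max 0 (u x - k) powr P \<partial>M)"
    by (subst (asm) ennreal_le_iff) (auto simp: A_def level_def)
qed

text \<open>The data of one equation. The other equation is an instance with P and Q exchanged, so
  each estimate is proved once.\<close>

locale truncation_estimate =
  fixes M :: "'m measure" and p P Q K \<beta> \<zeta> :: real and a :: "'m \<Rightarrow> real"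
  assumes a: "integrable M a" "integrable M (\<lambda>x. a x powr \<zeta>)" "\<And>x. a x \<ge> 0"
    and exps: "p > 1" "P > p" "Q > 0" "\<beta> > 0" "K \<ge> 0" "\<zeta> > 0" "1 / \<zeta> \<le> 1 - p / P - \<beta> / Q"
begin

lemma zeta_gt_1: "\<zeta> > 1"
proof -
  have "p / P > 0" "\<beta> / Q > 0" using exps by auto
  then have "1 / \<zeta> < 1" using exps(7) by linarith
  then show ?thesis using exps(6) by (simp add: field_simps)
qed

text \<open>Since p > 1, there is a gap between 1/P and p/P. It keeps all weights in Hoelder's
  inequality positive even if the condition on \<zeta> is an equality.\<close>

lemma exps_strict: "1 / \<zeta> < 1 - 1 / P - \<beta> / Q" "1 / \<zeta> < 1 - 1 / P"
proof -
  have "1 / P < p / P" "\<beta> / Q > 0" using exps by (auto simp: divide_strict_right_mono)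
  then show "1 / \<zeta> < 1 - 1 / P - \<beta> / Q" "1 / \<zeta> < 1 - 1 / P" using exps(7) by linarith+
qed

text \<open>The truncation inequality at k = 1/2, in the form required by
  \<open>crossed_powers_bounded\<close>. On the right v enters through its truncation too, because
  no other norm of v can be bounded uniformly.\<close>

lemma a_priori:
  obtains C where "C \<ge> 0"
    "\<And>u v. truncation_energy M p P K a \<beta> u v \<Longrightarrow> integrable M (\<lambda>x. \<bar>v x\<bar> powr Q) \<Longrightarrow>
       ((\<integral>x. max 0 (u x - 1/2) powr P \<partial>M) powr (1 / P)) powr (p - 1)
         \<le> C * (1 + ((\<integral>x. max 0 (v x - 1/2) powr Q \<partial>M) powr (1 / Q)) powr \<beta>)"
proof -
  define s where "s = 1 - 1 / P - \<beta> / Q"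
  define s' where "s' = 1 - 1 / P"
  define D where "D = (\<integral>x. a x \<partial>M) powr ((s * \<zeta> - 1) / (\<zeta> - 1)) * (\<integral>x. a x powr \<zeta> \<partial>M) powr ((1 - s) / (\<zeta> - 1))"
  define D' where "D' = (\<integral>x. a x \<partial>M) powr ((s' * \<zeta> - 1) / (\<zeta> - 1)) * (\<integral>x. a x powr \<zeta> \<partial>M) powr ((1 - s') / (\<zeta> - 1))"
  have DD: "D \<ge> 0" "D' \<ge> 0" by (auto simp: D_def D'_def)
  define E where "E = max (2 * D') (2 powr \<beta> * D)"
  have E: "E \<ge> 0" "2 * D' \<le> E" "2 powr \<beta> * D \<le> E" using DD by (auto simp: E_def)
  have P: "P > 0" "P > 1" using exps by auto
  show ?thesis
  proof (rule that[of "K powr p * E"])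
    show "K powr p * E \<ge> 0" using E by simp
    fix u v :: "'m \<Rightarrow> real"
    assume en: "truncation_energy M p P K a \<beta> u v" and iv: "integrable M (\<lambda>x. \<bar>v x\<bar> powr Q)"
    note [measurable] = truncation_energyD(1,2)[OF en]
    note iu = truncation_energyD(3)[OF en] and vpos = truncation_energyD(4)[OF en]
    define U where "U x = max 0 (u x - 1/2)" for x
    define V where "V x = max 0 (v x - 1/2)" for x
    have UV: "U x \<ge> 0" "V x \<ge> 0" for x by (auto simp: U_def V_def)
    have iU: "integrable M (\<lambda>x. U x powr P)" unfolding U_def by (rule integrable_truncation[OF _ iu]) (use P in auto)
    have iV: "integrable M (\<lambda>x. V x powr Q)" unfolding V_def by (rule integrable_truncation[OF _ iv]) (use exps in auto)
    define X where "X = (\<integral>x. U x powr P \<partial>M) powr (1 / P)"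
    define Y where "Y = (\<integral>x. V x powr Q \<partial>M) powr (1 / Q)"
    have XY: "X \<ge> 0" "Y \<ge> 0" by (auto simp: X_def Y_def)
    note H = weighted_Holder_bound[OF a zeta_gt_1 P(1) exps(3,4) exps_strict(1) iU UV(1) iV UV(2)]
    note H' = weighted_Holder_bound_1[OF a zeta_gt_1 P(1) exps_strict(2) iU UV(1)]
    have Yb: "(\<integral>x. V x powr Q \<partial>M) powr (\<beta> / Q) = Y powr \<beta>" using exps by (simp add: Y_def powr_powr)
    define g where "g x = 2 * (a x * U x) + 2 powr \<beta> * (a x * V x powr \<beta> * U x)" for x
    have ig: "integrable M g" unfolding g_def using H(1) H'(1) by simp
    have "(\<integral>x. g x \<partial>M) \<le> 2 * (D' * X) + 2 powr \<beta> * (D * Y powr \<beta> * X)"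
      unfolding g_def using H H' by (simp add: D_def D'_def X_def Yb s_def s'_def mult_left_mono add_mono)
    also have "\<dots> = (2 * D' + (2 powr \<beta> * D) * Y powr \<beta>) * X" by (simp add: algebra_simps)
    also have "\<dots> \<le> (E * (1 + Y powr \<beta>)) * X"
    proof (rule mult_right_mono[OF _ XY(1)])
      have "(2 powr \<beta> * D) * Y powr \<beta> \<le> E * Y powr \<beta>" using E by (intro mult_right_mono) auto
      then show "2 * D' + (2 powr \<beta> * D) * Y powr \<beta> \<le> E * (1 + Y powr \<beta>)"
        using E(2) by (simp only: distrib_left mult_1_right add_mono)
    qed
    finally have gX: "(\<integral>x. g x \<partial>M) \<le> (E * (1 + Y powr \<beta>)) * X" .
    have am: "a \<in> borel_measurable M" using a(1) by (rule borel_measurable_integrable)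
    note [measurable] = am
    have pt: "AE x in M. norm (a x * (1 + v x powr \<beta>) * U x) \<le> g x"
      using vpos
    proof eventually_elim
      case (elim x)
      \<comment> \<open>Passage to the truncation V: either v \<le> 1, or v \<le> 2 (v -
        1/2).\<close>
      have "v x powr \<beta> \<le> 1 + (2 * V x) powr \<beta>"
      proof (cases "v x \<le> 1")
        case True
        then have "v x powr \<beta> \<le> 1" using elim exps by (simp add: powr_le1)
        then show ?thesis by (simp add: add_increasing2)
      next
        case False
        then have "v x powr \<beta> \<le> (2 * V x) powr \<beta>" using exps by (intro powr_mono2) (auto simp: V_def)
        then show ?thesis by simp
      qed
      then have "1 + v x powr \<beta> \<le> 2 + 2 powr \<beta> * V x powr \<beta>" by (simp add: powr_mult)
      then have "(a x * U x) * (1 + v x powr \<beta>) \<le> (a x * U x) * (2 + 2 powr \<beta> * V x powr \<beta>)"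
        using a(3)[of x] UV(1)[of x] by (intro mult_left_mono) auto
      then show ?case using a(3)[of x] UV(1)[of x] by (simp add: g_def abs_mult algebra_simps)
    qed
    have "U \<in> borel_measurable M" unfolding U_def by measurable
    note [measurable] = this
    have ih: "integrable M (\<lambda>x. a x * (1 + v x powr \<beta>) * U x)"
      by (rule Bochner_Integration.integrable_bound[OF ig]) (use pt in \<open>auto elim!: eventually_mono\<close>)
    have "(\<integral>x. a x * (1 + v x powr \<beta>) * U x \<partial>M) \<le> (\<integral>x. g x \<partial>M)"
      using pt by (intro integral_mono_AE[OF ih ig]) (auto elim!: eventually_mono simp: abs_le_iff)
    with gX have hX: "(\<integral>x. a x * (1 + v x powr \<beta>) * U x \<partial>M) \<le> (E * (1 + Y powr \<beta>)) * X" by simp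
    have h0: "0 \<le> (\<integral>x. a x * (1 + v x powr \<beta>) * U x \<partial>M)"
      using a(3) UV(1) by (intro integral_nonneg_AE) auto
    have "X \<le> K * (\<integral>x. a x * (1 + v x powr \<beta>) * U x \<partial>M) powr (1 / p)"
      using truncation_energyD(5)[OF en, of "1/2"] ih by (simp add: X_def U_def)
    also have "\<dots> \<le> K * ((E * (1 + Y powr \<beta>)) * X) powr (1 / p)"
      using exps hX h0 by (intro mult_left_mono powr_mono2) auto
    finally have "X powr (p - 1) \<le> K powr p * (E * (1 + Y powr \<beta>))"
      using absorb_root[OF exps(1) XY(1) _ exps(5)] E by simp
    then show "((\<integral>x. max 0 (u x - 1/2) powr P \<partial>M) powr (1 / P)) powr (p - 1)
         \<le> K powr p * E * (1 + ((\<integral>x. max 0 (v x - 1/2) powr Q \<partial>M) powr (1 / Q)) powr \<beta>)"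
      by (simp add: X_def Y_def U_def V_def mult.assoc)
  qed
qed

text \<open>Hoelder's inequality with a in L^\<zeta>, U in L^P, the power \<beta>/r of an integrable
  function built from v, and the indicator of {u > k}. The remaining weight e falls to the
  indicator, and \<delta> = e P/(p - 1) results after absorbing U and applying Markov's
  inequality.\<close>

lemma level_estimate:
  assumes r: "r \<ge> Q" and \<Lambda>: "\<Lambda> \<ge> 0" "B \<ge> 0"
  defines "\<delta> \<equiv> (1 - 1 / \<zeta> - 1 / P - \<beta> / r) * P / (p - 1)"
  obtains C where "C > 0"
    "\<And>u v k h. truncation_energy M p P K a \<beta> u v \<Longrightarrow> level M u 1 \<le> \<Lambda> \<Longrightarrow> moment_le M r B v \<Longrightarrow>
       1 \<le> k \<Longrightarrow> k < h \<Longrightarrow> level M u h \<le> C * (h - k) powr (- P) * level M u k powr \<delta>"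
proof -
  have P: "P > 0" "P > 1" using exps by auto
  have r0: "r > 0" using r exps by simp
  define e where "e = 1 - 1 / \<zeta> - 1 / P - \<beta> / r"
  have "\<beta> / r \<le> \<beta> / Q" using r exps by (intro divide_left_mono) auto
  then have e: "e > 0" using exps_strict(1) by (simp add: e_def)
  define N where "N = (\<integral>x. a x powr \<zeta> \<partial>M) powr (1 / \<zeta>)"
  define c where "c = 2 * N * (\<Lambda> + B) powr (\<beta> / r)"
  define C where "C = (K powr p * c) powr (P / (p - 1)) + 1"
  have c: "c \<ge> 0" by (simp add: c_def N_def)
  show ?thesis
  proof (rule that[of C])
    show "C > 0" by (simp add: C_def add_nonneg_pos)
    fix u v :: "'m \<Rightarrow> real" and k h :: real
    assume en: "truncation_energy M p P K a \<beta> u v" and uL: "level M u 1 \<le> \<Lambda>"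
      and vB: "moment_le M r B v" and k: "1 \<le> k" "k < h"
    note [measurable] = truncation_energyD(1,2)[OF en]
    note iu = truncation_energyD(3)[OF en] and vpos = truncation_energyD(4)[OF en]
    note iv = conjunct1[OF vB[unfolded moment_le_def]]
    define A where "A t = {x \<in> space M. u x > t}" for t
    have [measurable]: "A t \<in> sets M" for t unfolding A_def by measurable
    have Afin: "emeasure M (A t) < \<infinity>" if "t \<ge> 1" for t
      unfolding A_def by (rule level_set_Markov(1)[OF _ iu, of 0]) (use that P in auto)
    have iA: "integrable M (indicator (A t) :: 'm \<Rightarrow> real)" if "t \<ge> 1" for t
      using Afin[OF that] by (intro integrable_real_indicator) auto
    have mA: "(\<integral>x. indicator (A t) x \<partial>M) = measure M (A t)" for t
      using sets.sets_into_space[of "A t" M] by (simp add: Int_absorb1)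
    define U where "U x = max 0 (u x - k)" for x
    have U0: "U x \<ge> 0" for x by (simp add: U_def)
    have mU[measurable]: "U \<in> borel_measurable M" unfolding U_def by measurable
    have iU: "integrable M (\<lambda>x. U x powr P)" unfolding U_def by (rule integrable_truncation[OF _ iu]) (use k P in auto)
    define X where "X = (\<integral>x. U x powr P \<partial>M) powr (1 / P)"
    have X0: "X \<ge> 0" by (simp add: X_def)
    \<comment> \<open>Here 1 + v^\<beta> is replaced by 2 max(1, v)^\<beta>. Since U lives on u > k
      \<ge> 1, cutting off to u > 1 is free; it makes the constant part integrable and bounds the
      integral of z by \<Lambda> + B.\<close>
    define z where "z x = indicator (A 1) x * max 1 (v x) powr r" for x
    have z0: "z x \<ge> 0" for x by (simp add: z_def)
    have zle: "z x \<le> indicator (A 1) x + indicator {x. v x > 1} x * \<bar>v x\<bar> powr r" for x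
      by (auto simp: z_def indicator_def max_def)
    have iz': "integrable M (\<lambda>x. indicator (A 1) x + indicator {x. v x > 1} x * \<bar>v x\<bar> powr r)"
      by (intro Bochner_Integration.integrable_add iA iv) simp
    have mz: "z \<in> borel_measurable M" unfolding z_def by measurable
    have iz: "integrable M z"
      by (rule Bochner_Integration.integrable_bound[OF iz' mz]) (use z0 zle in \<open>auto intro!: AE_I2 order.trans[OF zle]\<close>)
    have zB: "(\<integral>x. z x \<partial>M) \<le> \<Lambda> + B"
    proof -
      have "(\<integral>x. z x \<partial>M) \<le> (\<integral>x. indicator (A 1) x + indicator {x. v x > 1} x * \<bar>v x\<bar> powr r \<partial>M)"
        by (rule integral_mono[OF iz iz']) (rule zle)
      also have "\<dots> = measure M (A 1) + (\<integral>x. indicator {x. v x > 1} x * \<bar>v x\<bar> powr r \<partial>M)"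
        using iA[of 1] iv by (simp only: Bochner_Integration.integral_add mA)
      finally show ?thesis using uL vB by (simp add: A_def level_def moment_le_def)
    qed
    have sum1: "1 / \<zeta> + 1 / P + \<beta> / r + e = 1" by (simp add: e_def)
    note H = integral_Holder4[OF _ _ _ e sum1 a(2) iU iz iA[OF k(1)]]
    have zpos: "1 / \<zeta> > 0" "1 / P > 0" "\<beta> / r > 0" using exps P r0 by auto
    have am: "a \<in> borel_measurable M" using a(1) by (rule borel_measurable_integrable)
    note [measurable] = am
    define g where "g x = (a x powr \<zeta>) powr (1 / \<zeta>) * (U x powr P) powr (1 / P) * z x powr (\<beta> / r) * indicator (A k) x powr e" for x
    have ig: "integrable M g" unfolding g_def using H(1) zpos z0 by simp
    have gle: "(\<integral>x. g x \<partial>M) \<le> N * X * (\<Lambda> + B) powr (\<beta> / r) * measure M (A k) powr e"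
    proof -
      have "(\<integral>x. g x \<partial>M) \<le> N * X * (\<integral>x. z x \<partial>M) powr (\<beta> / r) * measure M (A k) powr e"
        unfolding g_def using H(2) zpos z0 by (simp add: N_def X_def mA)
      also have "\<dots> \<le> N * X * (\<Lambda> + B) powr (\<beta> / r) * measure M (A k) powr e"
        using zB zpos X0 z0 by (intro mult_right_mono mult_left_mono powr_mono2) (auto simp: N_def intro!: integral_nonneg_AE)
      finally show ?thesis .
    qed
    have pt: "AE x in M. norm (a x * (1 + v x powr \<beta>) * U x) \<le> 2 * g x"
      using vpos AE_space
    proof eventually_elim
      case (elim x)
      show ?case
      proof (cases "u x > k")
        case True
        then have xA: "x \<in> A k" "x \<in> A 1" using elim k by (auto simp: A_def)
        have g: "g x = a x * U x * max 1 (v x) powr \<beta>"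
          using xA a(3)[of x] U0[of x] exps P r0 by (simp add: g_def z_def powr_powr)
        have "v x powr \<beta> \<le> max 1 (v x) powr \<beta>" "1 \<le> max 1 (v x) powr \<beta>"
          using elim exps by (auto intro!: powr_mono2 ge_one_powr_ge_zero)
        then have "(a x * U x) * (1 + v x powr \<beta>) \<le> (a x * U x) * (2 * max 1 (v x) powr \<beta>)"
          using a(3)[of x] U0[of x] by (intro mult_left_mono) auto
        then show ?thesis using a(3)[of x] U0[of x] by (simp add: g abs_mult ac_simps)
      next
        case False
        then have "U x = 0" by (simp add: U_def)
        then show ?thesis by (simp add: g_def)
      qed
    qed
    have ig2: "integrable M (\<lambda>x. 2 * g x)" using ig by simp
    have ih: "integrable M (\<lambda>x. a x * (1 + v x powr \<beta>) * U x)"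
      by (rule Bochner_Integration.integrable_bound[OF ig2]) (use pt in \<open>auto elim!: eventually_mono\<close>)
    have "(\<integral>x. a x * (1 + v x powr \<beta>) * U x \<partial>M) \<le> (\<integral>x. 2 * g x \<partial>M)"
      using pt by (intro integral_mono_AE[OF ih ig2]) (auto elim!: eventually_mono simp: abs_le_iff)
    also have "\<dots> \<le> (c * measure M (A k) powr e) * X"
      using gle by (simp add: c_def ac_simps)
    finally have hX: "(\<integral>x. a x * (1 + v x powr \<beta>) * U x \<partial>M) \<le> (c * measure M (A k) powr e) * X" .
    have h0: "0 \<le> (\<integral>x. a x * (1 + v x powr \<beta>) * U x \<partial>M)"
      using a(3) U0 by (intro integral_nonneg_AE) auto
    have "X \<le> K * (\<integral>x. a x * (1 + v x powr \<beta>) * U x \<partial>M) powr (1 / p)"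
      using truncation_energyD(5)[OF en, of k] ih k by (simp add: X_def U_def)
    also have "\<dots> \<le> K * ((c * measure M (A k) powr e) * X) powr (1 / p)"
      using exps hX h0 by (intro mult_left_mono powr_mono2) auto
    finally have "X powr (p - 1) \<le> K powr p * (c * measure M (A k) powr e)"
      using absorb_root[OF exps(1) X0 _ exps(5)] c by simp
    then have "(X powr (p - 1)) powr (P / (p - 1)) \<le> (K powr p * c * measure M (A k) powr e) powr (P / (p - 1))"
      using exps P by (intro powr_mono2) (auto simp: mult.assoc)
    also have "(X powr (p - 1)) powr (P / (p - 1)) = (\<integral>x. U x powr P \<partial>M)"
      using exps P by (simp add: X_def powr_powr)
    also have "(K powr p * c * measure M (A k) powr e) powr (P / (p - 1)) = (K powr p * c) powr (P / (p - 1)) * measure M (A k) powr \<delta>"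
      by (simp add: powr_mult powr_powr \<delta>_def e_def)
    also have "\<dots> \<le> C * measure M (A k) powr \<delta>"
      by (intro mult_right_mono) (auto simp: C_def)
    finally have "(\<integral>x. U x powr P \<partial>M) \<le> C * measure M (A k) powr \<delta>" .
    moreover have "(h - k) powr P * measure M (A h) \<le> (\<integral>x. U x powr P \<partial>M)"
      unfolding A_def U_def level_def[symmetric] by (rule level_set_Markov(2)[OF _ iu]) (use k P in auto)
    ultimately have "(h - k) powr P * measure M (A h) \<le> C * measure M (A k) powr \<delta>" by simp
    then show "level M u h \<le> C * (h - k) powr (- P) * level M u k powr \<delta>"
      using k by (simp add: A_def level_def powr_minus_divide field_simps)
  qed
qed

end

text \<open>The reason for truncating at 1/2 and measuring levels from 1: where u > 1, one has u
  \<le> 2 (u - 1/2), so the truncated norm controls both the level at 1 and the moment.\<close>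

lemma truncation_norm_bounds:
  fixes u :: "'m \<Rightarrow> real"
  assumes u[measurable]: "u \<in> borel_measurable M" and iu: "integrable M (\<lambda>x. \<bar>u x\<bar> powr P)" and P: "P > 0"
    and R: "(\<integral>x. max 0 (u x - 1/2) powr P \<partial>M) powr (1 / P) \<le> R"
  shows "level M u 1 \<le> 2 powr P * R powr P" "moment_le M P (2 powr P * R powr P) u"
proof -
  define I where "I = (\<integral>x. max 0 (u x - 1/2) powr P \<partial>M)"
  have "I \<ge> 0" by (simp add: I_def)
  have "(I powr (1 / P)) powr P \<le> R powr P"
    using R P by (intro powr_mono2) (auto simp: I_def)
  then have I: "I \<le> R powr P" using \<open>I \<ge> 0\<close> P by (simp add: powr_powr)
  have "(1 - 1/2) powr P * level M u 1 \<le> I"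
    unfolding I_def by (rule level_set_Markov(2)[OF u iu]) (use P in auto)
  then have "level M u 1 \<le> 2 powr P * I"
    by (simp add: powr_divide field_simps)
  also have "\<dots> \<le> 2 powr P * R powr P" using I by (intro mult_left_mono) auto
  finally show "level M u 1 \<le> 2 powr P * R powr P" .
  have ii: "integrable M (\<lambda>x. 2 powr P * max 0 (u x - 1/2) powr P)"
    by (intro integrable_mult_right integrable_truncation[OF u iu]) (use P in auto)
  have le: "indicator {x. u x > 1} x * \<bar>u x\<bar> powr P \<le> 2 powr P * max 0 (u x - 1/2) powr P" for x
    using P by (auto simp: indicator_def powr_mult[symmetric] intro!: powr_mono2)
  have i: "integrable M (\<lambda>x. indicator {x. u x > 1} x * \<bar>u x\<bar> powr P)"
    by (rule Bochner_Integration.integrable_bound[OF ii measurable_moment[OF u]]) (use le in auto)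
  have "(\<integral>x. indicator {x. u x > 1} x * \<bar>u x\<bar> powr P \<partial>M) \<le> (\<integral>x. 2 powr P * max 0 (u x - 1/2) powr P \<partial>M)"
    by (rule integral_mono[OF i ii]) (rule le)
  also have "\<dots> \<le> 2 powr P * R powr P" using I by (simp add: I_def mult_left_mono)
  finally show "moment_le M P (2 powr P * R powr P) u" using i by (simp add: moment_le_def)
qed

context truncation_estimate
begin

text \<open>With only the critical integrability of \<open>v\<close> the level set inequality is linear, so the level
  sets of \<open>u\<close> decay faster than any power and \<open>u\<close> gains integrability.\<close>

lemma higher_moment:
  assumes \<Lambda>: "\<Lambda> > 0"
  obtains B where "B \<ge> 0"
    "\<And>u v. truncation_energy M p P K a \<beta> u v \<Longrightarrow> level M u 1 \<le> \<Lambda> \<Longrightarrow> moment_le M Q \<Lambda> v \<Longrightarrow> moment_le M (2 * P) B u"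
proof -
  have P: "P > 0" using exps by auto
  define \<delta> where "\<delta> = (1 - 1 / \<zeta> - 1 / P - \<beta> / Q) * P / (p - 1)"
  \<comment> \<open>The condition on \<zeta>, rearranged: it says that \<delta> \<ge> 1.\<close>
  have "(p - 1) / P \<le> 1 - 1 / \<zeta> - 1 / P - \<beta> / Q" using exps(7) by (simp add: diff_divide_distrib)
  then have "(p - 1) / P * P / (p - 1) \<le> \<delta>"
    unfolding \<delta>_def using exps P by (intro divide_right_mono mult_right_mono) auto
  then have \<delta>: "\<delta> \<ge> 1" using exps P by simp
  obtain C where C: "C > 0" and lev:
    "\<And>u v k h. truncation_energy M p P K a \<beta> u v \<Longrightarrow> level M u 1 \<le> \<Lambda> \<Longrightarrow> moment_le M Q \<Lambda> v \<Longrightarrow>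
       1 \<le> k \<Longrightarrow> k < h \<Longrightarrow> level M u h \<le> C * (h - k) powr (- P) * level M u k powr \<delta>"
    unfolding \<delta>_def by (rule level_estimate[of Q \<Lambda> \<Lambda>]) (use \<Lambda> in \<open>auto simp: less_imp_le\<close>)
  have C': "C * \<Lambda> powr (\<delta> - 1) > 0" using C \<Lambda> by simp
  have PP: "2 * P > 0" using P by simp
  obtain B where B: "B \<ge> 0" and mom:
    "\<And>(N :: 'm measure) u. u \<in> borel_measurable N \<Longrightarrow> (\<And>k. k \<ge> 1 \<Longrightarrow> emeasure N {x \<in> space N. u x > k} < \<infinity>) \<Longrightarrow>
       level N u 1 \<le> \<Lambda> \<Longrightarrow> (\<And>k h. 1 \<le> k \<Longrightarrow> k < h \<Longrightarrow> level N u h \<le> (C * \<Lambda> powr (\<delta> - 1)) * (h - k) powr (- P) * level N u k) \<Longrightarrow>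
       moment_le N (2 * P) B u"
    by (rule dyadic_levels_moment[OF P C' \<Lambda> PP]) blast
  show ?thesis
  proof (rule that[OF B], rule mom)
    fix u v :: "'m \<Rightarrow> real"
    assume en: "truncation_energy M p P K a \<beta> u v" and uL: "level M u 1 \<le> \<Lambda>" and vB: "moment_le M Q \<Lambda> v"
    show u[measurable]: "u \<in> borel_measurable M" and "level M u 1 \<le> \<Lambda>" by (fact truncation_energyD(1)[OF en] uL)+
    show fin: "emeasure M {x \<in> space M. u x > k} < \<infinity>" if "k \<ge> 1" for k
      by (rule level_set_Markov(1)[OF u truncation_energyD(3)[OF en], of 0]) (use that P in auto)
    fix k h :: real assume k: "1 \<le> k" "k < h"
    define m where "m = level M u k"
    have m: "0 \<le> m" by (simp add: m_def level_def)
    have "m \<le> level M u 1"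
      unfolding m_def level_def using k fin[of 1] by (intro measure_mono_fmeasurable) (auto simp: fmeasurable_def)
    then have m1: "m \<le> \<Lambda>" using uL by simp
    \<comment> \<open>As 0 \<le> m \<le> \<Lambda>, the excess power \<delta> - 1 of m goes into the
      constant, and the inequality becomes linear in m. For m = 0 both sides vanish.\<close>
    have "m powr \<delta> = m * m powr (\<delta> - 1)"
      using m by (cases "m = 0") (auto simp: powr_diff)
    also have "\<dots> \<le> m * \<Lambda> powr (\<delta> - 1)" using m m1 \<delta> by (intro mult_left_mono powr_mono2) auto
    finally have mm: "m powr \<delta> \<le> m * \<Lambda> powr (\<delta> - 1)" .
    have "level M u h \<le> C * (h - k) powr (- P) * m powr \<delta>"
      unfolding m_def by (rule lev[OF en uL vB k])
    also have "\<dots> \<le> C * (h - k) powr (- P) * (m * \<Lambda> powr (\<delta> - 1))"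
      using mm C by (intro mult_left_mono) auto
    finally show "level M u h \<le> (C * \<Lambda> powr (\<delta> - 1)) * (h - k) powr (- P) * level M u k"
      by (simp add: m_def ac_simps)
  qed
qed

lemma essential_bound:
  assumes \<Lambda>: "\<Lambda> > 0" "B \<ge> 0"
  obtains R where "R \<ge> 1"
    "\<And>u v. truncation_energy M p P K a \<beta> u v \<Longrightarrow> level M u 1 \<le> \<Lambda> \<Longrightarrow> moment_le M (2 * Q) B v \<Longrightarrow> AE x in M. u x \<le> R"
proof -
  have P: "P > 0" using exps by auto
  define \<delta> where "\<delta> = (1 - 1 / \<zeta> - 1 / P - \<beta> / (2 * Q)) * P / (p - 1)"
  \<comment> \<open>Doubling the moment of v makes the condition on \<zeta> strict, which is what
    gives \<delta> > 1.\<close>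
  have "\<beta> / (2 * Q) < \<beta> / Q" using exps by (simp add: field_simps)
  then have "(p - 1) / P < 1 - 1 / \<zeta> - 1 / P - \<beta> / (2 * Q)" using exps(7) by (simp add: diff_divide_distrib)
  then have "(p - 1) / P * P / (p - 1) < \<delta>"
    unfolding \<delta>_def using exps P by (intro divide_strict_right_mono mult_strict_right_mono) auto
  then have \<delta>: "\<delta> > 1" using exps P by simp
  obtain C where C: "C > 0" and lev:
    "\<And>u v k h. truncation_energy M p P K a \<beta> u v \<Longrightarrow> level M u 1 \<le> \<Lambda> \<Longrightarrow> moment_le M (2 * Q) B v \<Longrightarrow>
       1 \<le> k \<Longrightarrow> k < h \<Longrightarrow> level M u h \<le> C * (h - k) powr (- P) * level M u k powr \<delta>"
    unfolding \<delta>_def by (rule level_estimate[of "2 * Q" \<Lambda> B]) (use \<Lambda> exps in \<open>auto simp: less_imp_le\<close>)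
  obtain R where R: "R \<ge> 1" and St: "\<And>A :: real \<Rightarrow> real. (\<And>k. A k \<ge> 0) \<Longrightarrow> (\<And>k h. 1 \<le> k \<Longrightarrow> k \<le> h \<Longrightarrow> A h \<le> A k) \<Longrightarrow> A 1 \<le> \<Lambda> \<Longrightarrow>
     (\<And>k h. 1 \<le> k \<Longrightarrow> k < h \<Longrightarrow> A h \<le> C * (h - k) powr (- P) * A k powr \<delta>) \<Longrightarrow> A R = 0"
    by (rule Stampacchia_levels[OF \<delta> P less_imp_le[OF C] \<Lambda>(1)]) blast
  show ?thesis
  proof (rule that[OF R])
    fix u v :: "'m \<Rightarrow> real"
    assume en: "truncation_energy M p P K a \<beta> u v" and uL: "level M u 1 \<le> \<Lambda>" and vB: "moment_le M (2 * Q) B v"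
    note u[measurable] = truncation_energyD(1)[OF en]
    have fin: "emeasure M {x \<in> space M. u x > k} < \<infinity>" if "k \<ge> 1" for k
      by (rule level_set_Markov(1)[OF u truncation_energyD(3)[OF en], of 0]) (use that P in auto)
    have "level M u R = 0"
    proof (rule St[of "level M u"])
      show "level M u h \<le> level M u k" if "1 \<le> k" "k \<le> h" for k h
        unfolding level_def using that fin[of k] by (intro measure_mono_fmeasurable) (auto simp: fmeasurable_def)
      show "level M u h \<le> C * (h - k) powr (- P) * level M u k powr \<delta>" if "1 \<le> k" "k < h" for k h
        by (rule lev[OF en uL vB that])
    qed (use uL in \<open>auto simp: level_def\<close>)
    then have "emeasure M {x \<in> space M. u x > R} = 0"
      using fin[OF R] by (simp add: emeasure_eq_ennreal_measure level_def)
    then show "AE x in M. u x \<le> R"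
      by (subst AE_iff_measurable[of "{x \<in> space M. u x > R}"]) (auto simp: not_le)
  qed
qed

end

text \<open>The constants form a chain R0, \<Lambda>, B1 and B2, R1 and R2 without circularity: a
  higher moment of one component needs just the critical moment of the other, and each essential
  bound needs the higher moment of the other.\<close>

theorem coupled_truncation_bound:
  fixes M :: "'m measure"
  assumes L1: "truncation_estimate M p P Q K1 \<beta> \<zeta>1 a1" and L2: "truncation_estimate M q Q P K2 \<alpha> \<zeta>2 a2"
    and \<alpha>\<beta>: "\<beta> < Q / P * (p - 1)" "\<alpha> < P / Q * (q - 1)"
  obtains R where "R > 0"
    "\<And>u v. truncation_energy M p P K1 a1 \<beta> u v \<Longrightarrow> truncation_energy M q Q K2 a2 \<alpha> v u \<Longrightarrow>
       (AE x in M. u x \<le> R) \<and> (AE x in M. v x \<le> R)"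
proof -
  interpret L1: truncation_estimate M p P Q K1 \<beta> \<zeta>1 a1 by (rule L1)
  interpret L2: truncation_estimate M q Q P K2 \<alpha> \<zeta>2 a2 by (rule L2)
  have pos: "p > 1" "q > 1" "P > 0" "Q > 0" "\<alpha> > 0" "\<beta> > 0" using L1.exps L2.exps by auto
  \<comment> \<open>In the product of the two hypotheses the ratios Q/P and P/Q cancel, leaving the
    subcriticality condition of \<open>crossed_powers_bounded\<close>.\<close>
  have "\<alpha> * \<beta> < (P / Q * (q - 1)) * (Q / P * (p - 1))"
    using \<alpha>\<beta> pos by (intro mult_strict_mono) auto
  then have ab: "\<alpha> * \<beta> < (p - 1) * (q - 1)" using pos by (simp add: ac_simps)
  obtain C1 where C1: "C1 \<ge> 0" and ap1:
    "\<And>u v. truncation_energy M p P K1 a1 \<beta> u v \<Longrightarrow> integrable M (\<lambda>x. \<bar>v x\<bar> powr Q) \<Longrightarrow>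
       ((\<integral>x. max 0 (u x - 1/2) powr P \<partial>M) powr (1 / P)) powr (p - 1)
         \<le> C1 * (1 + ((\<integral>x. max 0 (v x - 1/2) powr Q \<partial>M) powr (1 / Q)) powr \<beta>)"
    using L1.a_priori by blast
  obtain C2 where C2: "C2 \<ge> 0" and ap2:
    "\<And>v u. truncation_energy M q Q K2 a2 \<alpha> v u \<Longrightarrow> integrable M (\<lambda>x. \<bar>u x\<bar> powr P) \<Longrightarrow>
       ((\<integral>x. max 0 (v x - 1/2) powr Q \<partial>M) powr (1 / Q)) powr (q - 1)
         \<le> C2 * (1 + ((\<integral>x. max 0 (u x - 1/2) powr P \<partial>M) powr (1 / P)) powr \<alpha>)"
    using L2.a_priori by blast
  obtain R0 where R0: "R0 > 0" and XY: "\<And>X Y. X \<ge> 0 \<Longrightarrow> Y \<ge> 0 \<Longrightarrow> X powr (p - 1) \<le> C1 * (1 + Y powr \<beta>) \<Longrightarrow>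
     Y powr (q - 1) \<le> C2 * (1 + X powr \<alpha>) \<Longrightarrow> X \<le> R0 \<and> Y \<le> R0"
    using crossed_powers_bounded[OF C1 C2 _ _ pos(5,6) ab] pos by auto
  define \<Lambda> where "\<Lambda> = 2 powr P * R0 powr P + 2 powr Q * R0 powr Q"
  have \<Lambda>: "\<Lambda> > 0" "2 powr P * R0 powr P \<le> \<Lambda>" "2 powr Q * R0 powr Q \<le> \<Lambda>"
    using R0 by (auto simp: \<Lambda>_def add_pos_pos)
  obtain B1 where B1: "B1 \<ge> 0" and hm1:
    "\<And>u v. truncation_energy M p P K1 a1 \<beta> u v \<Longrightarrow> level M u 1 \<le> \<Lambda> \<Longrightarrow> moment_le M Q \<Lambda> v \<Longrightarrow> moment_le M (2 * P) B1 u"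
    using L1.higher_moment[OF \<Lambda>(1)] by blast
  obtain B2 where B2: "B2 \<ge> 0" and hm2:
    "\<And>v u. truncation_energy M q Q K2 a2 \<alpha> v u \<Longrightarrow> level M v 1 \<le> \<Lambda> \<Longrightarrow> moment_le M P \<Lambda> u \<Longrightarrow> moment_le M (2 * Q) B2 v"
    using L2.higher_moment[OF \<Lambda>(1)] by blast
  obtain R1 where R1: "R1 \<ge> 1" and eb1:
    "\<And>u v. truncation_energy M p P K1 a1 \<beta> u v \<Longrightarrow> level M u 1 \<le> \<Lambda> \<Longrightarrow> moment_le M (2 * Q) B2 v \<Longrightarrow> AE x in M. u x \<le> R1"
    using L1.essential_bound[OF \<Lambda>(1) B2] by blast
  obtain R2 where R2: "R2 \<ge> 1" and eb2:
    "\<And>v u. truncation_energy M q Q K2 a2 \<alpha> v u \<Longrightarrow> level M v 1 \<le> \<Lambda> \<Longrightarrow> moment_le M (2 * P) B1 u \<Longrightarrow> AE x in M. v x \<le> R2"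
    using L2.essential_bound[OF \<Lambda>(1) B1] by blast
  show ?thesis
  proof (rule that[of "max R1 R2"])
    show "max R1 R2 > 0" using R1 by simp
    fix u v :: "'m \<Rightarrow> real"
    assume e1: "truncation_energy M p P K1 a1 \<beta> u v" and e2: "truncation_energy M q Q K2 a2 \<alpha> v u"
    note u = truncation_energyD(1,3)[OF e1] and v = truncation_energyD(1,3)[OF e2]
    have R: "(\<integral>x. max 0 (u x - 1/2) powr P \<partial>M) powr (1 / P) \<le> R0 \<and> (\<integral>x. max 0 (v x - 1/2) powr Q \<partial>M) powr (1 / Q) \<le> R0"
      by (rule XY[OF _ _ ap1[OF e1 v(2)] ap2[OF e2 u(2)]]) auto
    have tu: "level M u 1 \<le> \<Lambda>" "moment_le M P \<Lambda> u" and tv: "level M v 1 \<le> \<Lambda>" "moment_le M Q \<Lambda> v"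
      using truncation_norm_bounds[OF u pos(3) conjunct1[OF R]] truncation_norm_bounds[OF v pos(4) conjunct2[OF R]] \<Lambda>
      by (auto simp: moment_le_def)
    have "AE x in M. u x \<le> R1" by (rule eb1[OF e1 tu(1) hm2[OF e2 tv(1) tu(2)]])
    then have "AE x in M. u x \<le> max R1 R2" by eventually_elim simp
    moreover have "AE x in M. v x \<le> R2" by (rule eb2[OF e2 tv(1) hm1[OF e1 tu(1) tv(2)]])
    then have "AE x in M. v x \<le> max R1 R2" by eventually_elim simp
    ultimately show "(AE x in M. u x \<le> max R1 R2) \<and> (AE x in M. v x \<le> max R1 R2)" ..
  qed
qed

section \<open>Weak solutions\<close>

text \<open>The truncation itself is the test function: the left side becomes the energy of u
  weighted by \<open>heaviside\<close>, which dominates the energy of the truncation. The bound on h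
  is required where u > 1/2, and the truncation vanishes elsewhere.\<close>

lemma weak_solution_energy:
  fixes u v h a :: "'a::euclidean_space \<Rightarrow> real"
  assumes p: "1 < p" "p < real DIM('a)" and u: "u \<in> D1p_space p" and eq: "weak_p_Laplace_eq p u h"
    and c: "c \<ge> 0" and hb: "AE x in lebesgue. u x > 1/2 \<longrightarrow> h x \<le> c * (a x * (1 + v x powr \<beta>))"
    and a: "\<And>x. a x \<ge> 0" and v: "v \<in> borel_measurable lebesgue" "AE x in lebesgue. v x > 0"
  defines "P \<equiv> critical_exponent DIM('a) p"
  shows "truncation_energy lebesgue p P (4 * (p * (real DIM('a) - 1) / (real DIM('a) - p)) * c powr (1 / p)) a \<beta> u v"
  unfolding truncation_energy_def
proof (intro conjI allI impI v)
  show "u \<in> borel_measurable lebesgue" "integrable lebesgue (\<lambda>x. \<bar>u x\<bar> powr P)"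
    using u by (auto simp: D1p_space_def Lp_space_def P_def)
  fix k :: real assume k: "k \<ge> 1/2"
  assume ig: "integrable lebesgue (\<lambda>x. a x * (1 + v x powr \<beta>) * max 0 (u x - k))"
  define Sob where "Sob = p * (real DIM('a) - 1) / (real DIM('a) - p)"
  have Sob: "Sob \<ge> 0" using p by (simp add: Sob_def)
  define G where "G = weak_grad u"
  define U where "U x = max 0 (u x - k)" for x
  define H where "H x = heaviside (u x - k)" for x
  have Hb: "0 \<le> H x" "H x \<le> 1" for x by (auto simp: H_def heaviside_def)
  note pd = p P_def[THEN meta_eq_to_obj_eq] Sob_def
  have pair: "D1p_pair p u G" unfolding G_def by (rule D1p_imp_pair[OF pd u])
  have tr: "D1p_pair p U (\<lambda>x. H x *\<^sub>R G x)"
    unfolding U_def H_def by (rule D1p_pair_truncation[OF pd pair]) (use k in simp)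
  note UD = D1p_pair_imp_D1p[OF pd tr]
  have GL: "G \<in> Lp_space p" and HL: "(\<lambda>x. H x *\<^sub>R G x) \<in> Lp_space p" and uL: "u \<in> Lp_space P"
    using pair tr by (auto simp: D1p_pair_def P_def)
  have hU: "integrable lebesgue (\<lambda>x. h x * U x)"
    and weq: "(\<integral>x. (norm (G x) powr (p - 2) *\<^sub>R G x) \<bullet> weak_grad U x \<partial>lebesgue) = (\<integral>x. h x * U x \<partial>lebesgue)"
    using eq UD(1) unfolding weak_p_Laplace_eq_def G_def by auto
  note mG[measurable] = Lp_spaceD(1)[OF GL]
  have mu[measurable]: "u \<in> borel_measurable lebesgue" by (rule Lp_spaceD(1)[OF uL])
  have mH[measurable]: "H \<in> borel_measurable lebesgue" unfolding H_def heaviside_def[abs_def] by measurable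
  have mW[measurable]: "weak_grad U \<in> borel_measurable lebesgue"
    using UD(1) by (auto simp: D1p_space_def Lp_space_def)
  have GG: "(norm (G x) powr (p - 2) *\<^sub>R G x) \<bullet> (H x *\<^sub>R G x) = H x * norm (G x) powr p" for x
  proof (cases "G x = 0")
    case False
    then have n: "norm (G x) > 0" by simp
    have "G x \<bullet> G x = norm (G x) powr 2" using n by (simp add: powr_numeral dot_square_norm)
    then have "(norm (G x) powr (p - 2) *\<^sub>R G x) \<bullet> (H x *\<^sub>R G x) = H x * (norm (G x) powr (p - 2) * norm (G x) powr 2)"
      by simp
    also have "norm (G x) powr (p - 2) * norm (G x) powr 2 = norm (G x) powr p" by (simp only: powr_add[symmetric]) simp
    finally show ?thesis .
  qed simp
  have hU_eq: "(\<integral>x. h x * U x \<partial>lebesgue) = (\<integral>x. H x * norm (G x) powr p \<partial>lebesgue)"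
    unfolding weq[symmetric] by (rule integral_cong_AE) (use UD(2) in \<open>auto simp: GG[symmetric] elim!: eventually_mono\<close>)
  have iH: "integrable lebesgue (\<lambda>x. H x * norm (G x) powr p)"
    by (rule Bochner_Integration.integrable_bound[OF Lp_spaceD(2)[OF GL]])
       (use Hb in \<open>auto simp: abs_mult intro!: mult_left_le_one_le\<close>)
  have "(Lp_int p (\<lambda>x. H x *\<^sub>R G x)) \<le> (\<integral>x. H x * norm (G x) powr p \<partial>lebesgue)"
  proof (rule integral_mono[OF Lp_spaceD(2)[OF HL] iH])
    fix x
    \<comment> \<open>Here p > 1 and 0 \<le> H \<le> 1 are used; the value of H on the level set u =
      k is irrelevant.\<close>
    have "H x powr p \<le> H x" using Hb[of x] p powr_mono'[of 1 p "H x"] by simp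
    then show "norm (H x *\<^sub>R G x) powr p \<le> H x * norm (G x) powr p"
      using Hb[of x] by (simp add: powr_mult mult_right_mono)
  qed
  also have "\<dots> = (\<integral>x. h x * U x \<partial>lebesgue)" by (rule hU_eq[symmetric])
  also have "\<dots> \<le> (\<integral>x. c * (a x * (1 + v x powr \<beta>) * U x) \<partial>lebesgue)"
  proof (rule integral_mono_AE[OF hU])
    show "integrable lebesgue (\<lambda>x. c * (a x * (1 + v x powr \<beta>) * U x))" using ig by (simp add: U_def)
    show "AE x in lebesgue. h x * U x \<le> c * (a x * (1 + v x powr \<beta>) * U x)"
      using hb
    proof eventually_elim
      case (elim x)
      show ?case
      proof (cases "u x > k")
        case True
        then have "h x * U x \<le> (c * (a x * (1 + v x powr \<beta>))) * U x"
          using elim k by (intro mult_right_mono) (auto simp: U_def)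
        then show ?thesis by (simp add: mult.assoc)
      qed (simp add: U_def)
    qed
  qed
  also have "\<dots> = c * (\<integral>x. a x * (1 + v x powr \<beta>) * U x \<partial>lebesgue)" by simp
  finally have GI: "(Lp_int p (\<lambda>x. H x *\<^sub>R G x)) \<le> c * (\<integral>x. a x * (1 + v x powr \<beta>) * U x \<partial>lebesgue)" .
  have nn: "0 \<le> (\<integral>x. a x * (1 + v x powr \<beta>) * U x \<partial>lebesgue)"
    using a by (intro integral_nonneg_AE) (auto simp: U_def)
  have "Lp_int P U powr (1 / P) \<le> 4 * Sob * (Lp_int p (\<lambda>x. H x *\<^sub>R G x)) powr (1 / p)"
    by (rule D1p_pair_Sobolev[OF pd tr])
  also have "\<dots> \<le> 4 * Sob * (c * (\<integral>x. a x * (1 + v x powr \<beta>) * U x \<partial>lebesgue)) powr (1 / p)"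
    using GI Sob p by (intro mult_left_mono powr_mono2) auto
  also have "\<dots> = 4 * Sob * c powr (1 / p) * (\<integral>x. a x * (1 + v x powr \<beta>) * U x \<partial>lebesgue) powr (1 / p)"
    by (simp add: powr_mult)
  finally show "(\<integral>x. max 0 (u x - k) powr P \<partial>lebesgue) powr (1 / P) \<le>
    4 * (p * (real DIM('a) - 1) / (real DIM('a) - p)) * c powr (1 / p) * (\<integral>x. a x * (1 + v x powr \<beta>) * max 0 (u x - k) \<partial>lebesgue) powr (1 / p)"
    by (simp add: U_def Sob_def)
qed

lemma Linf_norm_le:
  fixes u :: "'a::euclidean_space \<Rightarrow> real"
  assumes [measurable]: "u \<in> borel_measurable lebesgue" and "AE x in lebesgue. u x > 0" "AE x in lebesgue. u x \<le> R"
  shows "Linf_norm u \<le> ereal R"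
  unfolding Linf_norm_def
proof (rule esssup_I)
  show "AE x in lebesgue. ereal \<bar>u x\<bar> \<le> ereal R" using assms(2,3) by eventually_elim simp
qed measurable

text \<open>Disposes of the singular factors; the bound 2 is the one in \<open>2 * M1\<close> and
  \<open>2 * M2\<close> below.\<close>

lemma negative_powr_bound:
  fixes s \<alpha> :: real
  assumes "-1 < \<alpha>" "\<alpha> < 0" "s > 1/2" shows "s powr \<alpha> \<le> 2"
proof -
  have "s powr \<alpha> \<le> (1/2) powr \<alpha>" using assms by (intro powr_mono2') auto
  also have "\<dots> = 2 powr (- \<alpha>)" by (simp add: powr_divide powr_minus_divide)
  also have "\<dots> \<le> 2 powr 1" using assms by (intro powr_mono) auto
  finally show ?thesis by simp
qed

theorem theorem3p4:
  fixes a1 a2 :: "'a::euclidean_space \<Rightarrow> real"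
    and f g :: "real \<Rightarrow> real \<Rightarrow> real"
    and p1 p2 \<alpha>1 \<beta>1 \<alpha>2 \<beta>2 :: real
  assumes "DIM('a) \<ge> 3"
    and "1 < p1" "p1 < real DIM('a)" "1 < p2" "p2 < real DIM('a)"
    and "hypothesis_fg DIM('a) p1 p2 \<alpha>1 \<beta>1 \<alpha>2 \<beta>2 f g"
    and "hypothesis_a p1 p2 \<beta>1 \<alpha>2 a1 a2"
  shows "\<exists>R::real. R > 0 \<and>
    (\<forall>u v. weak_solution p1 p2 a1 a2 f g u v \<longrightarrow> max (Linf_norm u) (Linf_norm v) \<le> ereal R)"
proof -
  define P where "P = critical_exponent DIM('a) p1"
  define Q where "Q = critical_exponent DIM('a) p2"
  have PQ: "p1 < P" "p2 < Q"
    unfolding P_def Q_def using assms(2-5) by (auto intro: critical_exponent_gt)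
  then have PQ0: "P > 0" "Q > 0" using assms(2,4) by auto
  note H = assms(6)[unfolded hypothesis_fg_def, folded P_def Q_def]
  from H obtain m1 M1 m2 M2 where M: "M1 > 0" "M2 > 0"
    and bd: "\<forall>s>0. \<forall>t>0. m1 * s powr \<alpha>1 \<le> f s t \<and> f s t \<le> M1 * s powr \<alpha>1 * (1 + t powr \<beta>1) \<and>
        m2 * t powr \<beta>2 \<le> g s t \<and> g s t \<le> M2 * (1 + s powr \<alpha>2) * t powr \<beta>2"
    by (elim conjE exE) (rule that; assumption)
  have growth: "f s t \<le> M1 * s powr \<alpha>1 * (1 + t powr \<beta>1)" "g s t \<le> M2 * (1 + s powr \<alpha>2) * t powr \<beta>2"
    if "s > 0" "t > 0" for s t
    using bd[rule_format, OF that] by simp_all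
  from H have ex: "-1 < \<alpha>1" "\<alpha>1 < 0" "-1 < \<beta>2" "\<beta>2 < 0" "0 < \<alpha>2" "0 < \<beta>1"
    and mn: "\<beta>1 < Q / P * min (p1 - 1) (P - p1)" "\<alpha>2 < P / Q * min (p2 - 1) (Q - p2)"
    by simp_all
  obtain \<zeta>1 \<zeta>2 where z: "\<zeta>1 > 0" "\<zeta>2 > 0"
    and aL: "a1 \<in> Lp_space 1" "a1 \<in> Lp_space \<zeta>1" "a2 \<in> Lp_space 1" "a2 \<in> Lp_space \<zeta>2"
    and zb: "1 / \<zeta>1 \<le> 1 - p1 / P - \<beta>1 / Q" "1 / \<zeta>2 \<le> 1 - p2 / Q - \<alpha>2 / P"
    using assms(7) unfolding hypothesis_a_def P_def[symmetric] Q_def[symmetric] by blast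
  have apos: "AE x in lebesgue. a1 x > 0" "AE x in lebesgue. a2 x > 0"
    using assms(7) by (auto simp: hypothesis_a_def)
  \<comment> \<open>The Sobolev constant of \<open>D1p_pair_Sobolev\<close> times the root of the
    growth constant, as delivered by \<open>weak_solution_energy\<close>.\<close>
  define K1 where "K1 = 4 * (p1 * (real DIM('a) - 1) / (real DIM('a) - p1)) * (2 * M1) powr (1 / p1)"
  define K2 where "K2 = 4 * (p2 * (real DIM('a) - 1) / (real DIM('a) - p2)) * (2 * M2) powr (1 / p2)"
  have K: "K1 \<ge> 0" "K2 \<ge> 0" using assms(2-5) by (auto simp: K1_def K2_def)
  \<comment> \<open>The weights are positive almost everywhere, while the locale asks for
    nonnegativity at every point; absolute values bridge the difference.\<close>
  have L1: "truncation_estimate lebesgue p1 P Q K1 \<beta>1 \<zeta>1 (\<lambda>x. \<bar>a1 x\<bar>)"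
    using aL(1,2) assms(2) PQ PQ0 ex z zb K by unfold_locales (auto simp: Lp_space_def)
  have L2: "truncation_estimate lebesgue p2 Q P K2 \<alpha>2 \<zeta>2 (\<lambda>x. \<bar>a2 x\<bar>)"
    using aL(3,4) assms(4) PQ PQ0 ex z zb K by unfold_locales (auto simp: Lp_space_def)
  have b1: "\<beta>1 < Q / P * (p1 - 1)"
    using mn(1) PQ0 mult_left_mono[of "min (p1 - 1) (P - p1)" "p1 - 1" "Q / P"] by simp
  have b2: "\<alpha>2 < P / Q * (p2 - 1)"
    using mn(2) PQ0 mult_left_mono[of "min (p2 - 1) (Q - p2)" "p2 - 1" "P / Q"] by simp
  obtain R where R: "R > 0" and bound:
    "\<And>u v. truncation_energy lebesgue p1 P K1 (\<lambda>x. \<bar>a1 x\<bar>) \<beta>1 u v \<Longrightarrow>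
       truncation_energy lebesgue p2 Q K2 (\<lambda>x. \<bar>a2 x\<bar>) \<alpha>2 v u \<Longrightarrow>
       (AE x in lebesgue. u x \<le> R) \<and> (AE x in lebesgue. v x \<le> R)"
    by (rule coupled_truncation_bound[OF L1 L2 b1 b2]) blast
  have "max (Linf_norm u) (Linf_norm v) \<le> ereal R" if sol: "weak_solution p1 p2 a1 a2 f g u v" for u v
  proof -
    have uv: "u \<in> D1p_space p1" "v \<in> D1p_space p2"
      and up: "AE x in lebesgue. u x > 0" and vp: "AE x in lebesgue. v x > 0"
      and e1: "weak_p_Laplace_eq p1 u (\<lambda>x. a1 x * f (u x) (v x))"
      and e2: "weak_p_Laplace_eq p2 v (\<lambda>x. a2 x * g (u x) (v x))"
      using sol by (auto simp: weak_solution_def)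
    have L: "u \<in> Lp_space P" "v \<in> Lp_space Q" using uv by (auto simp: D1p_space_def P_def Q_def)
    have hb1: "AE x in lebesgue. u x > 1/2 \<longrightarrow> a1 x * f (u x) (v x) \<le> (2 * M1) * (\<bar>a1 x\<bar> * (1 + v x powr \<beta>1))"
      using up vp apos(1)
    proof eventually_elim
      case (elim x)
      show ?case
      proof
        assume "u x > 1/2"
        then have "u x powr \<alpha>1 \<le> 2" by (intro negative_powr_bound ex)
        then have "M1 * u x powr \<alpha>1 * (1 + v x powr \<beta>1) \<le> M1 * 2 * (1 + v x powr \<beta>1)"
          using M by (intro mult_right_mono mult_left_mono) auto
        then have "f (u x) (v x) \<le> M1 * 2 * (1 + v x powr \<beta>1)"
          using growth[OF elim(1,2)] by linarith
        then have "a1 x * f (u x) (v x) \<le> a1 x * (M1 * 2 * (1 + v x powr \<beta>1))"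
          using elim by (intro mult_left_mono) auto
        then show "a1 x * f (u x) (v x) \<le> (2 * M1) * (\<bar>a1 x\<bar> * (1 + v x powr \<beta>1))"
          using elim by (simp add: ac_simps)
      qed
    qed
    have en1: "truncation_energy lebesgue p1 P K1 (\<lambda>x. \<bar>a1 x\<bar>) \<beta>1 u v"
      unfolding P_def K1_def by (rule weak_solution_energy[OF assms(2,3) uv(1) e1 _ hb1 _ Lp_spaceD(1)[OF L(2)] vp]) (use M in auto)
    have hb2: "AE x in lebesgue. v x > 1/2 \<longrightarrow> a2 x * g (u x) (v x) \<le> (2 * M2) * (\<bar>a2 x\<bar> * (1 + u x powr \<alpha>2))"
      using up vp apos(2)
    proof eventually_elim
      case (elim x)
      show ?case
      proof
        assume "v x > 1/2"
        then have "v x powr \<beta>2 \<le> 2" by (intro negative_powr_bound ex)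
        then have "M2 * (1 + u x powr \<alpha>2) * v x powr \<beta>2 \<le> M2 * (1 + u x powr \<alpha>2) * 2"
          using M by (intro mult_left_mono) auto
        then have "g (u x) (v x) \<le> M2 * (1 + u x powr \<alpha>2) * 2"
          using growth[OF elim(1,2)] by linarith
        then have "a2 x * g (u x) (v x) \<le> a2 x * (M2 * (1 + u x powr \<alpha>2) * 2)"
          using elim by (intro mult_left_mono) auto
        then show "a2 x * g (u x) (v x) \<le> (2 * M2) * (\<bar>a2 x\<bar> * (1 + u x powr \<alpha>2))"
          using elim by (simp add: ac_simps)
      qed
    qed
    have en2: "truncation_energy lebesgue p2 Q K2 (\<lambda>x. \<bar>a2 x\<bar>) \<alpha>2 v u"
      unfolding Q_def K2_def by (rule weak_solution_energy[OF assms(4,5) uv(2) e2 _ hb2 _ Lp_spaceD(1)[OF L(1)] up]) (use M in auto)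
    have "(AE x in lebesgue. u x \<le> R) \<and> (AE x in lebesgue. v x \<le> R)"
      by (rule bound[OF en1 en2])
    then show ?thesis
      using Linf_norm_le[OF Lp_spaceD(1)[OF L(1)] up] Linf_norm_le[OF Lp_spaceD(1)[OF L(2)] vp] by simp
  qed
  with R show ?thesis by blast
qed

end
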